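(* Consider the wave equation $u_{tt}-u_{xx}=0$ for $u=u(t,x)$. Put $\xi:=x+t$, $\eta:=x-t$, $\check w_{0l}:=u_{0l}-u_{1,l-1}$ for $l\ge1$ and $\check w_{k0}:=u_{0k}+u_{1,k-1}$ for $k\ge1$. Below, $\check F$ denotes an arbitrary smooth function of $\eta$ and an arbitrary finite number of $\check w_{0l}$, $l\ge1$, i.e. $\check F=\check F(\eta,\check w_{01},\dots,\check w_{0r_1})$, and $\check G$ denotes an arbitrary smooth function of $\xi$ and an arbitrary finite number of $\check w_{k0}$, $k\ge1$, i.e. $\check G=\check G(\xi,\check w_{10},\dots,\check w_{r_20})$, for some $r_1,r_2\in\mathbb N_0$; further, $\check{\mathcal D}_\xi:=\partial_\xi+\sum_{k\ge1}\check w_{k+1,0}\partial_{\check w_{k0}}$, $\check{\mathcal D}_\eta:=\partial_\eta+\sum_{l\ge1}\check w_{0,l+1}\partial_{\check w_{0l}}$, and $C$ denotes an arbitrary constant. (i) The space of (local) conservation laws of the equation $u_{tt}-u_{xx}=0$ is naturally isomorphic to the quotient of the space $\check V$ by the subspace $\check V_0$, where $\check V$ denotes the subspace of conserved currents of the form $(\check F-\check G,\check F+\check G)$ for this equation, and $\check V_0$ denotes the subspace of trivial conserved currents belonging to $\check V$: \[ \check V:=\{(\check F-\check G,\ \check F+\check G)\}\ \supset\ \check V_0:=\{(\check{\mathcal D}_\eta\check F-\check{\mathcal D}_\xi\check G+Cu_{01},\ \check{\mathcal D}_\eta\check F+\check{\mathcal D}_\xi\check G-Cu_{10})\}. \] (ii)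 The quotient space of variational symmetries (or, equivalently, of conservation-law characteristics) of the equation $u_{tt}-u_{xx}=0$ is naturally isomorphic to the subspace of its variational symmetries of the form \[ \mu=-\sum_{l\ge1}(-\check{\mathcal D}_\eta)^{l-1}\partial_{\check w_{0l}}\check F-\sum_{k\ge1}(-\check{\mathcal D}_\xi)^{k-1}\partial_{\check w_{k0}}\check G . \]
   Context: Write $\mathcal U$ for the equation $u_{tt}-u_{xx}=0$ and $u_{ij}:=\partial^{i+j}u/\partial t^i\partial x^j$, $i,j\in\mathbb N_0=\{0,1,2,\dots\}$ (so $u_{00}=u$, $u_{10}=u_t$, $u_{01}=u_x$), regarded as jet variables. A differential function of $u$ is a smooth function of $t$, $x$ and finitely many $u_{ij}$. The total derivative operators are $\mathrm D_t=\partial_t+\sum_{i,j\ge0}u_{i+1,j}\partial_{u_{ij}}$ and $\mathrm D_x=\partial_x+\sum_{i,j\ge0}u_{i,j+1}\partial_{u_{ij}}$. A differential function vanishes on solutions of $\mathcal U$ if it vanishes whenever $u_{i+2,j}=u_{i,j+2}$ for all $i,j\ge0$. In $\check{\mathcal D}_\eta$ (respectively $\check{\mathcal D}_\xi$), which acts on functions of $\eta$ and the $\check w_{0l}$ (respectively of $\xi$ and the $\check w_{k0}$), these arguments are treated as independent coordinates. A conserved current of $\mathcal U$ is a pair $(\rho,\sigma)$ of differential functions ($\rho$ the $t$-component, $\sigma$ the $x$-component) such that $\mathrm D_t\rho+\mathrm D_x\sigma$ vanishes on solutions of $\mathcal U$. It is trivial if it is of the form $(\rho'+\mathrm D_xH,\,\sigma'-\mathrm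 D_tH)$, where $\rho',\sigma',H$ are differential functions and $\rho',\sigma'$ vanish on solutions of $\mathcal U$. The space of (local) conservation laws is the quotient of the space of conserved currents by the subspace of trivial ones. In (i), "naturally isomorphic" means that the isomorphism is induced by the inclusion of $\check V$ into the space of conserved currents. A conservation-law characteristic of $\mathcal U$ is a differential function $\mu$ such that $\mu\cdot(u_{tt}-u_{xx})=\mathrm D_t\rho+\mathrm D_x\sigma$ identically for some differential functions $\rho,\sigma$ (equivalently, $\mathsf E_u(\mu(u_{tt}-u_{xx}))\equiv0$, where $\mathsf E_u=\sum_{i,j\ge0}(-\mathrm D_t)^i(-\mathrm D_x)^j\partial_{u_{ij}}$ is the Euler operator). By Noether's theorem, these are the same as the variational symmetries $\mu\partial_u$ (in evolution form, identified with $\mu$) of the functional with Lagrangian $-\frac12(u_t^2-u_x^2)$, whose Euler–Lagrange equation is $\mathcal U$; "variational symmetries of $\mathcal U$" means variational symmetries of this functional. Two characteristics (variational symmetries) are equivalent if their difference vanishes on solutions of $\mathcal U$, and the quotient space in (ii) is the quotient with respect to this equivalence. In (ii), "naturally isomorphic" means that the isomorphism maps each $\mu$ of the indicated form to its equivalence class. All considerations are local: differential functions may be restricted to a sufficiently small neighbourhood of a point of the solution set of $\mathcal U$ in the jet space; in particular, the representation of the elements of $\check V_0$ is a local one. *)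

theory Defs
  imports
    "HOL-Analysis.Analysis"
    "HOL-Library.Function_Algebras"
    "HOL-Library.Groups_Big_Fun"
begin

section \<open>Quotients of subspaces and natural isomorphisms\<close>

instantiation "fun" :: (type, real_vector) real_vector
begin

definition scaleR_fun :: "real \<Rightarrow> ('a \<Rightarrow> 'b) \<Rightarrow> 'a \<Rightarrow> 'b" where
  "scaleR_fun c f = (\<lambda>x. c *\<^sub>R f x)"

instance
  by standard (simp_all add: scaleR_fun_def fun_eq_iff scaleR_add_right scaleR_add_left)

end

definition coset :: "'a::real_vector set \<Rightarrow> 'a \<Rightarrow> 'a set" where
  "coset W v = {v + w |w. w \<in> W}"

definition quotient_space :: "'a::real_vector set \<Rightarrow> 'a set \<Rightarrow> 'a set set" where
  "quotient_space V W = coset W ` V"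

definition coset_add :: "'a::real_vector set \<Rightarrow> 'a set \<Rightarrow> 'a set" where
  "coset_add A B = {a + b |a b. a \<in> A \<and> b \<in> B}"

text \<open>The summand \<open>w\<close> matters only for \<open>c = 0\<close>, where \<open>c *\<^sub>R a\<close> alone would give \<open>{0}\<close>
  instead of \<open>W\<close>.\<close>

definition coset_scaleR :: "'a::real_vector set \<Rightarrow> real \<Rightarrow> 'a set \<Rightarrow> 'a set" where
  "coset_scaleR W c A = {c *\<^sub>R a + w |a w. a \<in> A \<and> w \<in> W}"

definition quotient_iso ::
  "('a::real_vector set \<Rightarrow> 'a set) \<Rightarrow> 'a set \<Rightarrow> 'a set \<Rightarrow> 'a set \<Rightarrow> 'a set \<Rightarrow> bool" where
  "quotient_iso \<Phi> V V\<^sub>0 W W\<^sub>0 \<longleftrightarrow>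
     bij_betw \<Phi> (quotient_space V V\<^sub>0) (quotient_space W W\<^sub>0) \<and>
     (\<forall>A\<in>quotient_space V V\<^sub>0. \<forall>B\<in>quotient_space V V\<^sub>0.
        \<Phi> (coset_add A B) = coset_add (\<Phi> A) (\<Phi> B)) \<and>
     (\<forall>c. \<forall>A\<in>quotient_space V V\<^sub>0. \<Phi> (coset_scaleR V\<^sub>0 c A) = coset_scaleR W\<^sub>0 c (\<Phi> A))"

text \<open>\<open>V / V\<^sub>0\<close> and \<open>W / W\<^sub>0\<close> are isomorphic vector spaces via the map induced by the inclusion
  of \<open>V\<close> into \<open>W\<close>.\<close>

definition naturally_isomorphic ::
  "'a::real_vector set \<Rightarrow> 'a set \<Rightarrow> 'a set \<Rightarrow> 'a set \<Rightarrow> bool" where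
  "naturally_isomorphic V V\<^sub>0 W W\<^sub>0 \<longleftrightarrow>
     subspace V \<and> subspace V\<^sub>0 \<and> V\<^sub>0 \<subseteq> V \<and>
     subspace W \<and> subspace W\<^sub>0 \<and> W\<^sub>0 \<subseteq> W \<and>
     V \<subseteq> W \<and>
     (\<exists>\<Phi>. quotient_iso \<Phi> V V\<^sub>0 W W\<^sub>0 \<and> (\<forall>v\<in>V. \<Phi> (coset V\<^sub>0 v) = coset W\<^sub>0 v))"

section \<open>Smooth functions of finitely many out of infinitely many variables\<close>

definition partial :: "'v \<Rightarrow> (('v \<Rightarrow> real) \<Rightarrow> real) \<Rightarrow> ('v \<Rightarrow> real) \<Rightarrow> real" where
  "partial v f z = deriv (\<lambda>s. f (z(v := s))) (z v)"

definition C_infinity_on :: "('v \<Rightarrow> real) set \<Rightarrow> (('v \<Rightarrow> real) \<Rightarrow> real) \<Rightarrow> bool" where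
  "C_infinity_on N f \<longleftrightarrow>
     (\<forall>vs. continuous_on N (foldr partial vs f) \<and>
        (\<forall>v. \<forall>z\<in>N. (\<lambda>s. foldr partial vs f (z(v := s))) differentiable (at (z v))))"

definition depends_only_on ::
  "('v \<Rightarrow> real) set \<Rightarrow> 'v set \<Rightarrow> (('v \<Rightarrow> real) \<Rightarrow> real) \<Rightarrow> bool" where
  "depends_only_on N S f \<longleftrightarrow> (\<forall>z\<in>N. \<forall>z'\<in>N. (\<forall>v\<in>S. z v = z' v) \<longrightarrow> f z = f z')"

text \<open>Considerations are local: only the germ of \<open>f\<close> at \<open>p\<close> matters. The topology on
  \<open>'v \<Rightarrow> real\<close> is the product topology, so that a neighbourhood constrains only finitely many
  variables.\<close>

definition smooth_near :: "('v \<Rightarrow> real) \<Rightarrow> (('v \<Rightarrow> real) \<Rightarrow> real) \<Rightarrow> bool" where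
  "smooth_near p f \<longleftrightarrow>
     (\<exists>N S. open N \<and> p \<in> N \<and> finite S \<and> depends_only_on N S f \<and> C_infinity_on N f)"

definition germ_eq ::
  "('v \<Rightarrow> real) \<Rightarrow> (('v \<Rightarrow> real) \<Rightarrow> real) \<Rightarrow> (('v \<Rightarrow> real) \<Rightarrow> real) \<Rightarrow> bool" where
  "germ_eq p f g \<longleftrightarrow> (\<forall>\<^sub>F z in nhds p. f z = g z)"

definition null_germs :: "('v \<Rightarrow> real) \<Rightarrow> (('v \<Rightarrow> real) \<Rightarrow> real) set" where
  "null_germs p = {f. germ_eq p f (\<lambda>z. 0)}"

section \<open>Jet space and the wave equation\<close>

text \<open>\<open>U i j\<close> stands for the \<open>i\<close>-th \<open>t\<close>-derivative of the \<open>j\<close>-th \<open>x\<close>-derivative of \<open>u\<close>.\<close>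

datatype jet_var = T | X | U nat nat

type_synonym jet = "jet_var \<Rightarrow> real"
type_synonym jet_fun = "jet \<Rightarrow> real"

text \<open>Each differential function near \<open>p\<close> is represented by all total functions having its germ
  at \<open>p\<close>. Consequently all the spaces below are closed under changing functions away from \<open>p\<close>.
  The sums over jet variables are finite near \<open>p\<close> for differential functions.\<close>

definition D_t :: "jet_fun \<Rightarrow> jet_fun" where
  "D_t f z = partial T f z + Sum_any (\<lambda>(i, j). z (U (i + 1) j) * partial (U i j) f z)"

definition D_x :: "jet_fun \<Rightarrow> jet_fun" where
  "D_x f z = partial X f z + Sum_any (\<lambda>(i, j). z (U i (j + 1)) * partial (U i j) f z)"

definition solution_set :: "jet set" where
  "solution_set = {z. \<forall>i j. z (U (i + 2) j) = z (U i (j + 2))}"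

definition vanishes_on_solutions :: "jet \<Rightarrow> jet_fun \<Rightarrow> bool" where
  "vanishes_on_solutions p f \<longleftrightarrow> (\<forall>\<^sub>F z in nhds p. z \<in> solution_set \<longrightarrow> f z = 0)"

definition wave_lhs :: jet_fun where
  "wave_lhs z = z (U 2 0) - z (U 0 2)"

subsection \<open>Conservation laws\<close>

definition conserved_currents :: "jet \<Rightarrow> (jet_fun \<times> jet_fun) set" where
  "conserved_currents p =
     {(\<rho>, \<sigma>). smooth_near p \<rho> \<and> smooth_near p \<sigma> \<and>
        vanishes_on_solutions p (\<lambda>z. D_t \<rho> z + D_x \<sigma> z)}"

definition trivial_currents :: "jet \<Rightarrow> (jet_fun \<times> jet_fun) set" where
  "trivial_currents p =
     {(\<rho>, \<sigma>). \<exists>\<rho>' \<sigma>' H. smooth_near p \<rho>' \<and> smooth_near p \<sigma>' \<and> smooth_near p H \<and>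
        vanishes_on_solutions p \<rho>' \<and> vanishes_on_solutions p \<sigma>' \<and>
        germ_eq p \<rho> (\<lambda>z. \<rho>' z + D_x H z) \<and>
        germ_eq p \<sigma> (\<lambda>z. \<sigma>' z - D_t H z)}"

subsection \<open>Characteristics and variational symmetries\<close>

definition characteristics :: "jet \<Rightarrow> jet_fun set" where
  "characteristics p =
     {\<mu>. smooth_near p \<mu> \<and>
        (\<exists>\<rho> \<sigma>. smooth_near p \<rho> \<and> smooth_near p \<sigma> \<and>
           germ_eq p (\<lambda>z. \<mu> z * wave_lhs z) (\<lambda>z. D_t \<rho> z + D_x \<sigma> z))}"

definition Lagrangian :: jet_fun where
  "Lagrangian z = - (1/2) * ((z (U 1 0))\<^sup>2 - (z (U 0 1))\<^sup>2)"

definition prolongation :: "jet_fun \<Rightarrow> jet_fun \<Rightarrow> jet_fun" where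
  "prolongation \<mu> f z =
     Sum_any (\<lambda>(i, j). (D_t ^^ i) ((D_x ^^ j) \<mu>) z * partial (U i j) f z)"

text \<open>\<open>\<mu> \<partial>\<^sub>u\<close> is a variational symmetry iff its prolongation maps the Lagrangian to a total
  divergence.\<close>

definition variational_symmetries :: "jet \<Rightarrow> jet_fun set" where
  "variational_symmetries p =
     {\<mu>. smooth_near p \<mu> \<and>
        (\<exists>A B. smooth_near p A \<and> smooth_near p B \<and>
           germ_eq p (prolongation \<mu> Lagrangian) (\<lambda>z. D_t A z + D_x B z))}"

definition trivial_symmetries :: "jet \<Rightarrow> jet_fun set" where
  "trivial_symmetries p = {\<mu> \<in> variational_symmetries p. vanishes_on_solutions p \<mu>}"

section \<open>Functions of \<open>\<eta>, w\<^sub>0\<^sub>1, w\<^sub>0\<^sub>2, \<dots>\<close> and of \<open>\<xi>, w\<^sub>1\<^sub>0, w\<^sub>2\<^sub>0, \<dots>\<close>\<close>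

text \<open>In both coordinate systems, index \<open>0\<close> is the variable \<open>\<eta> = x - t\<close> (respectively
  \<open>\<xi> = x + t\<close>) and index \<open>l \<ge> 1\<close> is \<open>w\<^sub>0\<^sub>l\<close> (respectively \<open>w\<^sub>l\<^sub>0\<close>).\<close>

definition eta_coords :: "jet \<Rightarrow> nat \<Rightarrow> real" where
  "eta_coords z l = (if l = 0 then z X - z T else z (U 0 l) - z (U 1 (l - 1)))"

definition xi_coords :: "jet \<Rightarrow> nat \<Rightarrow> real" where
  "xi_coords z k = (if k = 0 then z X + z T else z (U 0 k) + z (U 1 (k - 1)))"

text \<open>In independent coordinates the operators for \<open>\<eta>\<close> and for \<open>\<xi>\<close> have the same expression.\<close>

definition D_check :: "((nat \<Rightarrow> real) \<Rightarrow> real) \<Rightarrow> (nat \<Rightarrow> real) \<Rightarrow> real" where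
  "D_check F y = partial 0 F y + Sum_any (\<lambda>l. if l \<ge> 1 then y (l + 1) * partial l F y else 0)"

definition euler_check :: "((nat \<Rightarrow> real) \<Rightarrow> real) \<Rightarrow> (nat \<Rightarrow> real) \<Rightarrow> real" where
  "euler_check F y =
     Sum_any (\<lambda>l. if l \<ge> 1 then ((\<lambda>g. - D_check g) ^^ (l - 1)) (partial l F) y else 0)"

definition V_check :: "jet \<Rightarrow> (jet_fun \<times> jet_fun) set" where
  "V_check p =
     {(\<rho>, \<sigma>). \<exists>F G. smooth_near (eta_coords p) F \<and> smooth_near (xi_coords p) G \<and>
        germ_eq p \<rho> (\<lambda>z. F (eta_coords z) - G (xi_coords z)) \<and>
        germ_eq p \<sigma> (\<lambda>z. F (eta_coords z) + G (xi_coords z))}"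

definition V0_check :: "jet \<Rightarrow> (jet_fun \<times> jet_fun) set" where
  "V0_check p =
     {(\<rho>, \<sigma>). \<exists>F G C. smooth_near (eta_coords p) F \<and> smooth_near (xi_coords p) G \<and>
        germ_eq p \<rho> (\<lambda>z. D_check F (eta_coords z) - D_check G (xi_coords z) + C * z (U 0 1)) \<and>
        germ_eq p \<sigma> (\<lambda>z. D_check F (eta_coords z) + D_check G (xi_coords z) - C * z (U 1 0))}"

definition special_symmetries :: "jet \<Rightarrow> jet_fun set" where
  "special_symmetries p =
     {\<mu>. \<exists>F G. smooth_near (eta_coords p) F \<and> smooth_near (xi_coords p) G \<and>
        germ_eq p \<mu> (\<lambda>z. - euler_check F (eta_coords z) - euler_check G (xi_coords z))}"

end

theory Submission
  imports Defs
begin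

text \<open>On the solution set the jets are parametrized by \<open>u\<close> and two strands of coordinates:
  \<open>\<xi>, w\<^sub>1\<^sub>0, w\<^sub>2\<^sub>0, \<dots>\<close> and \<open>\<eta>, w\<^sub>0\<^sub>1, w\<^sub>0\<^sub>2, \<dots>\<close>. The total derivatives become
  \<open>D\<^sub>x = D\<^sub>\<xi> + D\<^sub>\<eta>\<close> and \<open>D\<^sub>t = D\<^sub>\<xi> - D\<^sub>\<eta>\<close>, where \<open>D\<^sub>\<xi>\<close> and \<open>D\<^sub>\<eta>\<close> commute and each of them shifts its own
  strand, annihilates the other one, and maps \<open>u\<close> to half of the first coordinate of its strand.
  Conserved currents, modulo currents vanishing on solutions, are pairs of functions of these
  coordinates, and triviality means \<open>(\<rho>, \<sigma>) = (D\<^sub>x H, - D\<^sub>t H)\<close> there.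

  With \<open>a = (\<rho> + \<sigma>)/2\<close> and \<open>\<beta> = (\<rho> - \<sigma>)/2\<close> the conservation of \<open>(\<rho>, \<sigma>)\<close> reads \<open>D\<^sub>\<xi> a = D\<^sub>\<eta> \<beta>\<close>.
  Differentiating this equation with respect to the coordinate of order \<open>n + 1\<close> in the \<open>\<xi>\<close>-strand
  shows, by descending induction on \<open>n\<close>, that the derivatives of \<open>a\<close> with respect to \<open>u\<close> and to the
  \<open>\<xi>\<close>-strand are in the image of \<open>D\<^sub>\<eta>\<close> (\<open>partials_exact\<close>). Since \<open>D\<^sub>\<eta>\<close> commutes with
  these derivatives, integration removes the variables one after another from \<open>a\<close> at the expense of
  a term \<open>D\<^sub>\<eta> H\<close>, and \<open>a = F + D\<^sub>\<eta> H\<close> with \<open>F\<close> a function of the \<open>\<eta>\<close>-strand (\<open>reduce_to_strand\<close>). Then \<open>\<beta> - D\<^sub>\<xi> H\<close> is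
  in the kernel of \<open>D\<^sub>\<eta>\<close>, which consists of the functions of the \<open>\<xi>\<close>-strand (\<open>cone_D_kernel\<close>). So every
  conserved current is equivalent to a special one. The same kernels decide which special
  currents are trivial: if \<open>D\<^sub>\<xi> H\<close> and \<open>D\<^sub>\<eta> H\<close> are functions of their own strands, then all mixed
  derivatives of \<open>H\<close> vanish and its \<open>u\<close>-derivative is a constant \<open>C\<close>, so that \<open>H\<close> is the sum of a
  function of each strand and \<open>C u\<close> (\<open>potential_splits\<close>).

  For the second part, linearize the identity \<open>\<mu> (u\<^sub>t\<^sub>t - u\<^sub>x\<^sub>x) = D\<^sub>t \<rho> + D\<^sub>x \<sigma>\<close> at solutions. This
  gives one equation for each \<open>u\<^sub>i\<^sub>j\<close>; applying \<open>(- D\<^sub>x)\<^sup>j\<close> and summing over \<open>j\<close> eliminates \<open>\<sigma>\<close>, and what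
  is left determines \<open>\<mu>\<close> on solutions as the variational derivative of \<open>\<rho>\<close> with respect to \<open>u\<^sub>t\<close>
  (\<open>characteristic_on_solutions\<close>). This derivative annihilates \<open>D\<^sub>x H\<close>, and its value on \<open>F - G\<close> is the
  characteristic of the stated form. Conversely, the divergence of a special current is a
  combination of the derivatives \<open>D\<^sub>x\<^sup>k (u\<^sub>t\<^sub>t - u\<^sub>x\<^sub>x)\<close>, and integration by parts brings it, up to a
  total \<open>x\<close>-derivative, into the form \<open>\<mu> (u\<^sub>t\<^sub>t - u\<^sub>x\<^sub>x)\<close> with the same \<open>\<mu>\<close> (\<open>special_divergence\<close>). A function of the two strands that
  vanishes on solutions vanishes identically, which gives uniqueness.

  All of this is calculus of germs of functions of infinitely many variables, each depending on
  finitely many of them. It takes place on cylinders, where a variable can be integrated from the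
  centre and a function with vanishing derivative in some variable does not depend on it.\<close>

section \<open>Isomorphisms of quotient spaces\<close>

lemma mem_coset: "x \<in> coset W v \<longleftrightarrow> x - v \<in> W"
  unfolding coset_def by (auto intro: exI[of _ "x - v"])

lemma coset_eq_iff:
  assumes "subspace W" shows "coset W v = coset W v' \<longleftrightarrow> v - v' \<in> W"
proof
  assume "coset W v = coset W v'"
  moreover have "v \<in> coset W v" using subspace_0[OF assms] by (simp add: mem_coset)
  ultimately show "v - v' \<in> W" by (simp add: mem_coset)
next
  assume d: "v - v' \<in> W"
  have "x - v \<in> W \<longleftrightarrow> x - v' \<in> W" for x
    using subspace_add[OF assms _ d, of "x - v"] subspace_diff[OF assms _ d, of "x - v'"] by auto
  then show "coset W v = coset W v'" by (auto simp: mem_coset)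
qed

lemma coset_add_subspace:
  assumes "subspace W" "W' \<subseteq> W" "subspace W'" shows "coset_add (coset W' v) (coset W v') = coset W (v + v')"
proof (intro equalityI subsetI)
  fix x assume "x \<in> coset_add (coset W' v) (coset W v')"
  then obtain a b where ab: "x = a + b" "a - v \<in> W" "b - v' \<in> W"
    using assms(2) by (auto simp: coset_add_def mem_coset)
  have "x - (v + v') = (a - v) + (b - v')" by (simp add: ab(1))
  also have "\<dots> \<in> W" by (rule subspace_add[OF assms(1) ab(2,3)])
  finally show "x \<in> coset W (v + v')" unfolding mem_coset .
next
  fix x assume "x \<in> coset W (v + v')"
  then have "v \<in> coset W' v" "x - v \<in> coset W v'" "x = v + (x - v)"
    using subspace_0[OF assms(3)] by (simp_all add: mem_coset algebra_simps)
  then show "x \<in> coset_add (coset W' v) (coset W v')" unfolding coset_add_def by blast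
qed

lemma coset_add_coset:
  assumes "subspace W" shows "coset_add (coset W v) (coset W v') = coset W (v + v')"
  by (rule coset_add_subspace[OF assms order_refl assms])

lemma coset_scaleR_coset:
  assumes "subspace W" shows "coset_scaleR W c (coset W v) = coset W (c *\<^sub>R v)"
proof (intro equalityI subsetI)
  fix x assume "x \<in> coset_scaleR W c (coset W v)"
  then obtain a w where a: "x = c *\<^sub>R a + w" "a - v \<in> W" "w \<in> W"
    by (auto simp: coset_scaleR_def mem_coset)
  have "x - c *\<^sub>R v = c *\<^sub>R (a - v) + w" by (simp add: a(1) algebra_simps)
  also have "\<dots> \<in> W" by (rule subspace_add[OF assms subspace_scale[OF assms a(2)] a(3)])
  finally show "x \<in> coset W (c *\<^sub>R v)" unfolding mem_coset .
next
  fix x assume "x \<in> coset W (c *\<^sub>R v)"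
  then have "v \<in> coset W v" "x - c *\<^sub>R v \<in> W" "x = c *\<^sub>R v + (x - c *\<^sub>R v)"
    using subspace_0[OF assms] by (simp_all add: mem_coset)
  then show "x \<in> coset_scaleR W c (coset W v)" unfolding coset_scaleR_def by blast
qed

lemma coset_0: "coset W 0 = W"
  by (auto simp: mem_coset)

text \<open>The inclusion sends a coset of \<open>V\<^sub>0\<close> to the coset of \<open>W\<^sub>0\<close> containing it. This map is
  injective because \<open>W\<^sub>0\<close> meets \<open>V\<close> only in \<open>V\<^sub>0\<close>, and surjective because \<open>V\<close> meets every coset of
  \<open>W\<^sub>0\<close> in \<open>W\<close>.\<close>

lemma naturally_isomorphicI:
  assumes V: "subspace V" and V0: "V\<^sub>0 = V \<inter> W\<^sub>0" and W: "subspace W" and W0: "subspace W\<^sub>0" "W\<^sub>0 \<subseteq> W"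
    and VW: "V \<subseteq> W" and surj: "\<And>w. w \<in> W \<Longrightarrow> \<exists>v\<in>V. w - v \<in> W\<^sub>0"
  shows "naturally_isomorphic V V\<^sub>0 W W\<^sub>0"
proof -
  have sV0: "subspace V\<^sub>0" unfolding V0 by (rule subspace_inter[OF V W0(1)])
  define \<Phi> where "\<Phi> A = coset_add A W\<^sub>0" for A
  have \<Phi>: "\<Phi> (coset V\<^sub>0 v) = coset W\<^sub>0 v" for v
    using coset_add_subspace[OF W0(1) _ sV0, of v 0] by (simp add: \<Phi>_def V0 coset_0)
  have inj: "inj_on \<Phi> (quotient_space V V\<^sub>0)"
  proof (rule inj_onI)
    fix A B assume "A \<in> quotient_space V V\<^sub>0" "B \<in> quotient_space V V\<^sub>0" "\<Phi> A = \<Phi> B"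
    then obtain v v' where v: "v \<in> V" "v' \<in> V" "A = coset V\<^sub>0 v" "B = coset V\<^sub>0 v'" "coset W\<^sub>0 v = coset W\<^sub>0 v'"
      by (auto simp: quotient_space_def \<Phi>)
    then have "v - v' \<in> V\<^sub>0" using coset_eq_iff[OF W0(1)] subspace_diff[OF V] by (auto simp: V0)
    then show "A = B" using v coset_eq_iff[OF sV0] by simp
  qed
  have "\<Phi> ` quotient_space V V\<^sub>0 = quotient_space W W\<^sub>0"
  proof
    show "\<Phi> ` quotient_space V V\<^sub>0 \<subseteq> quotient_space W W\<^sub>0"
      using VW by (auto simp: quotient_space_def \<Phi>)
    show "quotient_space W W\<^sub>0 \<subseteq> \<Phi> ` quotient_space V V\<^sub>0"
    proof
      fix B assume "B \<in> quotient_space W W\<^sub>0"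
      then obtain w where w: "w \<in> W" "B = coset W\<^sub>0 w" by (auto simp: quotient_space_def)
      then obtain v where v: "v \<in> V" "w - v \<in> W\<^sub>0" using surj by blast
      then have "B = \<Phi> (coset V\<^sub>0 v)" using w coset_eq_iff[OF W0(1)] by (simp add: \<Phi>)
      then show "B \<in> \<Phi> ` quotient_space V V\<^sub>0" using v(1) by (auto simp: quotient_space_def)
    qed
  qed
  with inj have "bij_betw \<Phi> (quotient_space V V\<^sub>0) (quotient_space W W\<^sub>0)" by (simp add: bij_betw_def)
  moreover have "\<Phi> (coset_add (coset V\<^sub>0 v) (coset V\<^sub>0 v')) = coset_add (\<Phi> (coset V\<^sub>0 v)) (\<Phi> (coset V\<^sub>0 v'))" for v v'
    by (simp add: \<Phi> coset_add_coset[OF sV0] coset_add_coset[OF W0(1)])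
  moreover have "\<Phi> (coset_scaleR V\<^sub>0 c (coset V\<^sub>0 v)) = coset_scaleR W\<^sub>0 c (\<Phi> (coset V\<^sub>0 v))" for c v
    by (simp add: \<Phi> coset_scaleR_coset[OF sV0] coset_scaleR_coset[OF W0(1)])
  ultimately have "quotient_iso \<Phi> V V\<^sub>0 W W\<^sub>0"
    unfolding quotient_iso_def by (auto simp: quotient_space_def)
  then show ?thesis
    unfolding naturally_isomorphic_def using V sV0 W W0 VW V0 \<Phi> by blast
qed

lemma subspaceI_linear:
  assumes "0 \<in> S" "\<And>c x y. x \<in> S \<Longrightarrow> y \<in> S \<Longrightarrow> c *\<^sub>R x + y \<in> S"
  shows "subspace S"
  unfolding subspace_def
proof (intro conjI ballI allI)
  show "x + y \<in> S" if "x \<in> S" "y \<in> S" for x y using assms(2)[OF that, of 1] by simp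
  show "c *\<^sub>R x \<in> S" if "x \<in> S" for x c using assms(2)[OF that assms(1), of c] by simp
qed (rule assms(1))

section \<open>Calculus of smooth functions of finitely many variables\<close>

text \<open>The basic neighbourhoods of the product topology. On a cylinder all line segments towards
  values of the centre \<open>p\<close> are available, whether or not the variable is constrained.\<close>

definition cylinder :: "('v \<Rightarrow> real) \<Rightarrow> 'v set \<Rightarrow> real \<Rightarrow> ('v \<Rightarrow> real) set" where
  "cylinder p B e = {z. \<forall>v\<in>B. \<bar>z v - p v\<bar> < e}"

lemma open_cylinder:
  assumes "finite B" shows "open (cylinder p B e)"
proof -
  have "cylinder p B e = (\<Inter>v\<in>B. {z. \<bar>z v - p v\<bar> < e})"
    by (auto simp: cylinder_def)
  also have "open \<dots>"
    using assms by (intro open_INT ballI open_Collect_less continuous_intros) auto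
  finally show ?thesis .
qed

lemma open_contains_cylinder:
  assumes "open N" "p \<in> N"
  obtains B e where "finite B" "0 < e" "cylinder p B e \<subseteq> N"
proof -
  have "openin (product_topology (\<lambda>i. euclidean) UNIV) N"
    using assms(1) by (simp add: open_fun_def)
  from product_topology_open_contains_basis[OF this assms(2)] obtain Y where
    Y: "p \<in> Pi\<^sub>E UNIV Y" "\<And>i. open (Y i)" "finite {i. Y i \<noteq> UNIV}" "Pi\<^sub>E UNIV Y \<subseteq> N"
    by auto
  let ?B = "{i. Y i \<noteq> UNIV}"
  have "\<exists>e>0. ball (p i) e \<subseteq> Y i" for i
    using Y(1) Y(2)[of i] by (meson PiE_mem UNIV_I open_contains_ball)
  then obtain r where r: "\<And>i. 0 < r i" "\<And>i. ball (p i) (r i) \<subseteq> Y i" by metis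
  define e where "e = Min (insert 1 (r ` ?B))"
  have e: "0 < e" using Y(3) r(1) by (auto simp: e_def)
  have le: "e \<le> r i" if "i \<in> ?B" for i
    unfolding e_def using Y(3) that by (intro Min_le) auto
  have "z i \<in> Y i" if "z \<in> cylinder p ?B e" for z i
  proof (cases "i \<in> ?B")
    case True
    then have "\<bar>z i - p i\<bar> < r i" using that le[of i] by (fastforce simp: cylinder_def)
    then show ?thesis using r(2)[of i] by (auto simp: dist_real_def abs_minus_commute)
  qed auto
  then have "cylinder p ?B e \<subseteq> N" using Y(4) by auto
  then show thesis using that Y(3) e by blast
qed

lemma continuous_on_fun_upd [continuous_intros]:
  fixes f :: "'a::topological_space \<Rightarrow> 'v \<Rightarrow> real"
  assumes "continuous_on A f" "continuous_on A g"
  shows "continuous_on A (\<lambda>x. (f x)(v := g x))"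
proof (rule continuous_on_coordinatewise_then_product)
  fix w
  show "continuous_on A (\<lambda>x. ((f x)(v := g x)) w)"
    using assms continuous_on_product_then_coordinatewise[OF assms(1), of w]
    by (cases "w = v") auto
qed

lemma eventually_fun_upd:
  fixes z :: "'v \<Rightarrow> real"
  assumes "open N" "z \<in> N"
  shows "\<forall>\<^sub>F s in nhds (z v). z(v := s) \<in> N"
proof -
  have "continuous_on UNIV (\<lambda>s. z(v := s))" by (intro continuous_intros)
  then have "open ((\<lambda>s. z(v := s)) -` N)"
    using assms(1) by (simp add: open_vimage)
  then show ?thesis using assms(2) by (intro eventually_nhds_in_open[THEN eventually_mono]) auto
qed

lemma partial_cong_open:
  assumes "open N" "z \<in> N" "\<And>z. z \<in> N \<Longrightarrow> f z = g z"
  shows "partial v f z = partial v g z"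
  unfolding partial_def
  by (intro deriv_cong_ev eventually_mono[OF eventually_fun_upd[OF assms(1,2)]]) (auto simp: assms(3))

lemma partial_eqI:
  "((\<lambda>s. f (z(v := s))) has_real_derivative D) (at (z v)) \<Longrightarrow> partial v f z = D"
  unfolding partial_def by (rule DERIV_imp_deriv)

lemma has_partial:
  assumes "C_infinity_on N f" "z \<in> N"
  shows "((\<lambda>s. f (z(v := s))) has_real_derivative partial v f z) (at (z v))"
proof -
  have "(\<lambda>s. foldr partial [] f (z(v := s))) differentiable (at (z v))"
    using assms unfolding C_infinity_on_def by blast
  then show ?thesis unfolding partial_def by (simp add: DERIV_deriv_iff_real_differentiable)
qed

lemma C_infinity_on_continuous: assumes "C_infinity_on N f" shows "continuous_on N f"
proof -
  have "continuous_on N (foldr partial [] f)" using assms unfolding C_infinity_on_def by blast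
  then show ?thesis by simp
qed

lemma C_infinity_on_partial:
  assumes "C_infinity_on N f" shows "C_infinity_on N (partial v f)"
proof -
  have "foldr partial vs (partial v f) = foldr partial (vs @ [v]) f" for vs by simp
  then show ?thesis using assms unfolding C_infinity_on_def by metis
qed

lemma C_infinity_on_subset: "C_infinity_on N f \<Longrightarrow> M \<subseteq> N \<Longrightarrow> C_infinity_on M f"
  unfolding C_infinity_on_def by (meson continuous_on_subset subsetD)

text \<open>Smoothness asks for all iterated partial derivatives at once; it suffices to exhibit a class
  of continuous functions that is closed under partial differentiation.\<close>

lemma C_infinity_on_coinduct:
  assumes "open N" "P f"
    and cont: "\<And>g. P g \<Longrightarrow> continuous_on N g"
    and diff: "\<And>g v. P g \<Longrightarrow>
      \<exists>g'. P g' \<and> (\<forall>z\<in>N. ((\<lambda>s. g (z(v := s))) has_real_derivative g' z) (at (z v)))"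
  shows "C_infinity_on N f"
proof -
  have *: "\<exists>g. P g \<and> (\<forall>z\<in>N. foldr partial vs f z = g z)" for vs
  proof (induction vs)
    case Nil then show ?case using assms(2) by auto
  next
    case (Cons v vs)
    then obtain g where g: "P g" "\<And>z. z \<in> N \<Longrightarrow> foldr partial vs f z = g z" by blast
    from diff[OF g(1), of v] obtain g' where g': "P g'"
      "\<And>z. z \<in> N \<Longrightarrow> ((\<lambda>s. g (z(v := s))) has_real_derivative g' z) (at (z v))" by blast
    have "foldr partial (v # vs) f z = g' z" if "z \<in> N" for z
      using partial_cong_open[OF assms(1) that g(2), where v = v] partial_eqI[OF g'(2)[OF that]] by simp
    then show ?case using g'(1) by blast
  qed
  show ?thesis unfolding C_infinity_on_def
  proof (intro allI conjI ballI)
    fix vs v z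
    obtain g where g: "P g" "\<And>z. z \<in> N \<Longrightarrow> foldr partial vs f z = g z" using * by blast
    show "continuous_on N (foldr partial vs f)"
      using cont[OF g(1)] g(2) by (simp cong: continuous_on_cong)
    assume z: "z \<in> N"
    from diff[OF g(1), of v] z obtain D where
      D: "((\<lambda>s. g (z(v := s))) has_real_derivative D) (at (z v))" by blast
    have "((\<lambda>s. foldr partial vs f (z(v := s))) has_real_derivative D) (at (z v))"
      by (rule DERIV_cong_ev[THEN iffD2, OF refl _ refl D],
          rule eventually_mono[OF eventually_fun_upd[OF assms(1) z]]) (auto simp: g(2))
    then show "(\<lambda>s. foldr partial vs f (z(v := s))) differentiable (at (z v))"
      by (metis real_differentiable_def)
  qed
qed

lemma C_infinity_on_cong:
  assumes "open N" "C_infinity_on N f" "\<And>z. z \<in> N \<Longrightarrow> f z = g z"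
  shows "C_infinity_on N g"
proof (rule C_infinity_on_coinduct[where P = "\<lambda>g. \<exists>f. C_infinity_on N f \<and> (\<forall>z\<in>N. f z = g z)"])
  fix g v assume "\<exists>f. C_infinity_on N f \<and> (\<forall>z\<in>N. f z = g z)"
  then obtain f where f: "C_infinity_on N f" "\<And>z. z \<in> N \<Longrightarrow> f z = g z" by blast
  show "continuous_on N g"
    using C_infinity_on_continuous[OF f(1)] f(2) by (simp cong: continuous_on_cong)
  have "((\<lambda>s. g (z(v := s))) has_real_derivative partial v f z) (at (z v))" if z: "z \<in> N" for z
    by (rule DERIV_cong_ev[THEN iffD1, OF refl _ refl has_partial[OF f(1) z]],
        rule eventually_mono[OF eventually_fun_upd[OF assms(1) z]]) (auto simp: f(2))
  then show "\<exists>g'. (\<exists>f. C_infinity_on N f \<and> (\<forall>z\<in>N. f z = g' z)) \<and>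
      (\<forall>z\<in>N. ((\<lambda>s. g (z(v := s))) has_real_derivative g' z) (at (z v)))"
    using C_infinity_on_partial[OF f(1)] by blast
qed (use assms in auto)

lemma C_infinity_on_const:
  fixes N :: "('v \<Rightarrow> real) set"
  assumes "open N" shows "C_infinity_on N (\<lambda>z. c)"
proof (rule C_infinity_on_coinduct[where P = "\<lambda>g. \<exists>c. g = (\<lambda>z. c)"])
  fix g :: "('v \<Rightarrow> real) \<Rightarrow> real" and v assume "\<exists>c. g = (\<lambda>z. c)"
  then show "\<exists>g'. (\<exists>c. g' = (\<lambda>z. c)) \<and>
      (\<forall>z\<in>N. ((\<lambda>s. g (z(v := s))) has_real_derivative g' z) (at (z v)))"
    by (intro exI[of _ "\<lambda>z. 0"]) auto
qed (use assms in auto)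

lemma C_infinity_on_coordinate: "open N \<Longrightarrow> C_infinity_on N (\<lambda>z. z v)"
proof (rule C_infinity_on_coinduct[where P = "\<lambda>g. C_infinity_on N g \<or> g = (\<lambda>z. z v)"])
  fix g w assume N: "open N" and g: "C_infinity_on N g \<or> g = (\<lambda>z. z v)"
  then show "continuous_on N g"
    by (auto intro: C_infinity_on_continuous continuous_on_subset[OF continuous_on_product_coordinates])
  show "\<exists>g'. (C_infinity_on N g' \<or> g' = (\<lambda>z. z v)) \<and>
            (\<forall>z\<in>N. ((\<lambda>s. g (z(w := s))) has_real_derivative g' z) (at (z w)))"
  proof (cases "g = (\<lambda>z. z v)")
    case True
    have "\<forall>z\<in>N. ((\<lambda>s. g (z(w := s))) has_real_derivative (if v = w then 1 else 0)) (at (z w))"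
      by (auto simp: True)
    then show ?thesis using C_infinity_on_const[OF N] by (intro exI conjI) auto
  next
    case False
    then show ?thesis using g C_infinity_on_partial has_partial by metis
  qed
qed auto

lemma C_infinity_on_add:
  assumes "open N" "C_infinity_on N f" "C_infinity_on N g"
  shows "C_infinity_on N (\<lambda>z. f z + g z)"
proof (rule C_infinity_on_coinduct[where P =
      "\<lambda>h. \<exists>f g. C_infinity_on N f \<and> C_infinity_on N g \<and> h = (\<lambda>z. f z + g z)"])
  fix h v assume "\<exists>f g. C_infinity_on N f \<and> C_infinity_on N g \<and> h = (\<lambda>z. f z + g z)"
  then obtain f g where *: "C_infinity_on N f" "C_infinity_on N g" "h = (\<lambda>z. f z + g z)" by blast
  then show "continuous_on N h" by (auto intro: continuous_on_add C_infinity_on_continuous)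
  have "((\<lambda>s. h (z(v := s))) has_real_derivative partial v f z + partial v g z) (at (z v))"
    if "z \<in> N" for z
    unfolding *(3) by (rule DERIV_add[OF has_partial[OF *(1) that] has_partial[OF *(2) that]])
  then show "\<exists>h'. (\<exists>f g. C_infinity_on N f \<and> C_infinity_on N g \<and> h' = (\<lambda>z. f z + g z)) \<and>
      (\<forall>z\<in>N. ((\<lambda>s. h (z(v := s))) has_real_derivative h' z) (at (z v)))"
    using C_infinity_on_partial[OF *(1)] C_infinity_on_partial[OF *(2)]
    by (intro exI[of _ "\<lambda>z. partial v f z + partial v g z"]) blast
qed (use assms in auto)

text \<open>The derivatives of a product are not products but sums of products.\<close>

inductive leibniz_span :: "('v \<Rightarrow> real) set \<Rightarrow> (('v \<Rightarrow> real) \<Rightarrow> real) \<Rightarrow> bool" for N where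
  "C_infinity_on N f \<Longrightarrow> C_infinity_on N g \<Longrightarrow> leibniz_span N (\<lambda>z. f z * g z)"
| "leibniz_span N f \<Longrightarrow> leibniz_span N g \<Longrightarrow> leibniz_span N (\<lambda>z. f z + g z)"

lemma has_partial_mult:
  assumes "C_infinity_on N f" "C_infinity_on N g" "z \<in> N"
  shows "((\<lambda>s. f (z(v := s)) * g (z(v := s))) has_real_derivative
    partial v f z * g z + f z * partial v g z) (at (z v))"
  using DERIV_mult[OF has_partial[OF assms(1,3), of v] has_partial[OF assms(2,3), of v]]
  by (simp add: algebra_simps)

lemma C_infinity_on_mult:
  assumes N: "open N" and "C_infinity_on N f" "C_infinity_on N g"
  shows "C_infinity_on N (\<lambda>z. f z * g z)"
proof (rule C_infinity_on_coinduct[where P = "leibniz_span N"])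
  fix h v assume "leibniz_span N h"
  then show "continuous_on N h"
    by induction (auto intro: continuous_on_add continuous_on_mult C_infinity_on_continuous)
  from \<open>leibniz_span N h\<close>
  show "\<exists>h'. leibniz_span N h' \<and>
      (\<forall>z\<in>N. ((\<lambda>s. h (z(v := s))) has_real_derivative h' z) (at (z v)))"
  proof induction
    case (1 f g)
    have "leibniz_span N (\<lambda>z. partial v f z * g z + f z * partial v g z)"
      by (intro leibniz_span.intros C_infinity_on_partial 1)
    then show ?case using has_partial_mult[OF 1] by blast
  next
    case (2 f g)
    then obtain f' g' where *: "leibniz_span N f'" "leibniz_span N g'"
      "\<forall>z\<in>N. ((\<lambda>s. f (z(v := s))) has_real_derivative f' z) (at (z v))"
      "\<forall>z\<in>N. ((\<lambda>s. g (z(v := s))) has_real_derivative g' z) (at (z v))" by blast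
    have "\<forall>z\<in>N. ((\<lambda>s. f (z(v := s)) + g (z(v := s))) has_real_derivative f' z + g' z) (at (z v))"
      using *(3,4) by (intro ballI DERIV_add) blast+
    with leibniz_span.intros(2)[OF *(1,2)] show ?case by blast
  qed
qed (use assms in \<open>auto intro: leibniz_span.intros\<close>)

lemma depends_only_on_mono: "depends_only_on N S f \<Longrightarrow> M \<subseteq> N \<Longrightarrow> S \<subseteq> S' \<Longrightarrow> depends_only_on M S' f"
  unfolding depends_only_on_def by blast

lemma partial_eq_0:
  assumes "open N" "depends_only_on N S f" "v \<notin> S" "z \<in> N"
  shows "partial v f z = 0"
proof (rule partial_eqI)
  show "((\<lambda>s. f (z(v := s))) has_real_derivative 0) (at (z v))"
  proof (rule DERIV_cong_ev[THEN iffD2, OF refl _ refl])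
    show "\<forall>\<^sub>F s in nhds (z v). f (z(v := s)) = f z"
    proof (rule eventually_mono[OF eventually_fun_upd[OF assms(1,4)]])
      fix s assume "z(v := s) \<in> N"
      moreover have "\<forall>w\<in>S. (z(v := s)) w = z w" using assms(3) by auto
      ultimately show "f (z(v := s)) = f z"
        using assms(2,4) unfolding depends_only_on_def by blast
    qed
  qed auto
qed

lemma depends_only_on_partial:
  assumes "open N" "depends_only_on N S f"
  shows "depends_only_on N S (partial v f)"
  unfolding depends_only_on_def
proof (intro ballI impI)
  fix z z' assume z: "z \<in> N" "z' \<in> N" and eq: "\<forall>w\<in>S. z w = z' w"
  show "partial v f z = partial v f z'"
  proof (cases "v \<in> S")
    case False then show ?thesis using partial_eq_0[OF assms] z by simp
  next
    case True
    then have v: "z v = z' v" using eq by auto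
    show ?thesis unfolding partial_def v
    proof (rule deriv_cong_ev)
      show "\<forall>\<^sub>F s in nhds (z' v). f (z(v := s)) = f (z'(v := s))"
        using eventually_fun_upd[OF assms(1) z(1), of v, unfolded v] eventually_fun_upd[OF assms(1) z(2), of v]
      proof eventually_elim
        case (elim s)
        moreover have "\<forall>w\<in>S. (z(v := s)) w = (z'(v := s)) w" using eq by auto
        ultimately show ?case using assms(2) unfolding depends_only_on_def by blast
      qed
    qed auto
  qed
qed

lemma C_infinity_on_sum:
  "open N \<Longrightarrow> (\<And>i. i \<in> I \<Longrightarrow> C_infinity_on N (f i)) \<Longrightarrow> C_infinity_on N (\<lambda>z. \<Sum>i\<in>I. f i z)"
  by (induction I rule: infinite_finite_induct) (auto intro: C_infinity_on_const C_infinity_on_add)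

text \<open>Smoothness is defined by partial derivatives alone. Their continuity gives derivatives along
  lines: the relevant variables are moved one after another, and each move is estimated by the mean
  value theorem.\<close>

lemma has_derivative_along_line:
  fixes f :: "('v \<Rightarrow> real) \<Rightarrow> real"
  assumes N: "open N" and f: "C_infinity_on N f" and S: "depends_only_on N S f" "finite S" and z: "z \<in> N"
  shows "((\<lambda>s. f (\<lambda>v. z v + (s - s0) * m v)) has_real_derivative (\<Sum>v\<in>S. m v * partial v f z)) (at s0)"
proof -
  define path where "path T s = (\<lambda>v. if v \<in> T then z v + (s - s0) * m v else z v)" for T s
  have cont: "continuous_on UNIV (path T)" for T
  proof (rule continuous_on_coordinatewise_then_product)
    show "continuous_on UNIV (\<lambda>s. path T s v)" for v
      by (cases "v \<in> T") (auto simp: path_def intro!: continuous_intros)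
  qed
  have path0: "path T s0 = z" for T by (auto simp: path_def)
  have near: "\<forall>\<^sub>F s in nhds s0. path T s \<in> M" if "open M" "z \<in> M" for T M
  proof -
    have "open (path T -` M)" using that cont by (simp add: open_vimage)
    then show ?thesis using that(2) path0
      by (intro eventually_nhds_in_open[THEN eventually_mono]) auto
  qed
  have main: "((\<lambda>s. f (path T s)) has_real_derivative (\<Sum>v\<in>T. m v * partial v f z)) (at s0)"
    if "finite T" for T
    using that
  proof induction
    case empty
    then show ?case by (auto simp: path_def)
  next
    case (insert w T)
    define D where "D = partial w f z"
    define h where "h s = f (path (insert w T) s) - f (path T s)" for s
    have h0: "h s0 = 0" by (simp add: h_def path0)
    have "(h has_real_derivative m w * D) (at s0)"
      unfolding has_field_derivative_iff
    proof (rule tendstoI)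
      fix e :: real assume "e > 0"
      define e' where "e' = e / (\<bar>m w\<bar> + 1)"
      have e': "e' > 0" "e' * \<bar>m w\<bar> < e" using \<open>e > 0\<close> by (auto simp: e'_def field_simps)
      \<comment> \<open>near \<open>z\<close> the partial derivative deviates from \<open>D\<close> by less than \<open>e'\<close>\<close>
      define M where "M = {x \<in> N. \<bar>partial w f x - D\<bar> < e'}"
      have "open M"
        using open_Int[OF N] N
          continuous_open_preimage[of N "\<lambda>x. \<bar>partial w f x - D\<bar>" "{..<e'}"]
          C_infinity_on_continuous[OF C_infinity_on_partial[OF f, of w]]
        unfolding M_def by (auto simp: continuous_on_rabs continuous_on_diff vimage_def Int_def)
      moreover have "z \<in> M" using z e' by (auto simp: M_def D_def)
      ultimately obtain B d where B: "finite B" "0 < d" "cylinder z B d \<subseteq> M"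
        using open_contains_cylinder by blast
      have "\<forall>\<^sub>F s in nhds s0. \<forall>v\<in>B. \<bar>(s - s0) * m v\<bar> < d"
      proof (rule eventually_ball_finite[OF B(1)], rule ballI)
        fix v
        have "((\<lambda>s. \<bar>(s - s0) * m v\<bar>) \<longlongrightarrow> \<bar>(s0 - s0) * m v\<bar>) (nhds s0)"
          by (intro tendsto_intros filterlim_ident)
        then show "\<forall>\<^sub>F s in nhds s0. \<bar>(s - s0) * m v\<bar> < d"
          using B(2) by (intro order_tendstoD(2)[where y = "\<bar>(s0 - s0) * m v\<bar>"]) auto
      qed
      then have "\<forall>\<^sub>F s in at s0. \<forall>v\<in>B. \<bar>(s - s0) * m v\<bar> < d"
        by (simp add: eventually_at_filter eventually_mono)
      moreover have "\<forall>\<^sub>F s in at s0. s \<noteq> s0" by (simp add: eventually_at_filter)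
      ultimately show "\<forall>\<^sub>F s in at s0. dist ((h s - h s0) / (s - s0)) (m w * D) < e"
      proof eventually_elim
        case (elim s)
        let ?a = "z w" and ?b = "z w + (s - s0) * m w"
        have inM: "(path T s)(w := \<sigma>) \<in> M" if \<sigma>: "\<sigma> \<in> closed_segment ?a ?b" for \<sigma>
        proof -
          have "\<bar>\<sigma> - z w\<bar> \<le> \<bar>(s - s0) * m w\<bar>" using \<sigma> by (auto simp: closed_segment_eq_real_ivl split: if_splits)
          then have "(path T s)(w := \<sigma>) \<in> cylinder z B d"
            using elim(1) B(2) by (fastforce simp: cylinder_def path_def)
          then show ?thesis using B(3) by blast
        qed
        \<comment> \<open>the function \<open>k\<close> has small derivative, so the increment of \<open>f\<close> is close to \<open>D\<close> times that of \<open>\<sigma>\<close>\<close>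
        define k where "k \<sigma> = f ((path T s)(w := \<sigma>)) - \<sigma> * D" for \<sigma>
        have "norm (k ?b - k ?a) \<le> e' * norm (?b - ?a)"
        proof (rule field_differentiable_bound[where S = "closed_segment ?a ?b"
              and f' = "\<lambda>\<sigma>. partial w f ((path T s)(w := \<sigma>)) - D"])
          fix \<sigma> assume \<sigma>: "\<sigma> \<in> closed_segment ?a ?b"
          have "((\<lambda>\<sigma>. f ((path T s)(w := \<sigma>))) has_real_derivative partial w f ((path T s)(w := \<sigma>))) (at \<sigma>)"
            using has_partial[OF f, of "(path T s)(w := \<sigma>)" w] inM[OF \<sigma>] by (simp add: M_def)
          then show "(k has_field_derivative partial w f ((path T s)(w := \<sigma>)) - D) (at \<sigma> within closed_segment ?a ?b)"
            unfolding k_def by (auto intro!: derivative_eq_intros intro: has_field_derivative_at_within)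
          show "norm (partial w f ((path T s)(w := \<sigma>)) - D) \<le> e'"
            using inM[OF \<sigma>] by (auto simp: M_def)
        qed auto
        moreover have "norm (?b - ?a) = \<bar>m w\<bar> * \<bar>s - s0\<bar>" by (simp add: abs_mult)
        moreover have "(path T s)(w := ?b) = path (insert w T) s" "(path T s)(w := ?a) = path T s"
          using insert.hyps by (auto simp: path_def)
        ultimately have "\<bar>h s - (s - s0) * (m w * D)\<bar> \<le> e' * \<bar>m w\<bar> * \<bar>s - s0\<bar>"
          by (simp add: k_def h_def algebra_simps del: real_norm_def) (simp add: mult.commute algebra_simps)
        moreover have "h s / (s - s0) - m w * D = (h s - (s - s0) * (m w * D)) / (s - s0)"
          using elim(2) by (simp add: diff_divide_distrib)
        ultimately have "\<bar>h s / (s - s0) - m w * D\<bar> \<le> e' * \<bar>m w\<bar>"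
          using elim(2) by (simp add: abs_divide pos_divide_le_eq)
        then show ?case using e'(2) by (simp add: h0 dist_real_def)
      qed
    qed
    from DERIV_add[OF this insert.IH] show ?case
      using insert.hyps by (simp add: h_def D_def)
  qed
  have ev: "\<forall>\<^sub>F s in nhds s0. f (path UNIV s) = f (path S s)"
    using near[OF N z, of S] near[OF N z, of UNIV]
  proof eventually_elim
    case (elim s)
    have "\<forall>v\<in>S. path UNIV s v = path S s v" by (simp add: path_def)
    then show ?case using S(1) elim unfolding depends_only_on_def by blast
  qed
  have "((\<lambda>s. f (path UNIV s)) has_real_derivative (\<Sum>v\<in>S. m v * partial v f z)) (at s0)"
    by (rule DERIV_cong_ev[THEN iffD2, OF refl ev refl main[OF S(2)]])
  moreover have "path UNIV s = (\<lambda>v. z v + (s - s0) * m v)" for s by (simp add: path_def)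
  ultimately show ?thesis by simp
qed

text \<open>The changes of coordinates that occur below are affine, each new coordinate involving
  finitely many old ones; \<open>slope f v\<close> is the constant \<open>\<partial>f/\<partial>v\<close>.\<close>

definition slope :: "(('v \<Rightarrow> real) \<Rightarrow> real) \<Rightarrow> 'v \<Rightarrow> real" where
  "slope f v = f (\<lambda>u. if u = v then 1 else 0) - f (\<lambda>u. 0)"

definition affine_form :: "(('v \<Rightarrow> real) \<Rightarrow> real) \<Rightarrow> bool" where
  "affine_form f \<longleftrightarrow> continuous_on UNIV f \<and>
     (\<exists>A. finite A \<and> (\<forall>y y'. (\<forall>v\<in>A. y v = y' v) \<longrightarrow> f y = f y')) \<and>
     (\<forall>y v s. f (y(v := s)) = f y + (s - y v) * slope f v)"

definition affine_coords :: "(('v \<Rightarrow> real) \<Rightarrow> ('w \<Rightarrow> real)) \<Rightarrow> bool" where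
  "affine_coords \<Psi> \<longleftrightarrow> (\<forall>w. affine_form (\<lambda>y. \<Psi> y w))"

lemma affine_form_upd:
  assumes "affine_form f" shows "f (y(v := s)) = f y + (s - y v) * slope f v"
  by (rule conjunct2[OF conjunct2[OF assms[unfolded affine_form_def]], rule_format])

lemma affine_form_finite:
  assumes "affine_form f"
  shows "\<exists>A. finite A \<and> (\<forall>y y'. (\<forall>v\<in>A. y v = y' v) \<longrightarrow> f y = f y')"
  by (rule conjunct1[OF conjunct2[OF assms[unfolded affine_form_def]]])

lemma affine_form_continuous: "affine_form f \<Longrightarrow> continuous_on UNIV f"
  unfolding affine_form_def by (rule conjunct1)

lemma affine_form_const: "affine_form (\<lambda>y. c)"
  by (auto simp: affine_form_def slope_def)

lemma affine_form_coordinate: "affine_form (\<lambda>y. y w)"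
  unfolding affine_form_def
proof (intro conjI allI)
  show "\<exists>A. finite A \<and> (\<forall>y y'. (\<forall>v\<in>A. y v = y' v) \<longrightarrow> y w = y' w)"
    by (rule exI[of _ "{w}"]) simp
qed (auto simp: slope_def)

lemma affine_form_add:
  assumes "affine_form f" "affine_form g" shows "affine_form (\<lambda>y. f y + g y)"
  unfolding affine_form_def
proof (intro conjI allI)
  obtain A where A: "finite A" "\<And>y y'. (\<forall>v\<in>A. y v = y' v) \<Longrightarrow> f y = f y'"
    using affine_form_finite[OF assms(1)] by blast
  obtain A' where A': "finite A'" "\<And>y y'. (\<forall>v\<in>A'. y v = y' v) \<Longrightarrow> g y = g y'"
    using affine_form_finite[OF assms(2)] by blast
  have "f y + g y = f y' + g y'" if "\<forall>v\<in>A \<union> A'. y v = y' v" for y y'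
    using A(2)[of y y'] A'(2)[of y y'] that by simp
  then show "\<exists>A. finite A \<and> (\<forall>y y'. (\<forall>v\<in>A. y v = y' v) \<longrightarrow> f y + g y = f y' + g y')"
    using A(1) A'(1) by (intro exI[of _ "A \<union> A'"]) simp
  show "f (y(v := s)) + g (y(v := s)) = f y + g y + (s - y v) * slope (\<lambda>y. f y + g y) v" for y v s
    unfolding affine_form_upd[OF assms(1)] affine_form_upd[OF assms(2)]
    by (simp add: slope_def algebra_simps)
qed (intro continuous_intros affine_form_continuous assms)

lemma affine_form_cmult:
  assumes "affine_form f" shows "affine_form (\<lambda>y. c * f y)"
  unfolding affine_form_def
proof (intro conjI allI)
  obtain A where A: "finite A" "\<And>y y'. (\<forall>v\<in>A. y v = y' v) \<Longrightarrow> f y = f y'"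
    using affine_form_finite[OF assms] by blast
  have "c * f y = c * f y'" if "\<forall>v\<in>A. y v = y' v" for y y'
    using A(2)[of y y'] that by simp
  then show "\<exists>A. finite A \<and> (\<forall>y y'. (\<forall>v\<in>A. y v = y' v) \<longrightarrow> c * f y = c * f y')"
    using A(1) by blast
  show "c * f (y(v := s)) = c * f y + (s - y v) * slope (\<lambda>y. c * f y) v" for y v s
    unfolding affine_form_upd[OF assms] by (simp add: slope_def algebra_simps)
qed (intro continuous_intros affine_form_continuous assms)

lemma affine_form_diff:
  assumes "affine_form f" "affine_form g" shows "affine_form (\<lambda>y. f y - g y)"
  using affine_form_add[OF assms(1) affine_form_cmult[OF assms(2), of "-1"]] by simp

lemma affine_form_divide:
  assumes "affine_form f" shows "affine_form (\<lambda>y. f y / c)"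
  using affine_form_cmult[OF assms, of "1 / c"] by simp

lemmas affine_form_intros = affine_form_const affine_form_coordinate affine_form_add
  affine_form_cmult affine_form_diff affine_form_divide

text \<open>The slopes are the coefficients of the linear part of \<open>f\<close>, as follows by changing the
  finitely many relevant variables from \<open>0\<close> to \<open>c\<close> one after another.\<close>

lemma affine_form_sum:
  assumes f: "affine_form f"
  shows "\<exists>A. finite A \<and> (\<forall>v. v \<notin> A \<longrightarrow> slope f v = 0) \<and> (\<forall>c. (\<Sum>v\<in>A. c v * slope f v) = f c - f (\<lambda>v. 0))"
proof -
  obtain A where A: "finite A" "\<And>y y'. (\<forall>v\<in>A. y v = y' v) \<Longrightarrow> f y = f y'"
    using affine_form_finite[OF f] by blast
  have "slope f v = 0" if "v \<notin> A" for v
    unfolding slope_def using A(2)[of "\<lambda>u. if u = v then 1 else 0" "\<lambda>u. 0"] that by fastforce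
  moreover have "(\<Sum>v\<in>A. c v * slope f v) = f c - f (\<lambda>v. 0)" for c
  proof -
    have "f (\<lambda>v. if v \<in> B then c v else 0) = f (\<lambda>v. 0) + (\<Sum>v\<in>B. c v * slope f v)" if "finite B" for B
      using that
    proof induction
      case (insert w B)
      have "(\<lambda>v. if v \<in> insert w B then c v else 0) = (\<lambda>v. if v \<in> B then c v else 0)(w := c w)" by auto
      then show ?case
        using affine_form_upd[OF f, of "\<lambda>v. if v \<in> B then c v else 0" w "c w"] insert by simp
    qed simp
    moreover have "f (\<lambda>v. if v \<in> A then c v else 0) = f c" by (rule A(2)) simp
    ultimately show ?thesis using A(1) by (simp add: eq_diff_eq add.commute)
  qed
  ultimately show ?thesis using A(1) by blast
qed

lemma affine_coordsI: "(\<And>w. affine_form (\<lambda>y. \<Psi> y w)) \<Longrightarrow> affine_coords \<Psi>"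
  unfolding affine_coords_def by (rule allI)

lemma affine_coordsD: "affine_coords \<Psi> \<Longrightarrow> affine_form (\<lambda>y. \<Psi> y w)"
  unfolding affine_coords_def by (rule spec)

lemma affine_coords_continuous: "affine_coords \<Psi> \<Longrightarrow> continuous_on UNIV \<Psi>"
  by (rule continuous_on_coordinatewise_then_product) (rule affine_form_continuous[OF affine_coordsD])

lemmas affine_coords_upd = affine_form_upd[OF affine_coordsD]
  and affine_coords_finite = affine_form_finite[OF affine_coordsD]

lemma has_partial_affine:
  assumes \<Psi>: "affine_coords \<Psi>" and N: "open N" and f: "C_infinity_on N f"
    and S: "depends_only_on N S f" "finite S" and y: "\<Psi> y \<in> N"
  shows "((\<lambda>s. f (\<Psi> (y(v := s)))) has_real_derivative (\<Sum>w\<in>S. slope (\<lambda>y. \<Psi> y w) v * partial w f (\<Psi> y))) (at (y v))"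
proof -
  have "\<Psi> (y(v := s)) = (\<lambda>w. \<Psi> y w + (s - y v) * slope (\<lambda>y. \<Psi> y w) v)" for s
    by (rule ext) (rule affine_coords_upd[OF \<Psi>])
  then show ?thesis using has_derivative_along_line[OF N f S y, of "y v" "\<lambda>w. slope (\<lambda>y. \<Psi> y w) v"] by simp
qed

text \<open>The derivative of \<open>g \<circ> \<Psi>\<close> is \<open>h \<circ> \<Psi>\<close> with \<open>h\<close> a combination of derivatives of \<open>g\<close> with constant
  coefficients, so the functions of the form \<open>g \<circ> \<Psi>\<close> are closed under differentiation.\<close>

lemma C_infinity_on_affine:
  assumes \<Psi>: "affine_coords \<Psi>" and N: "open N" and f: "C_infinity_on N f"
    and S: "depends_only_on N S f" "finite S"
  shows "C_infinity_on (\<Psi> -` N) (\<lambda>y. f (\<Psi> y))"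
proof (rule C_infinity_on_coinduct[where
      P = "\<lambda>h. \<exists>g. C_infinity_on N g \<and> depends_only_on N S g \<and> h = (\<lambda>y. g (\<Psi> y))"])
  have cont: "continuous_on UNIV \<Psi>" by (rule affine_coords_continuous[OF \<Psi>])
  then show "open (\<Psi> -` N)" using N by (simp add: open_vimage)
  fix h v assume "\<exists>g. C_infinity_on N g \<and> depends_only_on N S g \<and> h = (\<lambda>y. g (\<Psi> y))"
  then obtain g where g: "C_infinity_on N g" "depends_only_on N S g" "h = (\<lambda>y. g (\<Psi> y))" by blast
  show "continuous_on (\<Psi> -` N) h"
    unfolding g(3)
    by (rule continuous_on_compose2[OF C_infinity_on_continuous[OF g(1)] continuous_on_subset[OF cont]]) auto
  let ?g = "\<lambda>z. \<Sum>w\<in>S. slope (\<lambda>y. \<Psi> y w) v * partial w g z"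
  have "C_infinity_on N ?g"
    by (intro C_infinity_on_sum C_infinity_on_mult C_infinity_on_const C_infinity_on_partial N g)
  moreover have "depends_only_on N S ?g"
    unfolding depends_only_on_def
  proof (intro ballI impI)
    fix z z' assume "z \<in> N" "z' \<in> N" "\<forall>v\<in>S. z v = z' v"
    then have "partial w g z = partial w g z'" for w
      using depends_only_on_partial[OF N g(2), of w] unfolding depends_only_on_def by blast
    then show "?g z = ?g z'" by simp
  qed
  moreover have "\<forall>y\<in>\<Psi> -` N. ((\<lambda>s. h (y(v := s))) has_real_derivative ?g (\<Psi> y)) (at (y v))"
    unfolding g(3) using has_partial_affine[OF \<Psi> N g(1,2) S(2)] by blast
  ultimately show "\<exists>h'. (\<exists>g. C_infinity_on N g \<and> depends_only_on N S g \<and> h' = (\<lambda>y. g (\<Psi> y))) \<and>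
      (\<forall>y\<in>\<Psi> -` N. ((\<lambda>s. h (y(v := s))) has_real_derivative h' y) (at (y v)))"
    by (intro exI[of _ "\<lambda>y. ?g (\<Psi> y)"] conjI exI[of _ ?g]) (assumption | rule refl)+
next
  show "\<exists>g. C_infinity_on N g \<and> depends_only_on N S g \<and> (\<lambda>y. f (\<Psi> y)) = (\<lambda>y. g (\<Psi> y))"
    using f S(1) by (intro exI[of _ f]) simp
qed

lemma depends_only_on_affine:
  assumes \<Psi>: "affine_coords \<Psi>" and S: "depends_only_on N S f" "finite S"
  shows "\<exists>A. finite A \<and> depends_only_on (\<Psi> -` N) A (\<lambda>y. f (\<Psi> y))"
proof -
  have "\<forall>w. \<exists>A. finite A \<and> (\<forall>y y'. (\<forall>v\<in>A. y v = y' v) \<longrightarrow> \<Psi> y w = \<Psi> y' w)"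
    using affine_coords_finite[OF \<Psi>] by (rule allI)
  from choice[OF this] obtain A where
    A': "\<forall>w. finite (A w) \<and> (\<forall>y y'. (\<forall>v\<in>A w. y v = y' v) \<longrightarrow> \<Psi> y w = \<Psi> y' w)" ..
  have A: "finite (A w)" "(\<forall>v\<in>A w. y v = y' v) \<Longrightarrow> \<Psi> y w = \<Psi> y' w" for w y y'
    using A'[rule_format, of w] by (simp, meson)
  have "depends_only_on (\<Psi> -` N) (\<Union>w\<in>S. A w) (\<lambda>y. f (\<Psi> y))"
    unfolding depends_only_on_def
  proof (intro ballI impI)
    fix y y' assume y: "y \<in> \<Psi> -` N" "y' \<in> \<Psi> -` N" "\<forall>v\<in>\<Union> (A ` S). y v = y' v"
    have "\<Psi> y w = \<Psi> y' w" if "w \<in> S" for w by (rule A(2)) (use y(3) that in blast)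
    then show "f (\<Psi> y) = f (\<Psi> y')" using S(1) y(1,2) unfolding depends_only_on_def by blast
  qed
  then show ?thesis using A(1) S(2) by blast
qed

text \<open>The antiderivative with respect to one variable, rescaled to a fixed interval of
  integration so that differentiation under the integral sign applies.\<close>

definition antideriv :: "('v \<Rightarrow> real) \<Rightarrow> 'v \<Rightarrow> (('v \<Rightarrow> real) \<Rightarrow> real) \<Rightarrow> ('v \<Rightarrow> real) \<Rightarrow> real" where
  "antideriv p v f z = (z v - p v) * integral {0..1} (\<lambda>\<tau>. f (z(v := p v + \<tau> * (z v - p v))))"

context
  fixes p :: "'v \<Rightarrow> real" and B :: "'v set" and e :: real and N
  assumes B: "finite B" and N_def: "N = cylinder p B e" and e: "0 < e"
begin

lemma open_domain: "open N" by (simp add: N_def open_cylinder B)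

lemma segment_mem_cylinder:
  assumes "z \<in> N" "\<tau> \<in> {0..1}"
  shows "z(v := p v + \<tau> * (z v - p v)) \<in> N"
proof -
  have "\<bar>\<tau>\<bar> * \<bar>z v - p v\<bar> \<le> 1 * \<bar>z v - p v\<bar>" using assms(2) by (intro mult_right_mono) auto
  then show ?thesis using assms by (fastforce simp: N_def cylinder_def abs_mult)
qed

lemma recentered_mem_cylinder: "z \<in> N \<Longrightarrow> z(v := p v) \<in> N"
  using segment_mem_cylinder[of z 0 v] by simp

lemma line_through_cylinder:
  assumes "z \<in> N"
  shows "open {s. z(v := s) \<in> N}" "convex {s. z(v := s) \<in> N}" "z v \<in> {s. z(v := s) \<in> N}" "p v \<in> {s. z(v := s) \<in> N}"
proof -
  have "{s. z(v := s) \<in> N} = (if v \<in> B then {p v - e <..< p v + e} else UNIV)"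
    using assms by (auto simp: N_def cylinder_def split: if_splits)
  then show "open {s. z(v := s) \<in> N}" "convex {s. z(v := s) \<in> N}" by auto
  show "z v \<in> {s. z(v := s) \<in> N}" "p v \<in> {s. z(v := s) \<in> N}"
    using assms recentered_mem_cylinder[OF assms] by auto
qed

lemma continuous_on_antideriv:
  assumes f: "continuous_on N f"
  shows "continuous_on N (antideriv p v f)"
proof -
  have c: "continuous_on A (\<lambda>x::('v\<Rightarrow>real) \<times> real. fst x w)" for A w
    by (rule continuous_on_product_then_coordinatewise) (intro continuous_intros)
  have "continuous_on (N \<times> cbox 0 1) (\<lambda>(z, \<tau>::real). f (z(v := p v + \<tau> * (z v - p v))))"
    unfolding split_beta
    by (rule continuous_on_compose2[OF f], rule continuous_on_fun_upd)
      (auto intro!: continuous_intros c simp: segment_mem_cylinder)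
  from integral_continuous_on_param[OF this] show ?thesis
    unfolding antideriv_def
    by (intro continuous_intros continuous_on_subset[OF continuous_on_product_coordinates]) auto
qed

lemma continuous_on_line:
  assumes "continuous_on N f" "z \<in> N"
  shows "continuous_on {s. z(v := s) \<in> N} (\<lambda>s. f (z(v := s)))"
  by (rule continuous_on_compose2[OF assms(1)], rule continuous_on_fun_upd) (auto intro!: continuous_intros)

lemma antideriv_other:
  assumes f: "C_infinity_on N f" and z: "z \<in> N" and "w \<noteq> v"
  shows "((\<lambda>s. antideriv p v f (z(w := s))) has_real_derivative antideriv p v (partial w f) z) (at (z w))"
proof -
  let ?U = "{s. z(w := s) \<in> N}"
  let ?q = "\<lambda>\<tau>. p v + \<tau> * (z v - p v)"
  have tw: "z(w := s, v := x) = z(v := x, w := s)" for s x using \<open>w \<noteq> v\<close> by (simp add: fun_upd_twist)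
  have inN: "z(v := ?q \<tau>, w := s) \<in> N" if "s \<in> ?U" "\<tau> \<in> cbox 0 1" for s \<tau>
    using segment_mem_cylinder[of "z(w := s)" \<tau> v] that \<open>w \<noteq> v\<close> by (simp add: tw)
  have cont: "continuous_on (?U \<times> cbox 0 1) (\<lambda>(s, \<tau>). g (z(v := ?q \<tau>, w := s)))" if "C_infinity_on N g" for g
    unfolding split_beta
    by (rule continuous_on_compose2[OF C_infinity_on_continuous[OF that]], (rule continuous_on_fun_upd)+)
      (use inN in \<open>auto intro!: continuous_intros\<close>)
  have "((\<lambda>s. integral (cbox 0 1) (\<lambda>\<tau>. f (z(v := ?q \<tau>, w := s)))) has_real_derivative
          integral (cbox 0 1) (\<lambda>\<tau>. partial w f (z(v := ?q \<tau>, w := z w)))) (at (z w) within ?U)"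
  proof (rule leibniz_rule_field_derivative)
    fix s \<tau> assume "s \<in> ?U" "\<tau> \<in> cbox (0::real) 1"
    from has_partial[OF f inN[OF this], of w]
    show "((\<lambda>s. f (z(v := ?q \<tau>, w := s))) has_real_derivative partial w f (z(v := ?q \<tau>, w := s))) (at s within ?U)"
      by (simp add: has_field_derivative_at_within)
  next
    fix s assume s: "s \<in> ?U"
    show "(\<lambda>\<tau>. f (z(v := ?q \<tau>, w := s))) integrable_on cbox 0 1"
      by (rule integrable_continuous, rule continuous_on_compose2[OF C_infinity_on_continuous[OF f]],
          (rule continuous_on_fun_upd)+)
        (use inN[OF s] in \<open>auto intro!: continuous_intros\<close>)
  next
    show "continuous_on (?U \<times> cbox 0 1) (\<lambda>(s, \<tau>). partial w f (z(v := ?q \<tau>, w := s)))"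
      by (rule cont[OF C_infinity_on_partial[OF f]])
    show "z w \<in> ?U" "convex ?U" by (rule line_through_cylinder[OF z])+
  qed
  moreover have "(z(v := ?q \<tau>))(w := z w) = z(v := ?q \<tau>)" for \<tau> using \<open>w \<noteq> v\<close> by auto
  ultimately have "((\<lambda>s. integral {0..1} (\<lambda>\<tau>. f (z(v := ?q \<tau>, w := s)))) has_real_derivative
      integral {0..1} (\<lambda>\<tau>. partial w f (z(v := ?q \<tau>)))) (at (z w))"
    using at_within_open[OF line_through_cylinder(3,1)[OF z]] by simp
  from DERIV_cmult[OF this, of "z v - p v"] show ?thesis
    using \<open>w \<noteq> v\<close> by (simp add: antideriv_def tw)
qed

text \<open>Undoing the rescaling turns the antiderivative into \<open>G (z v) - G (p v)\<close>, where \<open>G\<close> is an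
  antiderivative of \<open>f\<close> on a compact interval around the two points.\<close>

lemma antideriv_same:
  assumes f: "continuous_on N f" and z: "z \<in> N"
  shows "((\<lambda>s. antideriv p v f (z(v := s))) has_real_derivative f z) (at (z v))"
proof -
  let ?U = "{s. z(v := s) \<in> N}"
  let ?\<phi> = "\<lambda>s. f (z(v := s))"
  note U = line_through_cylinder[OF z, of v]
  obtain d where d: "d > 0" "ball (z v) d \<subseteq> ?U" "ball (p v) d \<subseteq> ?U"
  proof -
    from U(1,3) obtain d1 where "d1 > 0" "ball (z v) d1 \<subseteq> ?U" using open_contains_ball by blast
    moreover from U(1,4) obtain d2 where "d2 > 0" "ball (p v) d2 \<subseteq> ?U" using open_contains_ball by blast
    ultimately show thesis using that[of "min d1 d2"] by (auto simp: subset_iff)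
  qed
  define a where "a = min (z v) (p v) - d/2"
  define b where "b = max (z v) (p v) + d/2"
  have ab: "a < z v" "z v < b" "a < p v" "p v < b" using d(1) by (auto simp: a_def b_def)
  have "a \<in> ?U" "b \<in> ?U"
    using d by (auto simp: a_def b_def min_def max_def subset_iff dist_real_def)
  then have sub: "{a..b} \<subseteq> ?U"
    using U(2) ab by (metis closed_segment_eq_real_ivl1 closed_segment_subset less_trans less_imp_le)
  define G where "G x = integral {a..x} ?\<phi>" for x
  have G: "(G has_real_derivative ?\<phi> x) (at x within {a..b})" if "x \<in> {a..b}" for x
    unfolding G_def
    by (rule integral_has_real_derivative[OF continuous_on_subset[OF continuous_on_line[OF f z] sub] that])
  have eq: "antideriv p v f (z(v := s)) = G s - G (p v)" if s: "s \<in> {a..b}" for s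
  proof -
    let ?q = "\<lambda>\<tau>. p v + \<tau> * (s - p v)"
    have q: "?q \<tau> \<in> {a..b}" if "\<tau> \<in> {0..1}" for \<tau>
    proof -
      have "?q \<tau> = (1 - \<tau>) *\<^sub>R p v + \<tau> *\<^sub>R s" by (simp add: algebra_simps)
      also have "\<dots> \<in> {a..b}"
        by (rule convexD[of "{a..b}"]) (use that s ab in auto)
      finally show ?thesis .
    qed
    have "((\<lambda>\<tau>. ?\<phi> (?q \<tau>) * (s - p v)) has_integral G (?q 1) - G (?q 0)) {0..1}"
    proof (rule fundamental_theorem_of_calculus)
      fix \<tau> :: real assume \<tau>: "\<tau> \<in> {0..1}"
      have "((G \<circ> ?q) has_real_derivative ?\<phi> (?q \<tau>) * (s - p v)) (at \<tau> within {0..1})"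
      proof (rule DERIV_image_chain)
        show "(G has_real_derivative ?\<phi> (?q \<tau>)) (at (?q \<tau>) within ?q ` {0..1})"
          by (rule DERIV_subset[OF G[OF q[OF \<tau>]]]) (use q in blast)
        show "(?q has_real_derivative (s - p v)) (at \<tau> within {0..1})"
          by (auto intro!: derivative_eq_intros)
      qed
      then show "((\<lambda>\<tau>. G (?q \<tau>)) has_vector_derivative ?\<phi> (?q \<tau>) * (s - p v)) (at \<tau> within {0..1})"
        by (simp add: has_real_derivative_iff_has_vector_derivative o_def)
    qed auto
    from integral_unique[OF this] show ?thesis by (simp add: antideriv_def mult.commute)
  qed
  have "((\<lambda>s. G s - G (p v)) has_real_derivative f z) (at (z v))"
    using G[of "z v"] ab by (auto intro!: derivative_eq_intros simp: at_within_Icc_at)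
  then show ?thesis
    by (rule DERIV_cong_ev[OF refl _ refl, THEN iffD2, rotated])
      (rule eventually_mono[OF eventually_nhds_in_open[of "{a<..<b}"]], use ab eq in auto)
qed

lemma has_partial_antideriv:
  assumes f: "C_infinity_on N f" and z: "z \<in> N"
  shows "((\<lambda>s. antideriv p v f (z(w := s))) has_real_derivative
     (if w = v then f z else antideriv p v (partial w f) z)) (at (z w))"
  using antideriv_same[OF C_infinity_on_continuous[OF f] z] antideriv_other[OF f z] by auto

lemma partial_antideriv:
  assumes "C_infinity_on N f" "z \<in> N"
  shows "partial w (antideriv p v f) z = (if w = v then f z else antideriv p v (partial w f) z)"
  by (rule partial_eqI[OF has_partial_antideriv[OF assms]])

lemma C_infinity_on_antideriv:
  assumes f: "C_infinity_on N f"
  shows "C_infinity_on N (antideriv p v f)"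
proof (rule C_infinity_on_coinduct[where
      P = "\<lambda>h. C_infinity_on N h \<or> (\<exists>g. C_infinity_on N g \<and> h = antideriv p v g)"])
  fix h w assume h: "C_infinity_on N h \<or> (\<exists>g. C_infinity_on N g \<and> h = antideriv p v g)"
  then show "continuous_on N h"
    using C_infinity_on_continuous continuous_on_antideriv by blast
  from h show "\<exists>h'. (C_infinity_on N h' \<or> (\<exists>g. C_infinity_on N g \<and> h' = antideriv p v g)) \<and>
      (\<forall>z\<in>N. ((\<lambda>s. h (z(w := s))) has_real_derivative h' z) (at (z w)))"
  proof
    assume "C_infinity_on N h"
    then show ?thesis using C_infinity_on_partial has_partial by metis
  next
    assume "\<exists>g. C_infinity_on N g \<and> h = antideriv p v g"
    then obtain g where g: "C_infinity_on N g" "h = antideriv p v g" by blast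
    show ?thesis
    proof (cases "w = v")
      case True
      then show ?thesis using g has_partial_antideriv[OF g(1), of _ v v] by auto
    next
      case False
      then have "\<forall>z\<in>N. ((\<lambda>s. h (z(w := s))) has_real_derivative antideriv p v (partial w g) z) (at (z w))"
        using g has_partial_antideriv[OF g(1), of _ v w] by auto
      then show ?thesis using C_infinity_on_partial[OF g(1)] by blast
    qed
  qed
next
  show "C_infinity_on N (antideriv p v f) \<or> (\<exists>g. C_infinity_on N g \<and> antideriv p v f = antideriv p v g)"
    using f by blast
qed (rule open_domain)

lemma depends_only_on_antideriv:
  assumes "depends_only_on N S f"
  shows "depends_only_on N (insert v S) (antideriv p v f)"
  unfolding depends_only_on_def
proof (intro ballI impI)
  fix z z' assume z: "z \<in> N" "z' \<in> N" "\<forall>w\<in>insert v S. z w = z' w"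
  have "f (z(v := p v + \<tau> * (z v - p v))) = f (z'(v := p v + \<tau> * (z' v - p v)))" if "\<tau> \<in> {0..1}" for \<tau>
  proof -
    have "\<forall>w\<in>S. (z(v := p v + \<tau> * (z v - p v))) w = (z'(v := p v + \<tau> * (z' v - p v))) w"
      using z(3) by auto
    then show ?thesis
      using assms segment_mem_cylinder[OF z(1) that, of v] segment_mem_cylinder[OF z(2) that, of v]
      unfolding depends_only_on_def by blast
  qed
  then show "antideriv p v f z = antideriv p v f z'"
    using z(3) unfolding antideriv_def by (auto intro!: arg_cong2[where f = "(*)"] integral_cong)
qed

lemma constant_along_line:
  assumes f: "C_infinity_on N f" and "\<And>z. z \<in> N \<Longrightarrow> partial v f z = 0" and z: "z \<in> N" "z(v := s) \<in> N"
  shows "f (z(v := s)) = f z"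
proof -
  let ?U = "{s. z(v := s) \<in> N}"
  have "\<exists>c. \<forall>s\<in>?U. f (z(v := s)) = c"
  proof (rule has_field_derivative_zero_constant)
    fix s assume "s \<in> ?U"
    then show "((\<lambda>s. f (z(v := s))) has_field_derivative 0) (at s within ?U)"
      using has_partial[OF f, of "z(v := s)" v] assms(2)[of "z(v := s)"] by (simp add: has_field_derivative_at_within)
  qed (rule line_through_cylinder[OF z(1)])
  then show ?thesis using z by (metis fun_upd_triv mem_Collect_eq)
qed

lemma eq_center_plus_antideriv:
  assumes f: "C_infinity_on N f" and z: "z \<in> N"
  shows "f z = f (z(v := p v)) + antideriv p v (partial v f) z"
proof -
  let ?g = "\<lambda>z. f z + (- 1) * antideriv p v (partial v f) z"
  note a = C_infinity_on_antideriv[OF C_infinity_on_partial[OF f, of v], of v]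
  have g: "C_infinity_on N ?g"
    by (intro C_infinity_on_add C_infinity_on_mult C_infinity_on_const open_domain f a)
  have "partial v ?g z = 0" if "z \<in> N" for z
    by (rule partial_eqI)
      (use has_partial[OF f that, of v] antideriv_same[OF C_infinity_on_continuous[OF C_infinity_on_partial[OF f]] that, of v v]
       in \<open>auto intro!: derivative_eq_intros\<close>)
  from constant_along_line[OF g this z recentered_mem_cylinder[OF z]]
  show ?thesis by (simp add: antideriv_def)
qed

text \<open>Symmetry of second derivatives: differentiating \<open>f = f|\<^bsub>v=p\<^esub> + \<integral> \<partial>\<^sub>v f dv\<close> under the
  integral sign with respect to \<open>w\<close>, and then with respect to \<open>v\<close>.\<close>

lemma partial_commute_cylinder:
  assumes f: "C_infinity_on N f" and z: "z \<in> N"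
  shows "partial v (partial w f) z = partial w (partial v f) z"
proof (cases "v = w")
  case False
  have 1: "partial w f z = partial w f (z(v := p v)) + antideriv p v (partial w (partial v f)) z" if z: "z \<in> N" for z
  proof (rule partial_eqI)
    have D: "((\<lambda>s. f ((z(v := p v))(w := s)) + antideriv p v (partial v f) (z(w := s))) has_real_derivative
       partial w f (z(v := p v)) + antideriv p v (partial w (partial v f)) z) (at (z w))"
    proof (rule DERIV_add)
      show "((\<lambda>s. f ((z(v := p v))(w := s))) has_real_derivative partial w f (z(v := p v))) (at (z w))"
        using has_partial[OF f recentered_mem_cylinder[OF z, of v], of w] False by simp
      show "((\<lambda>s. antideriv p v (partial v f) (z(w := s))) has_real_derivative
          antideriv p v (partial w (partial v f)) z) (at (z w))"
        using antideriv_other[OF C_infinity_on_partial[OF f, of v] z, of w v] False by simp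
    qed
    have ev: "\<forall>\<^sub>F s in nhds (z w). f (z(w := s)) =
      f ((z(v := p v))(w := s)) + antideriv p v (partial v f) (z(w := s))"
      using eventually_fun_upd[OF open_domain z, of w]
    proof eventually_elim
      case (elim s)
      show ?case using eq_center_plus_antideriv[OF f elim, of v] False by (simp add: fun_upd_twist)
    qed
    show "((\<lambda>s. f (z(w := s))) has_real_derivative
      partial w f (z(v := p v)) + antideriv p v (partial w (partial v f)) z) (at (z w))"
      by (rule DERIV_cong_ev[THEN iffD2, OF refl ev refl D])
  qed
  show ?thesis
  proof (rule partial_eqI)
    have D: "((\<lambda>s. partial w f (z(v := p v)) + antideriv p v (partial w (partial v f)) (z(v := s)))
       has_real_derivative partial w (partial v f) z) (at (z v))"
      using DERIV_add[OF DERIV_const antideriv_same[OF C_infinity_on_continuous[OF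
              C_infinity_on_partial[OF C_infinity_on_partial[OF f, of v], of w]] z, of v]]
      by simp
    have ev: "\<forall>\<^sub>F s in nhds (z v). partial w f (z(v := s)) =
        partial w f (z(v := p v)) + antideriv p v (partial w (partial v f)) (z(v := s))"
      using eventually_fun_upd[OF open_domain z, of v]
    proof eventually_elim
      case (elim s)
      show ?case using 1[OF elim] by simp
    qed
    show "((\<lambda>s. partial w f (z(v := s))) has_real_derivative partial w (partial v f) z) (at (z v))"
      by (rule DERIV_cong_ev[THEN iffD2, OF refl ev refl D])
  qed
qed auto

text \<open>The variables in \<open>R\<close> on which \<open>f\<close> depends are moved one after another; a cylinder contains
  all the intermediate points.\<close>

lemma eq_if_partials_0:
  assumes f: "C_infinity_on N f" and S: "depends_only_on N S f" "finite S"
    and 0: "\<And>v z. v \<in> R \<Longrightarrow> z \<in> N \<Longrightarrow> partial v f z = 0"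
    and z: "z \<in> N" "z' \<in> N" "\<And>v. v \<in> S \<Longrightarrow> v \<notin> R \<Longrightarrow> z v = z' v"
  shows "f z = f z'"
proof -
  let ?mix = "\<lambda>T v. if v \<in> T then z' v else z v"
  have mixN: "?mix T \<in> N" for T using z(1,2) by (auto simp: N_def cylinder_def)
  have "f (?mix T) = f z" if "finite T" "T \<subseteq> R" for T
    using that
  proof induction
    case (insert w T)
    have "?mix (insert w T) = (?mix T)(w := z' w)" by auto
    then show ?case
      using constant_along_line[OF f 0, of w "?mix T" "z' w"] mixN[of "insert w T"] mixN[of T]
        insert.IH insert.prems by simp
  qed auto
  from this[of "R \<inter> S"] have "f z = f (?mix (R \<inter> S))" using S(2) by auto
  also have "\<dots> = f z'"
  proof -
    have "\<forall>v\<in>S. ?mix (R \<inter> S) v = z' v" using z(3) by auto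
    then show ?thesis by (rule S(1)[unfolded depends_only_on_def, THEN bspec, THEN bspec, THEN mp, OF mixN z(2)])
  qed
  finally show ?thesis .
qed

end

lemma partial_commute:
  assumes "open N" "C_infinity_on N f" "z \<in> N"
  shows "partial v (partial w f) z = partial w (partial v f) z"
proof -
  obtain B e where B: "finite B" "0 < e" "cylinder z B e \<subseteq> N"
    using open_contains_cylinder[OF assms(1,3)] .
  show ?thesis
    by (rule partial_commute_cylinder[OF B(1) refl B(2) C_infinity_on_subset[OF assms(2) B(3)]])
      (use B in \<open>auto simp: cylinder_def\<close>)
qed

section \<open>Germs of smooth functions\<close>

lemma smooth_near_cylinder:
  assumes "smooth_near p f" "open M" "p \<in> M"
  obtains B e S where "finite B" "0 < e" "cylinder p B e \<subseteq> M" "finite S"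
    "depends_only_on (cylinder p B e) S f" "C_infinity_on (cylinder p B e) f"
proof -
  obtain N S where N: "open N" "p \<in> N" "finite S" "depends_only_on N S f" "C_infinity_on N f"
    using assms(1) unfolding smooth_near_def by blast
  obtain B e where B: "finite B" "0 < e" "cylinder p B e \<subseteq> N \<inter> M"
    using open_contains_cylinder[of "N \<inter> M" p] N assms(2,3) by blast
  then have "cylinder p B e \<subseteq> N" "cylinder p B e \<subseteq> M" by auto
  then show thesis
    using that[OF B(1,2) _ N(3)] depends_only_on_mono[OF N(4) _ subset_refl] C_infinity_on_subset[OF N(5)]
    by simp
qed

lemma center_mem_cylinder: "0 < e \<Longrightarrow> p \<in> cylinder p B e"
  by (simp add: cylinder_def)

lemma smooth_nearI:
  "open N \<Longrightarrow> p \<in> N \<Longrightarrow> finite S \<Longrightarrow> depends_only_on N S f \<Longrightarrow> C_infinity_on N f \<Longrightarrow> smooth_near p f"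
  unfolding smooth_near_def by blast

lemma smooth_near2:
  assumes "smooth_near p f" "smooth_near p g"
  obtains N S where "open N" "p \<in> N" "finite S" "depends_only_on N S f" "C_infinity_on N f"
    "depends_only_on N S g" "C_infinity_on N g"
proof -
  obtain N S N' S' where "open N" "p \<in> N" "finite S" "depends_only_on N S f" "C_infinity_on N f"
    "open N'" "p \<in> N'" "finite S'" "depends_only_on N' S' g" "C_infinity_on N' g"
    using assms unfolding smooth_near_def by blast
  then show thesis
    by (intro that[of "N \<inter> N'" "S \<union> S'"])
      (auto intro: depends_only_on_mono C_infinity_on_subset)
qed

lemma germ_eq_refl [simp]: "germ_eq p f f"
  by (simp add: germ_eq_def)

lemma germ_eq_sym: "germ_eq p f g \<Longrightarrow> germ_eq p g f"
  by (simp add: germ_eq_def eq_commute)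

lemma germ_eq_trans [trans]:
  assumes "germ_eq p f g" "germ_eq p g h" shows "germ_eq p f h"
  using assms unfolding germ_eq_def by eventually_elim simp

lemma germ_eq_openE:
  assumes "germ_eq p f g"
  obtains N where "open N" "p \<in> N" "\<And>z. z \<in> N \<Longrightarrow> f z = g z"
  using assms unfolding germ_eq_def eventually_nhds by blast

lemma smooth_near_cong:
  assumes "smooth_near p f" "germ_eq p f g"
  shows "smooth_near p g"
proof -
  obtain N where N: "open N" "p \<in> N" "\<And>z. z \<in> N \<Longrightarrow> f z = g z"
    using assms(2) germ_eq_openE by blast
  obtain B e S where *: "finite B" "0 < e" "cylinder p B e \<subseteq> N" "finite S"
    "depends_only_on (cylinder p B e) S f" "C_infinity_on (cylinder p B e) f"
    using smooth_near_cylinder[OF assms(1) N(1,2)] .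
  have eq: "f z = g z" if "z \<in> cylinder p B e" for z using N(3) *(3) that by blast
  show ?thesis
  proof (rule smooth_nearI)
    show "C_infinity_on (cylinder p B e) g"
      by (rule C_infinity_on_cong[OF open_cylinder[OF *(1)] *(6) eq])
    show "depends_only_on (cylinder p B e) S g"
      unfolding depends_only_on_def
    proof (intro ballI impI)
      fix z z' assume z: "z \<in> cylinder p B e" "z' \<in> cylinder p B e" "\<forall>v\<in>S. z v = z' v"
      then have "f z = f z'" using *(5) unfolding depends_only_on_def by blast
      then show "g z = g z'" using eq[OF z(1)] eq[OF z(2)] by simp
    qed
  qed (use * open_cylinder center_mem_cylinder in auto)
qed

lemma smooth_near_const [simp, intro]: "smooth_near p (\<lambda>z. c)"
  by (rule smooth_nearI[of UNIV _ "{}"]) (auto simp: depends_only_on_def C_infinity_on_const)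

lemma smooth_near_coordinate [simp, intro]: "smooth_near p (\<lambda>z. z v)"
  by (rule smooth_nearI[of UNIV _ "{v}"]) (auto simp: depends_only_on_def C_infinity_on_coordinate)

lemma smooth_near_add [intro]:
  assumes "smooth_near p f" "smooth_near p g"
  shows "smooth_near p (\<lambda>z. f z + g z)"
proof -
  obtain N S where N: "open N" "p \<in> N" "finite S" "depends_only_on N S f" "C_infinity_on N f"
    "depends_only_on N S g" "C_infinity_on N g" using smooth_near2[OF assms] .
  have "depends_only_on N S (\<lambda>z. f z + g z)"
    using N(4,6) unfolding depends_only_on_def by metis
  then show ?thesis by (intro smooth_nearI[OF N(1-3)] C_infinity_on_add N)
qed

lemma smooth_near_mult [intro]:
  assumes "smooth_near p f" "smooth_near p g"
  shows "smooth_near p (\<lambda>z. f z * g z)"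
proof -
  obtain N S where N: "open N" "p \<in> N" "finite S" "depends_only_on N S f" "C_infinity_on N f"
    "depends_only_on N S g" "C_infinity_on N g" using smooth_near2[OF assms] .
  have "depends_only_on N S (\<lambda>z. f z * g z)"
    using N(4,6) unfolding depends_only_on_def by metis
  then show ?thesis by (intro smooth_nearI[OF N(1-3)] C_infinity_on_mult N)
qed

lemma smooth_near_minus [intro]:
  assumes "smooth_near p f" shows "smooth_near p (\<lambda>z. - f z)"
  using smooth_near_mult[OF smooth_near_const[of p "-1"] assms] by simp

lemma smooth_near_diff [intro]:
  assumes "smooth_near p f" "smooth_near p g" shows "smooth_near p (\<lambda>z. f z - g z)"
  using smooth_near_add[OF assms(1) smooth_near_minus[OF assms(2)]] by simp

lemma smooth_near_divide [intro]:
  assumes "smooth_near p f" shows "smooth_near p (\<lambda>z. f z / c)"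
  using smooth_near_mult[OF assms smooth_near_const[of p "1 / c"]] by simp

lemma smooth_near_sum [intro]:
  "(\<And>i. i \<in> I \<Longrightarrow> smooth_near p (f i)) \<Longrightarrow> smooth_near p (\<lambda>z. \<Sum>i\<in>I. f i z)"
  by (induction I rule: infinite_finite_induct) auto

lemma smooth_near_partial [intro]:
  assumes "smooth_near p f" shows "smooth_near p (partial v f)"
  using assms unfolding smooth_near_def
  by (metis C_infinity_on_partial depends_only_on_partial)

lemmas smooth_near_intros = smooth_near_const smooth_near_coordinate smooth_near_add smooth_near_mult
  smooth_near_minus smooth_near_diff smooth_near_divide smooth_near_sum smooth_near_partial

subsection \<open>Partial derivatives of germs\<close>

lemma partial_const [simp]: "partial v (\<lambda>z. c) z = 0"
  by (simp add: partial_def)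

lemma partial_coordinate: "partial v (\<lambda>z. z w) z = (if v = w then 1 else 0)"
  by (rule partial_eqI) auto

lemma eventually_partial_cong:
  assumes "germ_eq p f g"
  shows "\<forall>\<^sub>F z in nhds p. \<forall>v. partial v f z = partial v g z"
proof -
  obtain N where "open N" "p \<in> N" "\<And>z. z \<in> N \<Longrightarrow> f z = g z"
    using germ_eq_openE[OF assms] by blast
  then show ?thesis
    by (intro eventually_nhds_in_open[THEN eventually_mono]) (auto intro: partial_cong_open)
qed

lemma germ_eq_partial:
  assumes "germ_eq p f g" shows "germ_eq p (partial v f) (partial v g)"
  using eventually_partial_cong[OF assms] unfolding germ_eq_def by eventually_elim simp

lemma eventually_has_partial:
  assumes "smooth_near p f"
  shows "\<forall>\<^sub>F z in nhds p. \<forall>v. ((\<lambda>s. f (z(v := s))) has_real_derivative partial v f z) (at (z v))"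
proof -
  obtain N where "open N" "p \<in> N" "C_infinity_on N f" using assms unfolding smooth_near_def by blast
  then show ?thesis
    by (intro eventually_nhds_in_open[THEN eventually_mono]) (auto intro: has_partial)
qed

lemma eventually_partial_add:
  assumes "smooth_near p f" "smooth_near p g"
  shows "\<forall>\<^sub>F z in nhds p. \<forall>v. partial v (\<lambda>z. f z + g z) z = partial v f z + partial v g z"
  using assms[THEN eventually_has_partial]
  by eventually_elim (intro allI partial_eqI DERIV_add; blast)

lemma eventually_partial_mult:
  assumes "smooth_near p f" "smooth_near p g"
  shows "\<forall>\<^sub>F z in nhds p. \<forall>v. partial v (\<lambda>z. f z * g z) z = partial v f z * g z + f z * partial v g z"
proof -
  obtain N S where N: "open N" "p \<in> N" "finite S" "depends_only_on N S f" "C_infinity_on N f"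
    "depends_only_on N S g" "C_infinity_on N g" using smooth_near2[OF assms] .
  show ?thesis
    by (rule eventually_mono[OF eventually_nhds_in_open[OF N(1,2)]])
      (intro allI partial_eqI has_partial_mult[OF N(5,7)])
qed

lemma eventually_partial_commute:
  assumes "smooth_near p f"
  shows "\<forall>\<^sub>F z in nhds p. \<forall>v w. partial v (partial w f) z = partial w (partial v f) z"
proof -
  obtain N where "open N" "p \<in> N" "C_infinity_on N f" using assms unfolding smooth_near_def by blast
  then show ?thesis
    by (intro eventually_nhds_in_open[THEN eventually_mono] allI partial_commute)
qed

lemma eventually_partial_cmult:
  assumes "smooth_near p f"
  shows "\<forall>\<^sub>F z in nhds p. \<forall>v. partial v (\<lambda>z. c * f z) z = c * partial v f z"
  using eventually_partial_mult[OF smooth_near_const assms, of c] by simp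

lemma eventually_partial_sum:
  assumes "\<And>i. i \<in> I \<Longrightarrow> smooth_near p (f i)"
  shows "\<forall>\<^sub>F z in nhds p. \<forall>v. partial v (\<lambda>z. \<Sum>i\<in>I. f i z) z = (\<Sum>i\<in>I. partial v (f i) z)"
  using assms
proof (induction I rule: infinite_finite_induct)
  case (insert i I)
  have "\<forall>\<^sub>F z in nhds p. \<forall>v. partial v (\<lambda>z. f i z + (\<Sum>i\<in>I. f i z)) z =
      partial v (f i) z + partial v (\<lambda>z. \<Sum>i\<in>I. f i z) z"
    by (rule eventually_partial_add) (use insert.prems in auto)
  moreover have "\<forall>\<^sub>F z in nhds p. \<forall>v. partial v (\<lambda>z. \<Sum>i\<in>I. f i z) z = (\<Sum>i\<in>I. partial v (f i) z)"
    by (rule insert.IH) (use insert.prems in auto)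
  ultimately show ?case
    by eventually_elim (use insert.hyps insert.prems in auto)
qed auto

lemma finite_support:
  assumes "smooth_near p f"
  obtains S where "finite S" "\<forall>\<^sub>F z in nhds p. \<forall>v. v \<notin> S \<longrightarrow> partial v f z = 0"
proof -
  obtain N S where N: "open N" "p \<in> N" "finite S" "depends_only_on N S f"
    using assms unfolding smooth_near_def by blast
  show thesis
    by (rule that[OF N(3)], rule eventually_mono[OF eventually_nhds_in_open[OF N(1,2)]])
      (use partial_eq_0[OF N(1,4)] in auto)
qed

abbreviation zero_germ :: "('v \<Rightarrow> real) \<Rightarrow> (('v \<Rightarrow> real) \<Rightarrow> real) \<Rightarrow> bool" where
  "zero_germ p f \<equiv> germ_eq p f (\<lambda>z. 0)"

lemma partial_diff:
  assumes "smooth_near p f" "smooth_near p g"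
  shows "germ_eq p (partial v (\<lambda>z. f z - g z)) (\<lambda>z. partial v f z - partial v g z)"
  using eventually_partial_add[OF assms(1) smooth_near_minus[OF assms(2)]]
    eventually_partial_cmult[OF assms(2), of "-1"]
  unfolding germ_eq_def by eventually_elim simp

lemma partial_add:
  assumes "smooth_near p f" "smooth_near p g"
  shows "germ_eq p (partial v (\<lambda>z. f z + g z)) (\<lambda>z. partial v f z + partial v g z)"
  using eventually_partial_add[OF assms] unfolding germ_eq_def by eventually_elim simp

lemma partial_zero:
  assumes "zero_germ p f" shows "zero_germ p (partial v f)"
  using eventually_partial_cong[OF assms] unfolding germ_eq_def by eventually_elim simp

lemma germ_eq_add:
  assumes "germ_eq p f f'" "germ_eq p g g'" shows "germ_eq p (\<lambda>z. f z + g z) (\<lambda>z. f' z + g' z)"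
  using assms unfolding germ_eq_def by eventually_elim simp

lemma eventually_all_partials_zero:
  assumes "smooth_near p f" "\<And>v. v \<in> R \<Longrightarrow> zero_germ p (partial v f)"
  shows "\<forall>\<^sub>F z in nhds p. \<forall>v\<in>R. partial v f z = 0"
proof -
  obtain S where S: "finite S" "\<forall>\<^sub>F z in nhds p. \<forall>v. v \<notin> S \<longrightarrow> partial v f z = 0"
    using finite_support[OF assms(1)] .
  have "\<forall>\<^sub>F z in nhds p. \<forall>v\<in>R \<inter> S. partial v f z = 0"
    using assms(2) S(1) unfolding germ_eq_def by (intro eventually_ball_finite) auto
  with S(2) show ?thesis by eventually_elim blast
qed

subsection \<open>Antiderivatives and freezing of variables\<close>

lemma smooth_near_antideriv:
  assumes "smooth_near p f" shows "smooth_near p (antideriv p v f)"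
proof -
  obtain B e S where *: "finite B" "0 < e" "cylinder p B e \<subseteq> UNIV" "finite S"
    "depends_only_on (cylinder p B e) S f" "C_infinity_on (cylinder p B e) f"
    using smooth_near_cylinder[OF assms, of UNIV] by auto
  show ?thesis
    by (rule smooth_nearI[OF open_cylinder[OF *(1)] center_mem_cylinder[OF *(2)] _
          depends_only_on_antideriv[OF *(1) refl *(2,5)] C_infinity_on_antideriv[OF *(1) refl *(2,6)]])
      (use *(4) in simp)
qed

lemma partial_antideriv_same:
  assumes "smooth_near p f" shows "germ_eq p (partial v (antideriv p v f)) f"
proof -
  obtain B e S where *: "finite B" "0 < e" "cylinder p B e \<subseteq> UNIV" "finite S"
    "depends_only_on (cylinder p B e) S f" "C_infinity_on (cylinder p B e) f"
    using smooth_near_cylinder[OF assms, of UNIV] by auto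
  show ?thesis unfolding germ_eq_def
    by (rule eventually_mono[OF eventually_nhds_in_open[OF open_cylinder[OF *(1)] center_mem_cylinder[OF *(2)]]])
      (use partial_antideriv[OF *(1) refl *(2,6), of _ v v] in simp)
qed

lemma partial_antideriv_other:
  assumes "smooth_near p f" "germ_eq p (partial w f) (\<lambda>z. 0)" "w \<noteq> v"
  shows "germ_eq p (partial w (antideriv p v f)) (\<lambda>z. 0)"
proof -
  obtain N where N: "open N" "p \<in> N" "\<And>z. z \<in> N \<Longrightarrow> partial w f z = 0"
    using germ_eq_openE[OF assms(2)] by blast
  obtain B e S where *: "finite B" "0 < e" "cylinder p B e \<subseteq> N" "finite S"
    "depends_only_on (cylinder p B e) S f" "C_infinity_on (cylinder p B e) f"
    using smooth_near_cylinder[OF assms(1) N(1,2)] .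
  have "partial w (antideriv p v f) z = 0" if z: "z \<in> cylinder p B e" for z
  proof -
    have "partial w f (z(v := p v + \<tau> * (z v - p v))) = 0" if "\<tau> \<in> {0..1}" for \<tau>
      using segment_mem_cylinder[OF *(1) refl *(2) z that, of v] N(3) *(3) by blast
    then have "integral {0..1} (\<lambda>\<tau>. partial w f (z(v := p v + \<tau> * (z v - p v)))) = integral {0..1} (\<lambda>\<tau>::real. 0)"
      by (rule integral_cong)
    then have "antideriv p v (partial w f) z = 0" by (simp add: antideriv_def)
    then show ?thesis using partial_antideriv[OF *(1) refl *(2,6) z, of w v] assms(3) by simp
  qed
  then show ?thesis unfolding germ_eq_def
    by (intro eventually_mono[OF eventually_nhds_in_open[OF open_cylinder[OF *(1)] center_mem_cylinder[OF *(2)]]])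
qed

lemma smooth_near_affine:
  assumes \<Psi>: "affine_coords \<Psi>" and f: "smooth_near (\<Psi> q) f"
  shows "smooth_near q (\<lambda>y. f (\<Psi> y))"
proof -
  obtain N S where N: "open N" "\<Psi> q \<in> N" "finite S" "depends_only_on N S f" "C_infinity_on N f"
    using f unfolding smooth_near_def by blast
  obtain A where A: "finite A" "depends_only_on (\<Psi> -` N) A (\<lambda>y. f (\<Psi> y))"
    using depends_only_on_affine[OF \<Psi> N(4,3)] by blast
  show ?thesis
    by (rule smooth_nearI[OF open_vimage[OF N(1) affine_coords_continuous[OF \<Psi>]] _ A
          C_infinity_on_affine[OF \<Psi> N(1,5,4,3)]]) (use N(2) in simp)
qed

lemma eventually_comp:
  assumes "continuous_on UNIV \<Psi>" "\<forall>\<^sub>F z in nhds (\<Psi> q). P z"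
  shows "\<forall>\<^sub>F y in nhds q. P (\<Psi> y)"
proof -
  obtain N where "open N" "\<Psi> q \<in> N" "\<And>z. z \<in> N \<Longrightarrow> P z" using assms(2) unfolding eventually_nhds by blast
  then show ?thesis
    by (intro eventually_nhds_in_open[OF open_vimage[OF _ assms(1)], THEN eventually_mono]) auto
qed

lemma germ_eq_comp:
  assumes "continuous_on UNIV \<Psi>" "germ_eq (\<Psi> q) f g"
  shows "germ_eq q (\<lambda>y. f (\<Psi> y)) (\<lambda>y. g (\<Psi> y))"
  using eventually_comp[OF assms(1), where q = q and P = "\<lambda>z. f z = g z"] assms(2)
  unfolding germ_eq_def by simp

lemma eventually_partial_affine:
  assumes \<Psi>: "affine_coords \<Psi>" and f: "smooth_near (\<Psi> q) f"
  obtains S where "finite S" "\<forall>\<^sub>F z in nhds (\<Psi> q). \<forall>w. w \<notin> S \<longrightarrow> partial w f z = 0"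
    "\<forall>\<^sub>F y in nhds q. \<forall>v. partial v (\<lambda>y. f (\<Psi> y)) y = (\<Sum>w\<in>S. slope (\<lambda>y. \<Psi> y w) v * partial w f (\<Psi> y))"
proof -
  obtain N S where N: "open N" "\<Psi> q \<in> N" "finite S" "depends_only_on N S f" "C_infinity_on N f"
    using f unfolding smooth_near_def by blast
  have "\<forall>\<^sub>F y in nhds q. \<Psi> y \<in> N"
    by (rule eventually_comp[OF affine_coords_continuous[OF \<Psi>], where P = "\<lambda>z. z \<in> N",
          OF eventually_nhds_in_open[OF N(1,2)]])
  then have "\<forall>\<^sub>F y in nhds q. \<forall>v. partial v (\<lambda>y. f (\<Psi> y)) y = (\<Sum>w\<in>S. slope (\<lambda>y. \<Psi> y w) v * partial w f (\<Psi> y))"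
    by eventually_elim (intro allI partial_eqI has_partial_affine[OF \<Psi> N(1,5,4,3)])
  then show thesis
    by (rule that[OF N(3), rotated], intro eventually_mono[OF eventually_nhds_in_open[OF N(1,2)]])
      (use partial_eq_0[OF N(1,4)] in auto)
qed

definition freeze :: "('v \<Rightarrow> real) \<Rightarrow> 'v set \<Rightarrow> ('v \<Rightarrow> real) \<Rightarrow> ('v \<Rightarrow> real)" where
  "freeze p R z = (\<lambda>v. if v \<in> R then p v else z v)"

lemma affine_coords_freeze: "affine_coords (freeze p R)"
proof (rule affine_coordsI)
  show "affine_form (\<lambda>y. freeze p R y w)" for w
    by (cases "w \<in> R") (simp_all add: freeze_def affine_form_intros)
qed

lemma freeze_center [simp]: "freeze p R p = p"
  by (auto simp: freeze_def)

lemma smooth_near_freeze: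
  "smooth_near p f \<Longrightarrow> smooth_near p (\<lambda>z. f (freeze p R z))"
  using smooth_near_affine[OF affine_coords_freeze, of p R p f] by simp

lemma germ_eq_freeze_cong:
  "germ_eq p f g \<Longrightarrow> germ_eq p (\<lambda>z. f (freeze p R z)) (\<lambda>z. g (freeze p R z))"
  using germ_eq_comp[OF affine_coords_continuous[OF affine_coords_freeze], of p R p f g] by simp

lemma partial_freeze:
  assumes "v \<in> R" shows "partial v (\<lambda>z. f (freeze p R z)) z = 0"
proof -
  have "freeze p R (z(v := s)) = freeze p R z" for s using assms by (auto simp: freeze_def)
  then show ?thesis by (simp add: partial_def)
qed

lemma partial_freeze_other:
  assumes "v \<notin> R" shows "partial v (\<lambda>z. f (freeze p R z)) z = partial v f (freeze p R z)"
proof -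
  have "freeze p R (z(v := s)) = (freeze p R z)(v := s)" for s using assms by (auto simp: freeze_def)
  moreover have "freeze p R z v = z v" using assms by (simp add: freeze_def)
  ultimately show ?thesis by (simp add: partial_def)
qed

text \<open>A germ whose partial derivatives in the directions of \<open>R\<close> vanish does not depend on the
  variables in \<open>R\<close>, however many these are, so that they may be given their values at \<open>p\<close>.\<close>

lemma germ_eq_freeze:
  assumes f: "smooth_near p f" and R: "\<And>v. v \<in> R \<Longrightarrow> germ_eq p (partial v f) (\<lambda>z. 0)"
  shows "germ_eq p f (\<lambda>z. f (freeze p R z))"
proof -
  have "\<forall>\<^sub>F z in nhds p. \<forall>v\<in>R. partial v f z = 0"
    by (rule eventually_all_partials_zero[OF f R])
  then obtain N where N: "open N" "p \<in> N" "\<And>z v. z \<in> N \<Longrightarrow> v \<in> R \<Longrightarrow> partial v f z = 0"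
    unfolding eventually_nhds by blast
  obtain B e S where *: "finite B" "0 < e" "cylinder p B e \<subseteq> N" "finite S"
    "depends_only_on (cylinder p B e) S f" "C_infinity_on (cylinder p B e) f"
    using smooth_near_cylinder[OF f N(1,2)] .
  show ?thesis unfolding germ_eq_def
  proof (rule eventually_mono[OF eventually_nhds_in_open[OF open_cylinder[OF *(1)] center_mem_cylinder[OF *(2)]]])
    fix z assume z: "z \<in> cylinder p B e"
    show "f z = f (freeze p R z)"
    proof (rule eq_if_partials_0[OF *(1) refl *(2,6,5,4)])
      show "freeze p R z \<in> cylinder p B e" using z *(2) by (auto simp: cylinder_def freeze_def)
      show "partial v f x = 0" if "v \<in> R" "x \<in> cylinder p B e" for v x using N(3) *(3) that by blast
    qed (use z in \<open>auto simp: freeze_def\<close>)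
  qed
qed

section \<open>Vector fields\<close>

text \<open>Total derivatives have infinitely many coefficients, of which a function of finitely many
  variables sees only finitely many.\<close>

definition vf :: "('v \<Rightarrow> ('v \<Rightarrow> real) \<Rightarrow> real) \<Rightarrow> (('v \<Rightarrow> real) \<Rightarrow> real) \<Rightarrow> ('v \<Rightarrow> real) \<Rightarrow> real" where
  "vf c f z = Sum_any (\<lambda>v. c v z * partial v f z)"

lemma Sum_any_eq_sum:
  assumes "finite S" "\<And>v. v \<notin> S \<Longrightarrow> g v = 0"
  shows "Sum_any g = sum g S"
  by (rule Sum_any.expand_superset) (use assms in auto)

lemma vf_eq_sum:
  assumes "finite S" "\<And>v. v \<notin> S \<Longrightarrow> partial v f z = 0"
  shows "vf c f z = (\<Sum>v\<in>S. c v z * partial v f z)"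
  unfolding vf_def by (rule Sum_any_eq_sum[OF assms(1)]) (simp add: assms(2))

lemma vf_coordinate [simp]: "vf c (\<lambda>z. z v) z = c v z"
  by (subst vf_eq_sum[of "{v}"]) (auto simp: partial_coordinate)

lemma vf_const [simp]: "vf c (\<lambda>z. a) = (\<lambda>z. 0)"
  by (rule ext) (simp add: vf_def)

lemma vf_cong:
  assumes "germ_eq p f g" shows "germ_eq p (vf c f) (vf c g)"
  using eventually_partial_cong[OF assms] unfolding germ_eq_def vf_def
  by eventually_elim simp

lemma vf_zero:
  assumes "germ_eq p f (\<lambda>z. 0)" shows "germ_eq p (vf c f) (\<lambda>z. 0)"
  using vf_cong[OF assms, of c] by simp

lemma smooth_near_vf:
  assumes "\<And>v. smooth_near p (c v)" "smooth_near p f"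
  shows "smooth_near p (vf c f)"
proof -
  obtain S where S: "finite S" "\<forall>\<^sub>F z in nhds p. \<forall>v. v \<notin> S \<longrightarrow> partial v f z = 0"
    using finite_support[OF assms(2)] .
  have "germ_eq p (\<lambda>z. \<Sum>v\<in>S. c v z * partial v f z) (vf c f)"
    using S(2) unfolding germ_eq_def by eventually_elim (rule vf_eq_sum[OF S(1), symmetric], blast)
  moreover have "smooth_near p (\<lambda>z. \<Sum>v\<in>S. c v z * partial v f z)"
    by (intro smooth_near_intros assms)
  ultimately show ?thesis using smooth_near_cong by blast
qed

lemma common_finite_support:
  assumes "smooth_near p f" "smooth_near p g"
  obtains S where "finite S" "\<forall>\<^sub>F z in nhds p. \<forall>v. v \<notin> S \<longrightarrow> partial v f z = 0 \<and> partial v g z = 0"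
proof -
  obtain S where S: "finite S" "\<forall>\<^sub>F z in nhds p. \<forall>v. v \<notin> S \<longrightarrow> partial v f z = 0"
    using finite_support[OF assms(1)] .
  obtain S' where S': "finite S'" "\<forall>\<^sub>F z in nhds p. \<forall>v. v \<notin> S' \<longrightarrow> partial v g z = 0"
    using finite_support[OF assms(2)] .
  from S(2) S'(2) have "\<forall>\<^sub>F z in nhds p. \<forall>v. v \<notin> S \<union> S' \<longrightarrow> partial v f z = 0 \<and> partial v g z = 0"
    by eventually_elim auto
  then show thesis using that[of "S \<union> S'"] S(1) S'(1) by simp
qed

lemma vf_mult:
  assumes "smooth_near p f" "smooth_near p g"
  shows "germ_eq p (vf c (\<lambda>z. f z * g z)) (\<lambda>z. vf c f z * g z + f z * vf c g z)"
proof -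
  obtain S where S: "finite S" "\<forall>\<^sub>F z in nhds p. \<forall>v. v \<notin> S \<longrightarrow> partial v f z = 0 \<and> partial v g z = 0"
    using common_finite_support[OF assms] .
  from S(2) eventually_partial_mult[OF assms] show ?thesis unfolding germ_eq_def
  proof eventually_elim
    case (elim z)
    then show ?case
      by (simp add: vf_eq_sum[OF S(1)] sum_distrib_left sum_distrib_right flip: sum.distrib)
        (simp add: algebra_simps)
  qed
qed

lemma vf_add:
  assumes "smooth_near p f" "smooth_near p g"
  shows "germ_eq p (vf c (\<lambda>z. f z + g z)) (\<lambda>z. vf c f z + vf c g z)"
proof -
  obtain S where S: "finite S" "\<forall>\<^sub>F z in nhds p. \<forall>v. v \<notin> S \<longrightarrow> partial v f z = 0 \<and> partial v g z = 0"
    using common_finite_support[OF assms] .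
  from S(2) eventually_partial_add[OF assms] show ?thesis unfolding germ_eq_def
  proof eventually_elim
    case (elim z)
    then show ?case
      by (simp add: vf_eq_sum[OF S(1)] distrib_left flip: sum.distrib)
  qed
qed

lemma vf_cmult:
  assumes "smooth_near p f"
  shows "germ_eq p (vf c (\<lambda>z. a * f z)) (\<lambda>z. a * vf c f z)"
  using vf_mult[OF smooth_near_const[of p a] assms, of c] by simp

lemma vf_minus:
  assumes "smooth_near p f" shows "germ_eq p (vf c (\<lambda>z. - f z)) (\<lambda>z. - vf c f z)"
  using vf_cmult[OF assms, of c "-1"] by simp

lemma vf_diff:
  assumes "smooth_near p f" "smooth_near p g"
  shows "germ_eq p (vf c (\<lambda>z. f z - g z)) (\<lambda>z. vf c f z - vf c g z)"
  using vf_add[OF assms(1) smooth_near_minus[OF assms(2)], of c] vf_minus[OF assms(2), of c]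
  unfolding germ_eq_def by eventually_elim simp

lemma vf_sum:
  assumes "\<And>i. i \<in> I \<Longrightarrow> smooth_near p (f i)"
  shows "germ_eq p (vf c (\<lambda>z. \<Sum>i\<in>I. f i z)) (\<lambda>z. \<Sum>i\<in>I. vf c (f i) z)"
  using assms
proof (induction I rule: infinite_finite_induct)
  case (insert i I)
  have "germ_eq p (vf c (\<lambda>z. f i z + (\<Sum>i\<in>I. f i z))) (\<lambda>z. vf c (f i) z + vf c (\<lambda>z. \<Sum>i\<in>I. f i z) z)"
    by (rule vf_add) (use insert.prems in auto)
  moreover have "germ_eq p (vf c (\<lambda>z. \<Sum>i\<in>I. f i z)) (\<lambda>z. \<Sum>i\<in>I. vf c (f i) z)"
    by (rule insert.IH) (use insert.prems in auto)
  ultimately show ?case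
    unfolding germ_eq_def by eventually_elim (use insert.hyps insert.prems in auto)
qed auto

lemma vf_linear:
  assumes "smooth_near p f" "smooth_near p g"
  shows "germ_eq p (vf c (\<lambda>z. a * f z + g z)) (\<lambda>z. a * vf c f z + vf c g z)"
  using vf_add[OF smooth_near_mult[OF smooth_near_const assms(1)] assms(2), of c a] vf_cmult[OF assms(1), of c a]
  unfolding germ_eq_def by eventually_elim simp

lemma smooth_near_linear:
  "smooth_near p f \<Longrightarrow> smooth_near p g \<Longrightarrow> smooth_near p (\<lambda>z. a * f z + g z)"
  by (intro smooth_near_intros)

lemma partial_partial_zero:
  assumes "smooth_near p f" "germ_eq p (partial v f) (\<lambda>z. 0)"
  shows "germ_eq p (partial v (partial w f)) (\<lambda>z. 0)"
  using eventually_partial_commute[OF assms(1)] germ_eq_partial[OF assms(2), of w]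
  unfolding germ_eq_def by eventually_elim simp

text \<open>By the symmetry of second derivatives, commuting \<open>\<partial>\<^sub>w\<close> with a vector field leaves the field
  with differentiated coefficients.\<close>

lemma partial_vf:
  assumes f: "smooth_near p f" and c: "\<And>v. smooth_near p (c v)"
  shows "germ_eq p (partial w (vf c f)) (\<lambda>z. vf c (partial w f) z + vf (\<lambda>v. partial w (c v)) f z)"
proof -
  obtain S where S: "finite S" "\<forall>\<^sub>F z in nhds p. \<forall>v. v \<notin> S \<longrightarrow> partial v f z = 0 \<and> partial v (partial w f) z = 0"
    using common_finite_support[OF f smooth_near_partial[OF f]] .
  have "germ_eq p (vf c f) (\<lambda>z. \<Sum>v\<in>S. c v z * partial v f z)"
    using S(2) unfolding germ_eq_def by eventually_elim (rule vf_eq_sum[OF S(1)], blast)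
  note eventually_partial_cong[OF this]
  moreover have "\<forall>\<^sub>F z in nhds p. \<forall>w. partial w (\<lambda>z. \<Sum>v\<in>S. c v z * partial v f z) z =
      (\<Sum>v\<in>S. partial w (\<lambda>z. c v z * partial v f z) z)"
    by (intro eventually_partial_sum smooth_near_intros f c)
  moreover have "\<forall>\<^sub>F z in nhds p. \<forall>v\<in>S. \<forall>w. partial w (\<lambda>z. c v z * partial v f z) z =
      partial w (c v) z * partial v f z + c v z * partial w (partial v f) z"
    by (rule eventually_ball_finite[OF S(1)]) (use f c eventually_partial_mult in blast)
  moreover note S(2) eventually_partial_commute[OF f]
  ultimately show ?thesis unfolding germ_eq_def
  proof eventually_elim
    case (elim z)
    have "vf c (partial w f) z = (\<Sum>v\<in>S. c v z * partial v (partial w f) z)"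
      "vf (\<lambda>v. partial w (c v)) f z = (\<Sum>v\<in>S. partial w (c v) z * partial v f z)"
      using elim(4) by (auto intro: vf_eq_sum[OF S(1)])
    moreover have "partial w (partial v f) z = partial v (partial w f) z" for v using elim(5) by blast
    ultimately show ?case using elim(1-3) by (simp add: sum.distrib)
  qed
qed

text \<open>The second-order part of a composition of two vector fields is symmetric in the two, so
  vector fields commute as soon as they commute on the coordinates.\<close>

lemma vf_commute:
  assumes f: "smooth_near p f" and c: "\<And>v. smooth_near p (c v)" and d: "\<And>v. smooth_near p (d v)"
    and cd: "\<And>v. germ_eq p (vf c (d v)) (vf d (c v))"
  shows "germ_eq p (vf c (vf d f)) (vf d (vf c f))"
proof -
  obtain S where S: "finite S" "\<forall>\<^sub>F z in nhds p. \<forall>v. v \<notin> S \<longrightarrow> partial v f z = 0"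
    using finite_support[OF f] .
  have S0: "germ_eq p (partial v f) (\<lambda>z. 0)" if "v \<notin> S" for v
    using S(2) unfolding germ_eq_def by eventually_elim (use that in blast)
  have main: "germ_eq p (vf c (vf d f))
      (\<lambda>z. (\<Sum>v\<in>S. vf c (d v) z * partial v f z) + (\<Sum>v\<in>S. \<Sum>w\<in>S. d v z * c w z * partial w (partial v f) z))"
    if c: "\<And>v. smooth_near p (c v)" and d: "\<And>v. smooth_near p (d v)" for c d
  proof -
    have "germ_eq p (vf d f) (\<lambda>z. \<Sum>v\<in>S. d v z * partial v f z)"
      using S(2) unfolding germ_eq_def by eventually_elim (rule vf_eq_sum[OF S(1)], blast)
    then have "germ_eq p (vf c (vf d f)) (vf c (\<lambda>z. \<Sum>v\<in>S. d v z * partial v f z))"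
      by (rule vf_cong)
    moreover have "germ_eq p (vf c (\<lambda>z. \<Sum>v\<in>S. d v z * partial v f z)) (\<lambda>z. \<Sum>v\<in>S. vf c (\<lambda>z. d v z * partial v f z) z)"
      by (intro vf_sum smooth_near_intros f d)
    moreover have "\<forall>\<^sub>F z in nhds p. \<forall>v\<in>S. vf c (\<lambda>z. d v z * partial v f z) z =
        vf c (d v) z * partial v f z + d v z * vf c (partial v f) z"
      by (rule eventually_ball_finite[OF S(1)])
        (use vf_mult[OF d smooth_near_partial[OF f]] in \<open>auto simp: germ_eq_def\<close>)
    moreover have "\<forall>\<^sub>F z in nhds p. \<forall>v\<in>S. vf c (partial v f) z = (\<Sum>w\<in>S. c w z * partial w (partial v f) z)"
    proof (rule eventually_ball_finite[OF S(1)], rule ballI)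
      fix v
      obtain S' where S': "finite S'" "\<forall>\<^sub>F z in nhds p. \<forall>w. w \<notin> S' \<longrightarrow> partial w (partial v f) z = 0"
        using finite_support[OF smooth_near_partial[OF f]] .
      have "\<forall>\<^sub>F z in nhds p. \<forall>w\<in>S' - S. partial w (partial v f) z = 0"
        using partial_partial_zero[OF f S0] S'(1) unfolding germ_eq_def by (intro eventually_ball_finite) auto
      with S'(2) show "\<forall>\<^sub>F z in nhds p. vf c (partial v f) z = (\<Sum>w\<in>S. c w z * partial w (partial v f) z)"
        by eventually_elim (rule vf_eq_sum[OF S(1)], blast)
    qed
    ultimately show ?thesis unfolding germ_eq_def
      by eventually_elim (simp add: sum.distrib sum_distrib_left mult.assoc)
  qed
  have "\<forall>\<^sub>F z in nhds p. \<forall>v\<in>S. vf c (d v) z = vf d (c v) z"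
    by (rule eventually_ball_finite[OF S(1)]) (use cd in \<open>auto simp: germ_eq_def\<close>)
  with main[of c d, OF c d] main[of d c, OF d c] eventually_partial_commute[OF f] show ?thesis unfolding germ_eq_def
  proof eventually_elim
    case (elim z)
    have "(\<Sum>v\<in>S. \<Sum>w\<in>S. d v z * c w z * partial w (partial v f) z) =
          (\<Sum>w\<in>S. \<Sum>v\<in>S. d v z * c w z * partial w (partial v f) z)" by (rule sum.swap)
    also have "\<dots> = (\<Sum>v\<in>S. \<Sum>w\<in>S. c v z * d w z * partial w (partial v f) z)"
      using elim(3) by (intro sum.cong refl) (simp add: mult_ac)
    finally show ?case using elim(1,2,4) by simp
  qed
qed

text \<open>The chain rule for vector fields under an affine change of coordinates: the coefficients of
  the pushed forward field are the values of the linear part of \<open>\<Psi>\<close> on the coefficients \<open>c\<close>.\<close>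

lemma vf_affine:
  assumes \<Psi>: "affine_coords \<Psi>" and f: "smooth_near (\<Psi> q) f"
  shows "germ_eq q (vf c (\<lambda>y. f (\<Psi> y)))
    (\<lambda>y. Sum_any (\<lambda>w. (\<Psi> (\<lambda>v. c v y) w - \<Psi> (\<lambda>v. 0) w) * partial w f (\<Psi> y)))"
proof -
  obtain S where S: "finite S" "\<forall>\<^sub>F z in nhds (\<Psi> q). \<forall>w. w \<notin> S \<longrightarrow> partial w f z = 0"
    "\<forall>\<^sub>F y in nhds q. \<forall>v. partial v (\<lambda>y. f (\<Psi> y)) y = (\<Sum>w\<in>S. slope (\<lambda>y. \<Psi> y w) v * partial w f (\<Psi> y))"
    using eventually_partial_affine[OF \<Psi> f] .
  have "\<forall>w. \<exists>A. finite A \<and> (\<forall>v. v \<notin> A \<longrightarrow> slope (\<lambda>y. \<Psi> y w) v = 0) \<and>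
      (\<forall>c. (\<Sum>v\<in>A. c v * slope (\<lambda>y. \<Psi> y w) v) = \<Psi> c w - \<Psi> (\<lambda>v. 0) w)"
    using affine_form_sum[OF affine_coordsD[OF \<Psi>]] by blast
  from choice[OF this] obtain A where A': "\<forall>w. finite (A w) \<and> (\<forall>v. v \<notin> A w \<longrightarrow> slope (\<lambda>y. \<Psi> y w) v = 0) \<and>
      (\<forall>c. (\<Sum>v\<in>A w. c v * slope (\<lambda>y. \<Psi> y w) v) = \<Psi> c w - \<Psi> (\<lambda>v. 0) w)" ..
  have A: "finite (A w)" "v \<notin> A w \<Longrightarrow> slope (\<lambda>y. \<Psi> y w) v = 0"
    "(\<Sum>v\<in>A w. c v * slope (\<lambda>y. \<Psi> y w) v) = \<Psi> c w - \<Psi> (\<lambda>v. 0) w" for w v c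
    using A'[rule_format, of w] by blast+
  define AS where "AS = (\<Union>w\<in>S. A w)"
  have AS: "finite AS" using A(1) S(1) by (simp add: AS_def)
  have AS0: "slope (\<lambda>y. \<Psi> y w) v = 0" if "w \<in> S" "v \<notin> AS" for w v using that A(2) by (auto simp: AS_def)
  have AS_sum: "(\<Sum>v\<in>AS. c v * slope (\<lambda>y. \<Psi> y w) v) = \<Psi> c w - \<Psi> (\<lambda>v. 0) w" if "w \<in> S" for w c
    unfolding A(3)[symmetric]
    by (rule sum.mono_neutral_right[OF AS]) (use that A(2) in \<open>auto simp: AS_def\<close>)
  from S(3) eventually_comp[OF affine_coords_continuous[OF \<Psi>],
      where P = "\<lambda>z. \<forall>w. w \<notin> S \<longrightarrow> partial w f z = 0", OF S(2)] show ?thesis unfolding germ_eq_def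
  proof eventually_elim
    case (elim y)
    have "vf c (\<lambda>y. f (\<Psi> y)) y = (\<Sum>v\<in>AS. c v y * (\<Sum>w\<in>S. slope (\<lambda>y. \<Psi> y w) v * partial w f (\<Psi> y)))"
      using elim(1) AS0 by (subst vf_eq_sum[OF AS]) auto
    also have "\<dots> = (\<Sum>w\<in>S. (\<Sum>v\<in>AS. c v y * slope (\<lambda>y. \<Psi> y w) v) * partial w f (\<Psi> y))"
      by (simp add: sum_distrib_left sum_distrib_right mult.assoc) (rule sum.swap)
    also have "\<dots> = (\<Sum>w\<in>S. (\<Psi> (\<lambda>v. c v y) w - \<Psi> (\<lambda>v. 0) w) * partial w f (\<Psi> y))"
      by (intro sum.cong refl arg_cong2[where f = "(*)"] AS_sum)
    also have "\<dots> = Sum_any (\<lambda>w. (\<Psi> (\<lambda>v. c v y) w - \<Psi> (\<lambda>v. 0) w) * partial w f (\<Psi> y))"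
      by (rule Sum_any_eq_sum[symmetric, OF S(1)]) (use elim(2) in simp)
    finally show ?case .
  qed
qed

lemma vf_affine_related:
  assumes "affine_coords \<Psi>" "smooth_near (\<Psi> q) f"
    and "\<And>w y. \<Psi> (\<lambda>v. c v y) w - \<Psi> (\<lambda>v. 0) w = d w (\<Psi> y)"
  shows "germ_eq q (vf c (\<lambda>y. f (\<Psi> y))) (\<lambda>y. vf d f (\<Psi> y))"
  using vf_affine[OF assms(1,2), of c] by (simp add: assms(3) vf_def)

lemma partial_coordinate_half: "partial v (\<lambda>z. z w / 2) z = (if v = w then 1 / 2 else 0)"
  by (rule partial_eqI) (auto intro!: derivative_eq_intros)

lemma vf_coordinate_half [simp]: "vf c (\<lambda>z. z v / 2) z = c v z / 2"
  by (subst vf_eq_sum[of "{v}"]) (auto simp: partial_coordinate_half)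

lemma vf_add_field:
  assumes "smooth_near p f"
  shows "germ_eq p (vf (\<lambda>v z. c v z + d v z) f) (\<lambda>z. vf c f z + vf d f z)"
proof -
  obtain S where S: "finite S" "\<forall>\<^sub>F z in nhds p. \<forall>v. v \<notin> S \<longrightarrow> partial v f z = 0"
    using finite_support[OF assms] .
  from S(2) show ?thesis unfolding germ_eq_def
    by eventually_elim (simp add: vf_eq_sum[OF S(1)] distrib_right sum.distrib)
qed

lemma vf_diff_field:
  assumes "smooth_near p f"
  shows "germ_eq p (vf (\<lambda>v z. c v z - d v z) f) (\<lambda>z. vf c f z - vf d f z)"
proof -
  obtain S where S: "finite S" "\<forall>\<^sub>F z in nhds p. \<forall>v. v \<notin> S \<longrightarrow> partial v f z = 0"
    using finite_support[OF assms] .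
  from S(2) show ?thesis unfolding germ_eq_def
    by eventually_elim (simp add: vf_eq_sum[OF S(1)] left_diff_distrib sum_subtractf)
qed

section \<open>Light-cone coordinates on the solution set\<close>

subsection \<open>Total derivatives as vector fields\<close>

definition field_t :: "jet_var \<Rightarrow> jet \<Rightarrow> real" where
  "field_t v z = (case v of T \<Rightarrow> 1 | X \<Rightarrow> 0 | U i j \<Rightarrow> z (U (i + 1) j))"

definition field_x :: "jet_var \<Rightarrow> jet \<Rightarrow> real" where
  "field_x v z = (case v of T \<Rightarrow> 0 | X \<Rightarrow> 1 | U i j \<Rightarrow> z (U i (j + 1)))"

definition field_check :: "nat \<Rightarrow> (nat \<Rightarrow> real) \<Rightarrow> real" where
  "field_check l y = (if l = 0 then 1 else y (l + 1))"

lemma Sum_any_jet_var: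
  assumes "finite S" "\<And>v. v \<notin> S \<Longrightarrow> g v = (0::real)"
  shows "Sum_any g = g T + g X + Sum_any (\<lambda>(i, j). g (U i j))"
proof -
  let ?I = "(\<lambda>(i, j). U i j) -` S"
  have I: "finite ?I" by (rule finite_vimageI[OF assms(1)]) (auto simp: inj_on_def)
  have "Sum_any g = sum g (insert T (insert X ((\<lambda>(i, j). U i j) ` ?I)))"
  proof (rule Sum_any_eq_sum)
    fix v assume v: "v \<notin> insert T (insert X ((\<lambda>(i, j). U i j) ` ?I))"
    have "v \<notin> S"
    proof
      assume "v \<in> S"
      then show False using v by (cases v) (auto simp: image_iff)
    qed
    then show "g v = 0" by (rule assms(2))
  qed (intro finite.insertI finite_imageI I)
  also have "\<dots> = g T + (g X + sum g ((\<lambda>(i, j). U i j) ` ?I))"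
  proof -
    have *: "finite J \<Longrightarrow> T \<notin> J \<Longrightarrow> X \<notin> J \<Longrightarrow> sum g (insert T (insert X J)) = g T + (g X + sum g J)" for J
      by simp
    show ?thesis by (rule *[OF finite_imageI[OF I]]) auto
  qed
  also have "sum g ((\<lambda>(i, j). U i j) ` ?I) = sum (\<lambda>(i, j). g (U i j)) ?I"
    by (subst sum.reindex) (auto simp: inj_on_def intro!: sum.cong)
  also have "\<dots> = Sum_any (\<lambda>(i, j). g (U i j))"
    by (rule Sum_any_eq_sum[symmetric, OF I]) (auto simp: assms(2))
  finally show ?thesis by simp
qed

lemma D_t_eq_vf:
  assumes "smooth_near p f" shows "germ_eq p (D_t f) (vf field_t f)"
proof -
  obtain S where S: "finite S" "\<forall>\<^sub>F z in nhds p. \<forall>v. v \<notin> S \<longrightarrow> partial v f z = 0"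
    using finite_support[OF assms] .
  from S(2) show ?thesis unfolding germ_eq_def
  proof eventually_elim
    case (elim z)
    show ?case unfolding vf_def D_t_def
      by (subst Sum_any_jet_var[OF S(1)]) (use elim in \<open>auto simp: field_t_def\<close>)
  qed
qed

lemma D_x_eq_vf:
  assumes "smooth_near p f" shows "germ_eq p (D_x f) (vf field_x f)"
proof -
  obtain S where S: "finite S" "\<forall>\<^sub>F z in nhds p. \<forall>v. v \<notin> S \<longrightarrow> partial v f z = 0"
    using finite_support[OF assms] .
  from S(2) show ?thesis unfolding germ_eq_def
  proof eventually_elim
    case (elim z)
    show ?case unfolding vf_def D_x_def
      by (subst Sum_any_jet_var[OF S(1)]) (use elim in \<open>auto simp: field_x_def\<close>)
  qed
qed

lemma D_check_eq_vf:
  assumes "smooth_near p f" shows "germ_eq p (D_check f) (vf field_check f)"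
proof -
  obtain S where S: "finite S" "\<forall>\<^sub>F z in nhds p. \<forall>v. v \<notin> S \<longrightarrow> partial v f z = 0"
    using finite_support[OF assms] .
  from S(2) show ?thesis unfolding germ_eq_def
  proof eventually_elim
    case (elim z)
    have "vf field_check f z = (\<Sum>v\<in>insert 0 S. field_check v z * partial v f z)"
      by (rule vf_eq_sum) (use S(1) elim in auto)
    also have "\<dots> = partial 0 f z + (\<Sum>v\<in>S - {0}. field_check v z * partial v f z)"
      using S(1) by (simp add: sum.insert_remove field_check_def)
    also have "(\<Sum>v\<in>S - {0}. field_check v z * partial v f z) =
        Sum_any (\<lambda>l. if l \<ge> 1 then z (l + 1) * partial l f z else 0)"
      by (subst Sum_any_eq_sum[of "S - {0}"])
        (use S(1) elim in \<open>auto simp: field_check_def intro!: sum.cong\<close>)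
    finally show ?case by (simp add: D_check_def)
  qed
qed

lemma smooth_near_field_t: "smooth_near p (field_t v)"
  by (cases v) (simp_all add: field_t_def[abs_def] smooth_near_intros)

lemma smooth_near_field_x: "smooth_near p (field_x v)"
  by (cases v) (simp_all add: field_x_def[abs_def] smooth_near_intros)

lemma smooth_near_field_check: "smooth_near p (field_check v)"
  by (cases "v = 0") (simp_all add: field_check_def[abs_def] smooth_near_intros)

lemma smooth_near_D_t: "smooth_near p f \<Longrightarrow> smooth_near p (D_t f)"
  by (rule smooth_near_cong[OF smooth_near_vf[OF smooth_near_field_t] germ_eq_sym[OF D_t_eq_vf]])

lemma smooth_near_D_x: "smooth_near p f \<Longrightarrow> smooth_near p (D_x f)"
  by (rule smooth_near_cong[OF smooth_near_vf[OF smooth_near_field_x] germ_eq_sym[OF D_x_eq_vf]])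

lemma smooth_near_D_check: "smooth_near p f \<Longrightarrow> smooth_near p (D_check f)"
  by (rule smooth_near_cong[OF smooth_near_vf[OF smooth_near_field_check] germ_eq_sym[OF D_check_eq_vf]])

subsection \<open>The coordinates\<close>

text \<open>\<open>W True\<close> are the coordinates \<open>\<xi>, w\<^sub>1\<^sub>0, w\<^sub>2\<^sub>0, \<dots>\<close>, \<open>W False\<close> are \<open>\<eta>, w\<^sub>0\<^sub>1, w\<^sub>0\<^sub>2, \<dots>\<close>, and
  \<open>V\<close> is \<open>u\<close>. A Boolean selects one of the two families of characteristics, so that statements
  symmetric in \<open>\<xi>\<close> and \<open>\<eta>\<close> are proved once.\<close>

datatype cone_var = V | W bool nat

type_synonym cone = "cone_var \<Rightarrow> real"

definition sg :: "bool \<Rightarrow> real" where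
  "sg b = (if b then 1 else - 1)"

definition cone_coord :: "bool \<Rightarrow> jet \<Rightarrow> nat \<Rightarrow> real" where
  "cone_coord b z n = (if n = 0 then z X + sg b * z T else z (U 0 n) + sg b * z (U 1 (n - 1)))"

definition to_cone :: "jet \<Rightarrow> cone" where
  "to_cone z v = (case v of V \<Rightarrow> z (U 0 0) | W b n \<Rightarrow> cone_coord b z n)"

definition of_cone :: "cone \<Rightarrow> jet" where
  "of_cone y v = (case v of
       T \<Rightarrow> (y (W True 0) - y (W False 0)) / 2
     | X \<Rightarrow> (y (W True 0) + y (W False 0)) / 2
     | U i j \<Rightarrow> if i + j = 0 then y V
         else (y (W True (i + j)) + (-1) ^ i * y (W False (i + j))) / 2)"

definition strand :: "bool \<Rightarrow> cone \<Rightarrow> nat \<Rightarrow> real" where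
  "strand b y n = y (W b n)"

text \<open>The values at \<open>q\<close> complete a point of one strand to a point of all coordinates; functions
  that depend on this strand only are recovered from their restrictions to its image.\<close>

definition unstrand :: "cone \<Rightarrow> bool \<Rightarrow> (nat \<Rightarrow> real) \<Rightarrow> cone" where
  "unstrand q b x v = (case v of V \<Rightarrow> q V | W b' n \<Rightarrow> if b' = b then x n else q v)"

lemma xi_coords_eq: "xi_coords = cone_coord True"
  by (auto simp: fun_eq_iff xi_coords_def cone_coord_def sg_def)

lemma eta_coords_eq: "eta_coords = cone_coord False"
  by (auto simp: fun_eq_iff eta_coords_def cone_coord_def sg_def)

lemma strand_to_cone: "strand b (to_cone z) = cone_coord b z"
  by (simp add: fun_eq_iff strand_def to_cone_def)

lemma affine_cone_coord: "affine_coords (cone_coord b)"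
proof (rule affine_coordsI)
  show "affine_form (\<lambda>y. cone_coord b y n)" for n
    by (cases "n = 0") (simp_all add: cone_coord_def affine_form_intros)
qed

lemma affine_to_cone: "affine_coords to_cone"
proof (rule affine_coordsI)
  show "affine_form (\<lambda>y. to_cone y v)" for v
    by (cases v) (simp_all add: to_cone_def affine_form_intros affine_coordsD[OF affine_cone_coord])
qed

lemma affine_of_cone: "affine_coords of_cone"
proof (rule affine_coordsI)
  show "affine_form (\<lambda>y. of_cone y v)" for v
  proof (cases v)
    case (U i j)
    have "(\<lambda>y. of_cone y v) = (if i + j = 0 then (\<lambda>y. y V)
        else (\<lambda>y. (y (W True (i + j)) + (-1) ^ i * y (W False (i + j))) / 2))"
      by (auto simp: U of_cone_def)
    then show ?thesis by (simp add: affine_form_intros)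
  qed (simp_all add: of_cone_def affine_form_intros)
qed

lemma affine_strand: "affine_coords (strand b)"
  by (rule affine_coordsI) (simp add: strand_def affine_form_intros)

lemma affine_unstrand: "affine_coords (unstrand q b)"
proof (rule affine_coordsI)
  show "affine_form (\<lambda>y. unstrand q b y v)" for v
  proof (cases v)
    case (W b' n)
    then show ?thesis by (cases "b' = b") (simp_all add: unstrand_def affine_form_intros)
  qed (simp_all add: unstrand_def affine_form_intros)
qed

lemma to_cone_of_cone [simp]: "to_cone (of_cone y) = y"
proof
  fix v
  have "cone_coord b (of_cone y) n = y (W b n)" for b n
    by (cases n; cases b) (simp_all add: cone_coord_def of_cone_def sg_def field_simps)
  then show "to_cone (of_cone y) v = y v"
    by (cases v) (simp_all add: to_cone_def of_cone_def)
qed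

lemma cone_coord_of_cone [simp]: "cone_coord b (of_cone y) = strand b y"
  unfolding strand_to_cone[symmetric] by simp

lemma of_cone_in_solution_set [simp]: "of_cone y \<in> solution_set"
  by (auto simp: solution_set_def of_cone_def)

lemma of_cone_to_cone:
  assumes "z \<in> solution_set" shows "of_cone (to_cone z) = z"
proof
  have red: "z (U i j) = (if even i then z (U 0 (i + j)) else z (U 1 (i + j - 1)))" for i j
  proof (induction i arbitrary: j rule: less_induct)
    case (less i)
    show ?case
    proof (cases "i < 2")
      case True
      then consider "i = 0" | "i = 1" by linarith
      then show ?thesis by cases auto
    next
      case False
      then obtain k where k: "i = k + 2" by (metis add.commute le_Suc_ex not_less)
      have "z (U i j) = z (U k (j + 2))" using assms by (simp add: solution_set_def k)
      also have "\<dots> = (if even k then z (U 0 (k + (j + 2))) else z (U 1 (k + (j + 2) - 1)))"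
        using less[of k "j + 2"] by (simp add: k)
      also have "\<dots> = (if even i then z (U 0 (i + j)) else z (U 1 (i + j - 1)))"
        by (auto simp: k ac_simps)
      finally show ?thesis .
    qed
  qed
  fix v show "of_cone (to_cone z) v = z v"
  proof (cases v)
    case (U i j)
    show ?thesis
    proof (cases "i + j = 0")
      case False
      then show ?thesis using red[of i j]
        by (auto simp: U of_cone_def to_cone_def cone_coord_def sg_def)
    qed (simp add: U of_cone_def to_cone_def)
  qed (simp_all add: of_cone_def to_cone_def cone_coord_def sg_def)
qed

text \<open>Vanishing on solutions is thereby an identity of germs in the light-cone coordinates.\<close>

lemma vanishes_iff:
  assumes "p \<in> solution_set"
  shows "vanishes_on_solutions p f \<longleftrightarrow> germ_eq (to_cone p) (\<lambda>y. f (of_cone y)) (\<lambda>y. 0)"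
proof
  assume "vanishes_on_solutions p f"
  then have "\<forall>\<^sub>F z in nhds (of_cone (to_cone p)). z \<in> solution_set \<longrightarrow> f z = 0"
    by (simp add: vanishes_on_solutions_def of_cone_to_cone[OF assms])
  from eventually_comp[OF affine_coords_continuous[OF affine_of_cone],
      where P = "\<lambda>z. z \<in> solution_set \<longrightarrow> f z = 0", OF this]
  show "germ_eq (to_cone p) (\<lambda>y. f (of_cone y)) (\<lambda>y. 0)" by (simp add: germ_eq_def)
next
  assume "germ_eq (to_cone p) (\<lambda>y. f (of_cone y)) (\<lambda>y. 0)"
  then have "\<forall>\<^sub>F y in nhds (to_cone p). f (of_cone y) = 0" by (simp add: germ_eq_def)
  from eventually_comp[OF affine_coords_continuous[OF affine_to_cone],
      where P = "\<lambda>y. f (of_cone y) = 0", OF this]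
  show "vanishes_on_solutions p f"
    unfolding vanishes_on_solutions_def by eventually_elim (auto simp: of_cone_to_cone)
qed

subsection \<open>The characteristic derivatives\<close>

text \<open>The restrictions of \<open>(D\<^sub>x + D\<^sub>t)/2\<close> and \<open>(D\<^sub>x - D\<^sub>t)/2\<close> to the solution set; each of them
  moves only along its own family of coordinates and along \<open>u\<close>.\<close>

definition cone_field :: "bool \<Rightarrow> cone_var \<Rightarrow> cone \<Rightarrow> real" where
  "cone_field b v y = (case v of V \<Rightarrow> y (W b 1) / 2
     | W b' n \<Rightarrow> if b' = b then (if n = 0 then 1 else y (W b (n + 1))) else 0)"

abbreviation "cone_D b \<equiv> vf (cone_field b)"

definition cone_t :: "(cone \<Rightarrow> real) \<Rightarrow> cone \<Rightarrow> real" where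
  "cone_t f y = cone_D True f y - cone_D False f y"

definition cone_x :: "(cone \<Rightarrow> real) \<Rightarrow> cone \<Rightarrow> real" where
  "cone_x f y = cone_D True f y + cone_D False f y"

lemma smooth_near_cone_field: "smooth_near q (cone_field b v)"
proof (cases v)
  case (W b' n)
  then show ?thesis
    by (cases "b' = b"; cases "n = 0") (simp_all add: cone_field_def[abs_def] smooth_near_intros)
qed (simp_all add: cone_field_def[abs_def] smooth_near_intros)

lemma smooth_near_cone_D: "smooth_near q f \<Longrightarrow> smooth_near q (cone_D b f)"
  by (rule smooth_near_vf[OF smooth_near_cone_field])

lemma smooth_near_cone_t: "smooth_near q f \<Longrightarrow> smooth_near q (cone_t f)"
  unfolding cone_t_def[abs_def] by (intro smooth_near_diff smooth_near_cone_D)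

lemma smooth_near_cone_x: "smooth_near q f \<Longrightarrow> smooth_near q (cone_x f)"
  unfolding cone_x_def[abs_def] by (intro smooth_near_add smooth_near_cone_D)

lemma smooth_near_of_cone: "p \<in> solution_set \<Longrightarrow> smooth_near p f \<Longrightarrow> smooth_near (to_cone p) (\<lambda>y. f (of_cone y))"
  by (rule smooth_near_affine[OF affine_of_cone]) (simp add: of_cone_to_cone)

lemma D_t_of_cone:
  assumes "p \<in> solution_set" "smooth_near p f"
  shows "germ_eq (to_cone p) (\<lambda>y. D_t f (of_cone y)) (cone_t (\<lambda>y. f (of_cone y)))"
proof -
  let ?g = "\<lambda>y. f (of_cone y)" and ?q = "to_cone p"
  have f: "smooth_near (of_cone ?q) f" using assms by (simp add: of_cone_to_cone)
  have "germ_eq ?q (\<lambda>y. D_t f (of_cone y)) (\<lambda>y. vf field_t f (of_cone y))"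
    by (rule germ_eq_comp[OF affine_coords_continuous[OF affine_of_cone], OF D_t_eq_vf[OF f]])
  also have "germ_eq ?q (\<lambda>y. vf field_t f (of_cone y)) (vf (\<lambda>v y. cone_field True v y - cone_field False v y) ?g)"
  proof (rule germ_eq_sym, rule vf_affine_related[OF affine_of_cone, where d = field_t and
        c = "\<lambda>v y. cone_field True v y - cone_field False v y", OF f])
    show "of_cone (\<lambda>v. cone_field True v y - cone_field False v y) w - of_cone (\<lambda>v. 0) w = field_t w (of_cone y)" for w y
      by (cases w) (simp_all add: of_cone_def field_t_def cone_field_def field_simps)
  qed
  also have "germ_eq ?q \<dots> (cone_t ?g)"
    unfolding cone_t_def[abs_def] by (rule vf_diff_field[OF smooth_near_of_cone[OF assms]])
  finally show ?thesis .
qed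

lemma D_x_of_cone:
  assumes "p \<in> solution_set" "smooth_near p f"
  shows "germ_eq (to_cone p) (\<lambda>y. D_x f (of_cone y)) (cone_x (\<lambda>y. f (of_cone y)))"
proof -
  let ?g = "\<lambda>y. f (of_cone y)" and ?q = "to_cone p"
  have f: "smooth_near (of_cone ?q) f" using assms by (simp add: of_cone_to_cone)
  have "germ_eq ?q (\<lambda>y. D_x f (of_cone y)) (\<lambda>y. vf field_x f (of_cone y))"
    by (rule germ_eq_comp[OF affine_coords_continuous[OF affine_of_cone], OF D_x_eq_vf[OF f]])
  also have "germ_eq ?q (\<lambda>y. vf field_x f (of_cone y)) (vf (\<lambda>v y. cone_field True v y + cone_field False v y) ?g)"
  proof (rule germ_eq_sym, rule vf_affine_related[OF affine_of_cone, where d = field_x and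
        c = "\<lambda>v y. cone_field True v y + cone_field False v y", OF f])
    show "of_cone (\<lambda>v. cone_field True v y + cone_field False v y) w - of_cone (\<lambda>v. 0) w = field_x w (of_cone y)" for w y
      by (cases w) (simp_all add: of_cone_def field_x_def cone_field_def field_simps)
  qed
  also have "germ_eq ?q \<dots> (cone_x ?g)"
    unfolding cone_x_def[abs_def] by (rule vf_add_field[OF smooth_near_of_cone[OF assms]])
  finally show ?thesis .
qed

text \<open>A function of one strand is constant along the characteristics of the other family, which
  is why the special currents are conserved.\<close>

lemma cone_D_strand:
  assumes "smooth_near (strand b q) F"
  shows "germ_eq q (cone_D b' (\<lambda>y. F (strand b y))) (\<lambda>y. if b' = b then D_check F (strand b y) else 0)"
proof (cases "b' = b")
  case True
  have "germ_eq q (cone_D b (\<lambda>y. F (strand b y))) (\<lambda>y. vf field_check F (strand b y))"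
    by (rule vf_affine_related[OF affine_strand, where d = field_check and c = "cone_field b", OF assms])
      (simp add: strand_def cone_field_def field_check_def)
  also have "germ_eq q \<dots> (\<lambda>y. D_check F (strand b y))"
    by (rule germ_eq_sym, rule germ_eq_comp[OF affine_coords_continuous[OF affine_strand], OF D_check_eq_vf[OF assms]])
  finally show ?thesis using True by simp
next
  case False
  have "germ_eq q (cone_D b' (\<lambda>y. F (strand b y))) (\<lambda>y. vf (\<lambda>l x. 0) F (strand b y))"
    by (rule vf_affine_related[OF affine_strand, where d = "\<lambda>l x. 0" and c = "cone_field b'", OF assms])
      (use False in \<open>simp add: strand_def cone_field_def\<close>)
  then show ?thesis using False by (simp add: vf_def)
qed

lemma cone_D_cone_field:
  assumes "b \<noteq> b'" shows "cone_D b (cone_field b' v) = (\<lambda>y. 0)"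
proof
  fix y show "cone_D b (cone_field b' v) y = 0"
  proof (cases v)
    case V
    then have "cone_field b' v = (\<lambda>y. y (W b' 1) / 2)" by (simp add: fun_eq_iff cone_field_def)
    then show ?thesis using assms by (simp add: cone_field_def)
  next
    case (W c n)
    then have "cone_field b' v = (if c = b' then if n = 0 then (\<lambda>y. 1) else (\<lambda>y. y (W b' (n + 1))) else (\<lambda>y. 0))"
      by (auto simp: fun_eq_iff cone_field_def)
    then show ?thesis using assms by (auto simp: cone_field_def)
  qed
qed

lemma cone_D_commute:
  assumes "smooth_near q f"
  shows "germ_eq q (cone_D b (cone_D b' f)) (cone_D b' (cone_D b f))"
proof (rule vf_commute[OF assms smooth_near_cone_field smooth_near_cone_field])
  show "germ_eq q (cone_D b (cone_field b' v)) (cone_D b' (cone_field b v))" for v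
    by (cases "b = b'") (simp_all add: cone_D_cone_field)
qed

text \<open>Only the derivatives with respect to coordinates of order at least 1 of the strand \<open>b\<close> fail to
  commute with \<open>cone_D b\<close>: these coordinates are coefficients of the field, and the commutator is the
  derivative with respect to the coordinate one order lower, where \<open>u\<close> precedes the coordinate of order 1 and contributes the factor \<open>1/2\<close>.\<close>

definition commutator_term :: "bool \<Rightarrow> cone_var \<Rightarrow> (cone \<Rightarrow> real) \<Rightarrow> cone \<Rightarrow> real" where
  "commutator_term b v f y = (case v of V \<Rightarrow> 0 | W b' n \<Rightarrow>
     if b' = b \<and> n > 0 then (if n = 1 then partial V f y / 2 else partial (W b (n - 1)) f y) else 0)"

lemma partial_cone_D:
  assumes "smooth_near q f"
  shows "germ_eq q (partial v (cone_D b f)) (\<lambda>y. cone_D b (partial v f) y + commutator_term b v f y)"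
proof -
  have pc: "partial v (cone_field b w) y = (case w of V \<Rightarrow> (if v = W b 1 then 1/2 else 0)
      | W b' n \<Rightarrow> if b' = b \<and> n > 0 \<and> v = W b (n + 1) then 1 else 0)" for w y
  proof (cases w)
    case V
    then have "cone_field b w = (\<lambda>y. y (W b 1) / 2)" by (simp add: fun_eq_iff cone_field_def)
    then show ?thesis using V by (simp add: partial_coordinate_half)
  next
    case (W c n)
    then have "cone_field b w = (if c = b then if n = 0 then (\<lambda>y. 1) else (\<lambda>y. y (W b (n + 1))) else (\<lambda>y. 0))"
      by (auto simp: fun_eq_iff cone_field_def)
    then show ?thesis using W by (auto simp: partial_coordinate)
  qed
  define u where "u = (case v of V \<Rightarrow> V | W b' n \<Rightarrow> if n = 1 then V else W b (n - 1))"
  have "vf (\<lambda>w. partial v (cone_field b w)) f y = (\<Sum>w\<in>{u}. partial v (cone_field b w) y * partial w f y)" for y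
    unfolding vf_def by (rule Sum_any_eq_sum)
      (auto simp: pc u_def split: cone_var.splits if_splits)
  also have "(\<Sum>w\<in>{u}. partial v (cone_field b w) y * partial w f y) = commutator_term b v f y" for y
    by (auto simp: pc u_def commutator_term_def split: cone_var.splits if_splits)
  finally show ?thesis
    using partial_vf[where c = "cone_field b", OF assms smooth_near_cone_field, of v] by simp
qed

section \<open>The kernels of the characteristic derivatives\<close>

lemma decreasing_induct:
  assumes "\<And>n. N < n \<Longrightarrow> P n" "\<And>n. k \<le> n \<Longrightarrow> P (Suc n) \<Longrightarrow> P n" "k \<le> (n::nat)"
  shows "P n"
proof -
  have "k \<le> n \<Longrightarrow> N < n + m \<Longrightarrow> P n" for m n
    by (induction m arbitrary: n) (use assms(1,2) in auto)
  from this[of n "Suc N"] show ?thesis using assms(3) by simp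
qed

lemma finite_order:
  assumes "smooth_near q f"
  obtains N where "\<And>n. N < n \<Longrightarrow> zero_germ q (partial (W b n) f)"
proof -
  obtain S where S: "finite S" "\<forall>\<^sub>F z in nhds q. \<forall>v. v \<notin> S \<longrightarrow> partial v f z = 0"
    using finite_support[OF assms] .
  have "finite (W b -` S)" by (rule finite_vimageI[OF S(1)]) (simp add: inj_on_def)
  then obtain N where N: "\<forall>n\<in>W b -` S. n \<le> N" unfolding finite_nat_set_iff_bounded_le by blast
  show thesis
  proof (rule that)
    fix n assume "N < n"
    then have n: "W b n \<notin> S" using N by force
    show "zero_germ q (partial (W b n) f)"
      using S(2) unfolding germ_eq_def by eventually_elim (use n in blast)
  qed
qed

lemma cone_D_first_order:
  assumes f: "smooth_near q f" and "zero_germ q (partial V f)" "\<And>n. 1 \<le> n \<Longrightarrow> zero_germ q (partial (W b n) f)"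
  shows "germ_eq q (cone_D b f) (partial (W b 0) f)"
proof -
  have "\<forall>\<^sub>F z in nhds q. \<forall>v\<in>insert V (W b ` {1..}). partial v f z = 0"
    by (rule eventually_all_partials_zero[OF f]) (use assms(2,3) in auto)
  then show ?thesis unfolding germ_eq_def
  proof eventually_elim
    case (elim z)
    have "cone_field b v z * partial v f z = 0" if "v \<noteq> W b 0" for v
    proof (cases v)
      case V then show ?thesis using elim by simp
    next
      case (W b' n)
      then show ?thesis using elim that by (cases "b' = b") (auto simp: cone_field_def)
    qed
    then have "cone_D b f z = (\<Sum>v\<in>{W b 0}. cone_field b v z * partial v f z)"
      unfolding vf_def by (intro Sum_any_eq_sum) auto
    then show ?case by (simp add: cone_field_def)
  qed
qed

text \<open>If \<open>f\<close> has order \<open>n\<close> in its own family of coordinates, then \<open>\<partial>\<^sub>n f\<close> is the coefficient of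
  the new coordinate of order \<open>n + 1\<close> in its characteristic derivative. Hence the derivative of
  \<open>f\<close> can vanish only if \<open>f\<close> depends neither on these coordinates nor on \<open>u\<close>.\<close>

lemma cone_D_kernel:
  assumes f: "smooth_near q f" and 0: "zero_germ q (cone_D b f)"
  shows "zero_germ q (partial V f)" "zero_germ q (partial (W b n) f)"
proof -
  obtain N where N: "\<And>n. N < n \<Longrightarrow> zero_germ q (partial (W b n) f)"
    using finite_order[OF f, where b = b] by blast
  have low: "zero_germ q (commutator_term b v f)" if "zero_germ q (partial v f)" for v
    using partial_cone_D[OF f, of v b] partial_zero[OF 0, of v] vf_zero[OF that, of "cone_field b"]
    unfolding germ_eq_def by eventually_elim simp
  have pos: "zero_germ q (partial (W b n) f)" if "1 \<le> n" for n
  proof (rule decreasing_induct[of N _ 1, OF N _ that])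
    fix n :: nat assume "1 \<le> n" and *: "zero_germ q (partial (W b (Suc n)) f)"
    then show "zero_germ q (partial (W b n) f)"
      using low[OF *] by (simp add: commutator_term_def[abs_def])
  qed
  from low[OF pos[of 1]] show V: "zero_germ q (partial V f)"
    by (simp add: commutator_term_def[abs_def] germ_eq_def)
  have "germ_eq q (cone_D b f) (partial (W b 0) f)"
    by (rule cone_D_first_order[OF f V pos])
  from germ_eq_trans[OF germ_eq_sym[OF this] 0] have "zero_germ q (partial (W b 0) f)" .
  with pos show "zero_germ q (partial (W b n) f)" by (cases n) auto
qed

lemma freeze_eq_unstrand: "freeze q (insert V (range (W (\<not> b)))) y = unstrand q b (strand b y)"
  by (rule ext) (auto simp: freeze_def unstrand_def strand_def split: cone_var.split)

lemma unstrand_strand_center: "unstrand q b (strand b q) = q"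
  by (rule ext) (auto simp: unstrand_def strand_def split: cone_var.split)

lemma function_of_strand:
  assumes f: "smooth_near q f" and "zero_germ q (partial V f)" "\<And>n. zero_germ q (partial (W (\<not> b) n) f)"
  obtains F where "smooth_near (strand b q) F" "germ_eq q f (\<lambda>y. F (strand b y))"
proof (rule that)
  have "germ_eq q f (\<lambda>y. f (freeze q (insert V (range (W (\<not> b)))) y))"
    by (rule germ_eq_freeze[OF f]) (use assms(2,3) in auto)
  then show "germ_eq q f (\<lambda>y. f (unstrand q b (strand b y)))" by (simp add: freeze_eq_unstrand)
  show "smooth_near (strand b q) (\<lambda>x. f (unstrand q b x))"
    by (rule smooth_near_affine[OF affine_unstrand]) (simp add: unstrand_strand_center f)
qed

lemma partial_strand: "partial V (\<lambda>y. F (strand b y)) y = 0" "partial (W (\<not> b) n) (\<lambda>y. F (strand b y)) y = 0"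
proof -
  have "strand b (y(V := s)) = strand b y" "strand b (y(W (\<not> b) n := s)) = strand b y" for s
    by (auto simp: strand_def)
  then show "partial V (\<lambda>y. F (strand b y)) y = 0" "partial (W (\<not> b) n) (\<lambda>y. F (strand b y)) y = 0"
    by (simp_all add: partial_def)
qed

lemma smooth_near_strand: "smooth_near (strand b q) F \<Longrightarrow> smooth_near q (\<lambda>y. F (strand b y))"
  by (rule smooth_near_affine[OF affine_strand])

text \<open>The hypothesis says that \<open>(D\<^sub>x H, - D\<^sub>t H)\<close> is a current of the special form.\<close>

lemma potential_splits:
  assumes H: "smooth_near q H"
    and D: "\<And>b. germ_eq q (cone_D b H) (\<lambda>y. F b (strand b y))"
  obtains h C where "\<And>b. smooth_near (strand b q) (h b)"
    "germ_eq q H (\<lambda>y. h True (strand True y) + h False (strand False y) + C * y V)"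
proof -
  \<comment> \<open>a derivative that commutes with \<open>cone_D b\<close> annihilates functions of the strand \<open>b\<close>\<close>
  have low: "zero_germ q (cone_D b (partial v H))" if v: "v = V \<or> (\<exists>n. v = W (\<not> b) n)" for b v
  proof -
    have "germ_eq q (partial v (cone_D b H)) (\<lambda>y. cone_D b (partial v H) y + commutator_term b v H y)"
      by (rule partial_cone_D[OF H])
    moreover have "commutator_term b v H y = 0" for y using v by (auto simp: commutator_term_def)
    moreover have "zero_germ q (partial v (cone_D b H))"
    proof -
      have "partial v (\<lambda>y. F b (strand b y)) = (\<lambda>y. 0)" using v by (auto simp: partial_strand)
      then show ?thesis using germ_eq_partial[OF D[of b], of v] by simp
    qed
    ultimately show ?thesis unfolding germ_eq_def by (auto elim: eventually_elim2)
  qed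
  have VV: "zero_germ q (partial v (partial V H))" for v
    using cone_D_kernel[OF smooth_near_partial[OF H] low] by (cases v) blast+
  have mixed: "zero_germ q (partial (W b m) (partial (W (\<not> b) n) H))" for b m n
    by (rule cone_D_kernel[OF smooth_near_partial[OF H] low]) blast
  define C where "C = partial V H q"
  have "germ_eq q (partial V H) (\<lambda>y. partial V H (freeze q UNIV y))"
    by (rule germ_eq_freeze[OF smooth_near_partial[OF H] VV])
  moreover have "freeze q UNIV y = q" for y by (simp add: freeze_def)
  ultimately have C: "germ_eq q (partial V H) (\<lambda>y. C)" by (simp add: C_def)
  \<comment> \<open>now \<open>u\<close> is removed, and the two strands separate in \<open>K\<close>\<close>
  define K where "K y = H y - C * y V" for y
  have K: "smooth_near q K" unfolding K_def[abs_def] by (intro smooth_near_intros H)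
  have pK: "germ_eq q (partial v K) (\<lambda>y. partial v H y - (if v = V then C else 0))" for v
  proof -
    have "partial v (\<lambda>y. C * y V) y = (if v = V then C else 0)" for y :: cone
      by (rule partial_eqI) (auto intro!: derivative_eq_intros)
    then show ?thesis
      using partial_diff[OF H, of "\<lambda>y. C * y V" v] unfolding K_def[abs_def]
      by (simp add: smooth_near_intros)
  qed
  have KV: "zero_germ q (partial V K)"
    using pK[of V] C unfolding germ_eq_def by eventually_elim simp
  have Kmixed: "zero_germ q (partial (W True m) (partial (W False n) K))" for m n
  proof -
    have "germ_eq q (partial (W False n) K) (partial (W False n) H)" using pK[of "W False n"] by simp
    from germ_eq_trans[OF germ_eq_partial[OF this]] mixed[of True m n] show ?thesis by simp
  qed
  let ?R = "range (W True)"
  define g where "g y = K (freeze q ?R y)" for y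
  define h where "h y = K y - g y" for y
  have g: "smooth_near q g" unfolding g_def[abs_def] by (rule smooth_near_freeze[OF K])
  have h: "smooth_near q h" unfolding h_def[abs_def] by (intro smooth_near_intros K g)
  have pg: "partial v g y = (if v \<in> ?R then 0 else partial v K (freeze q ?R y))" for v y
    unfolding g_def[abs_def] by (simp add: partial_freeze partial_freeze_other)
  have ph: "zero_germ q (partial v h)"
    if "germ_eq q (partial v K) (\<lambda>y. partial v K (freeze q ?R y))" "v \<notin> ?R" for v
    using partial_diff[OF K g, of v] that(1) unfolding h_def[abs_def] germ_eq_def
    by eventually_elim (use that(2) in \<open>simp add: pg\<close>)
  have fr: "germ_eq q (partial v K) (\<lambda>y. partial v K (freeze q ?R y))"
    if "\<And>m. zero_germ q (partial (W True m) (partial v K))" for v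
    by (rule germ_eq_freeze[OF smooth_near_partial[OF K]]) (use that in auto)
  have hF: "zero_germ q (partial (W False n) h)" for n
    by (rule ph[OF fr[OF Kmixed]]) auto
  have hV: "zero_germ q (partial V h)"
    by (rule ph[OF fr[OF partial_zero[OF KV]]]) auto
  obtain hT where hT: "smooth_near (strand True q) hT" "germ_eq q h (\<lambda>y. hT (strand True y))"
    by (rule function_of_strand[of q h True, OF h hV]) (use hF in auto)
  have gV: "zero_germ q (partial V g)"
    using germ_eq_freeze_cong[OF KV, of ?R] unfolding germ_eq_def
    by eventually_elim (auto simp: pg)
  have gT: "zero_germ q (partial (W True n) g)" for n
    by (simp add: germ_eq_def pg)
  obtain hF' where hF': "smooth_near (strand False q) hF'" "germ_eq q g (\<lambda>y. hF' (strand False y))"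
    by (rule function_of_strand[of q g False, OF g gV]) (use gT in auto)
  show thesis
  proof (rule that[of "\<lambda>b. if b then hT else hF'"])
    show "smooth_near (strand b q) (if b then hT else hF')" for b using hT hF' by (cases b) auto
    show "germ_eq q H (\<lambda>y. (if True then hT else hF') (strand True y) + (if False then hT else hF') (strand False y) + C * y V)"
      using hT(2) hF'(2) unfolding germ_eq_def
      by eventually_elim (simp add: h_def g_def K_def)
  qed
qed

section \<open>Normal form of conserved currents\<close>

text \<open>The components of conserved currents are simplified modulo the image of a characteristic
  derivative.\<close>

definition exact :: "cone \<Rightarrow> bool \<Rightarrow> (cone \<Rightarrow> real) \<Rightarrow> bool" where
  "exact q b f \<longleftrightarrow> (\<exists>\<theta>. smooth_near q \<theta> \<and> germ_eq q f (cone_D b \<theta>))"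

lemma exactI: "smooth_near q \<theta> \<Longrightarrow> germ_eq q f (cone_D b \<theta>) \<Longrightarrow> exact q b f"
  unfolding exact_def by (intro exI[of _ \<theta>] conjI)

lemma exactE:
  assumes "exact q b f"
  obtains \<theta> where "smooth_near q \<theta>" "germ_eq q f (cone_D b \<theta>)"
  using assms unfolding exact_def by (elim exE conjE)

lemma exact_cong: "exact q b f \<Longrightarrow> germ_eq q g f \<Longrightarrow> exact q b g"
  by (elim exactE) (rule exactI, assumption, rule germ_eq_trans)

lemma exact_zero: "zero_germ q f \<Longrightarrow> exact q b f"
  by (rule exactI[of q "\<lambda>y. 0"]) simp_all

lemma exact_add:
  assumes "exact q b f" "exact q b g" shows "exact q b (\<lambda>y. f y + g y)"
proof -
  obtain \<theta> where \<theta>: "smooth_near q \<theta>" "germ_eq q f (cone_D b \<theta>)" using exactE[OF assms(1)] .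
  obtain \<zeta> where \<zeta>: "smooth_near q \<zeta>" "germ_eq q g (cone_D b \<zeta>)" using exactE[OF assms(2)] .
  have "germ_eq q (\<lambda>y. f y + g y) (cone_D b (\<lambda>y. \<theta> y + \<zeta> y))"
    using \<theta>(2) \<zeta>(2) vf_add[OF \<theta>(1) \<zeta>(1), of "cone_field b"] unfolding germ_eq_def
    by eventually_elim simp
  then show ?thesis by (rule exactI[OF smooth_near_add[OF \<theta>(1) \<zeta>(1)]])
qed

lemma exact_mult:
  assumes "exact q b f" "smooth_near q c" "zero_germ q (cone_D b c)" shows "exact q b (\<lambda>y. c y * f y)"
proof -
  obtain \<theta> where *: "smooth_near q \<theta>" "germ_eq q f (cone_D b \<theta>)" using exactE[OF assms(1)] .
  have "germ_eq q (\<lambda>y. c y * f y) (cone_D b (\<lambda>y. c y * \<theta> y))"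
    using *(2) vf_mult[OF assms(2) *(1), of "cone_field b"] assms(3) unfolding germ_eq_def
    by eventually_elim simp
  then show ?thesis by (rule exactI[OF smooth_near_mult[OF assms(2) *(1)]])
qed

lemma exact_cmult: "exact q b f \<Longrightarrow> exact q b (\<lambda>y. c * f y)"
  by (rule exact_mult) (auto intro: smooth_near_const)

lemma exact_diff:
  assumes "exact q b f" "exact q b g" shows "exact q b (\<lambda>y. f y - g y)"
  using exact_add[OF assms(1) exact_cmult[OF assms(2), of "-1"]] by simp

lemma exact_sum:
  "(\<And>i. i \<in> I \<Longrightarrow> exact q b (f i)) \<Longrightarrow> exact q b (\<lambda>y. \<Sum>i\<in>I. f i y)"
  by (induction I rule: infinite_finite_induct) (auto intro: exact_add exact_zero)

lemma exact_cone_D: "smooth_near q \<theta> \<Longrightarrow> exact q b (cone_D b \<theta>)"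
  by (rule exactI[OF _ germ_eq_refl])

lemma cone_D_exact:
  assumes "exact q b f" shows "exact q b (cone_D b' f)"
proof -
  obtain \<theta> where *: "smooth_near q \<theta>" "germ_eq q f (cone_D b \<theta>)"
    using exactE[OF assms] .
  have "germ_eq q (cone_D b' f) (cone_D b' (cone_D b \<theta>))" by (rule vf_cong[OF *(2)])
  also have "germ_eq q \<dots> (cone_D b (cone_D b' \<theta>))" by (rule cone_D_commute[OF *(1)])
  finally show ?thesis by (rule exactI[OF smooth_near_cone_D[OF *(1)]])
qed

lemma partial_exact:
  assumes "exact q b f" "v = V \<or> (\<exists>n. v = W (\<not> b) n)" shows "exact q b (partial v f)"
proof -
  obtain \<theta> where *: "smooth_near q \<theta>" "germ_eq q f (cone_D b \<theta>)"
    using exactE[OF assms(1)] .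
  have "germ_eq q (partial v f) (partial v (cone_D b \<theta>))" by (rule germ_eq_partial[OF *(2)])
  also have "germ_eq q \<dots> (\<lambda>y. cone_D b (partial v \<theta>) y + commutator_term b v \<theta> y)" by (rule partial_cone_D[OF *(1)])
  also have "(\<lambda>y. cone_D b (partial v \<theta>) y + commutator_term b v \<theta> y) = cone_D b (partial v \<theta>)"
    using assms(2) by (auto simp: commutator_term_def fun_eq_iff)
  finally show ?thesis by (rule exactI[OF smooth_near_partial[OF *(1)]])
qed

text \<open>The derivative of \<open>cone_D (\<not> b) a\<close> with respect to the coordinate of order \<open>n + 1\<close> of its
  strand is \<open>\<partial>\<^sub>n a\<close> plus the characteristic derivative of \<open>\<partial>\<^sub>n\<^sub>+\<^sub>1 a\<close>. As exactness for \<open>b\<close> is preserved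
  by the other characteristic derivative, it passes from \<open>\<partial>\<^sub>n\<^sub>+\<^sub>1 a\<close> to \<open>\<partial>\<^sub>n a\<close>, and for \<open>n = 0\<close> to \<open>\<partial>\<^sub>u a\<close>.\<close>

lemma partials_exact:
  assumes a: "smooth_near q a" and ex: "exact q b (cone_D (\<not> b) a)"
  shows "exact q b (partial V a)" "exact q b (partial (W (\<not> b) n) a)"
proof -
  let ?c = "\<not> b"
  obtain N where N: "\<And>n. N < n \<Longrightarrow> zero_germ q (partial (W ?c n) a)"
    using finite_order[OF a, where b = ?c] by blast
  have low: "exact q b (commutator_term ?c (W ?c n) a)" if "exact q b (partial (W ?c n) a)" for n
  proof (rule exact_cong)
    show "germ_eq q (commutator_term ?c (W ?c n) a) (\<lambda>y. partial (W ?c n) (cone_D ?c a) y - cone_D ?c (partial (W ?c n) a) y)"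
      using partial_cone_D[OF a, of "W ?c n" ?c] unfolding germ_eq_def by eventually_elim simp
    show "exact q b (\<lambda>y. partial (W ?c n) (cone_D ?c a) y - cone_D ?c (partial (W ?c n) a) y)"
      by (intro exact_diff partial_exact[OF ex] cone_D_exact that) blast
  qed
  have pos: "exact q b (partial (W ?c n) a)" if "1 \<le> n" for n
  proof (rule decreasing_induct[of N _ 1, OF exact_zero[OF N] _ that])
    fix n :: nat assume "1 \<le> n" and *: "exact q b (partial (W ?c (Suc n)) a)"
    then show "exact q b (partial (W ?c n) a)"
      using low[OF *] by (simp add: commutator_term_def[abs_def])
  qed
  from exact_cmult[OF low[OF pos[of 1]], of 2] show V: "exact q b (partial V a)"
    by (simp add: commutator_term_def[abs_def])
  obtain S where S: "finite S" "\<forall>\<^sub>F z in nhds q. \<forall>v. v \<notin> S \<longrightarrow> partial v a z = 0"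
    using finite_support[OF a] .
  \<comment> \<open>the derivative with respect to \<open>\<xi>\<close> or \<open>\<eta>\<close> itself is the one term of \<open>cone_D (\<not> b) a\<close> left over\<close>
  have "exact q b (\<lambda>y. cone_field ?c v y * partial v a y)" if "v \<noteq> W ?c 0" for v
  proof (cases "\<exists>n. v = W b n")
    case True
    then show ?thesis by (intro exact_zero) (auto simp: cone_field_def)
  next
    case False
    have "exact q b (partial v a)"
    proof (cases v)
      case V then show ?thesis using \<open>exact q b (partial V a)\<close> by simp
    next
      case (W b' n)
      then show ?thesis using False that pos[of n] by (cases "b' = b"; cases n) auto
    qed
    then show ?thesis
      by (rule exact_mult) (simp_all add: smooth_near_cone_field cone_D_cone_field)
  qed
  then have "exact q b (\<lambda>y. cone_D ?c a y - (\<Sum>v\<in>S - {W ?c 0}. cone_field ?c v y * partial v a y))"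
    by (intro exact_diff ex exact_sum) auto
  moreover have "germ_eq q (partial (W ?c 0) a) (\<lambda>y. cone_D ?c a y - (\<Sum>v\<in>S - {W ?c 0}. cone_field ?c v y * partial v a y))"
    using S(2) unfolding germ_eq_def
  proof eventually_elim
    case (elim y)
    have "cone_D ?c a y = (\<Sum>v\<in>insert (W ?c 0) S. cone_field ?c v y * partial v a y)"
      by (rule vf_eq_sum) (use S(1) elim in auto)
    then show ?case using S(1) by (simp add: sum.insert_remove cone_field_def)
  qed
  ultimately have "exact q b (partial (W ?c 0) a)" by (rule exact_cong)
  with pos show "exact q b (partial (W ?c n) a)" by (cases n) auto
qed

lemma cone_D_freeze:
  assumes "smooth_near q \<theta>" "R \<subseteq> range (W (\<not> b))"
  shows "germ_eq q (cone_D b (\<lambda>y. \<theta> (freeze q R y))) (\<lambda>y. cone_D b \<theta> (freeze q R y))"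
proof (rule vf_affine_related[OF affine_coords_freeze, where c = "cone_field b" and d = "cone_field b"])
  show "smooth_near (freeze q R q) \<theta>" using assms(1) by simp
  show "freeze q R (\<lambda>v. cone_field b v y) w - freeze q R (\<lambda>v. 0) w = cone_field b w (freeze q R y)" for w y
    using assms(2) by (auto simp: freeze_def cone_field_def split: cone_var.split)
qed

text \<open>One variable at a time is removed from \<open>a\<close> by subtracting the derivative of an
  antiderivative of \<open>\<theta>\<close>, where \<open>\<partial>\<^sub>v a = cone_D b \<theta>\<close>. Freezing the variables removed before in \<open>\<theta>\<close>
  ensures that they do not come back.\<close>

lemma remove_variable:
  assumes a: "smooth_near q a" and R: "R \<subseteq> range (W (\<not> b))" "\<And>w. w \<in> R \<Longrightarrow> zero_germ q (partial w a)"
    and v: "v \<notin> R" "v = V \<or> (\<exists>n. v = W (\<not> b) n)" and ex: "exact q b (partial v a)"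
  obtains H where "smooth_near q H"
    "\<And>w. w \<in> insert v R \<Longrightarrow> zero_germ q (partial w (\<lambda>y. a y - cone_D b H y))"
proof -
  obtain \<theta> where \<theta>: "smooth_near q \<theta>" "germ_eq q (partial v a) (cone_D b \<theta>)"
    using exactE[OF ex] .
  define \<zeta> where "\<zeta> y = \<theta> (freeze q R y)" for y
  have \<zeta>: "smooth_near q \<zeta>" unfolding \<zeta>_def[abs_def] by (rule smooth_near_freeze[OF \<theta>(1)])
  have "germ_eq q (partial v a) (\<lambda>y. partial v a (freeze q R y))"
    by (rule germ_eq_freeze[OF smooth_near_partial[OF a] partial_partial_zero[OF a R(2)]])
  also have "germ_eq q \<dots> (\<lambda>y. cone_D b \<theta> (freeze q R y))"
    by (rule germ_eq_freeze_cong[OF \<theta>(2)])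
  also have "germ_eq q \<dots> (cone_D b \<zeta>)"
    unfolding \<zeta>_def[abs_def] by (rule germ_eq_sym[OF cone_D_freeze[OF \<theta>(1) R(1)]])
  finally have va: "germ_eq q (partial v a) (cone_D b \<zeta>)" .
  let ?H = "antideriv q v \<zeta>"
  have H: "smooth_near q ?H" by (rule smooth_near_antideriv[OF \<zeta>])
  have p: "germ_eq q (partial w (\<lambda>y. a y - cone_D b ?H y)) (\<lambda>y. partial w a y - cone_D b (partial w ?H) y)"
    if "w = V \<or> (\<exists>n. w = W (\<not> b) n)" for w
  proof -
    have "commutator_term b w ?H y = 0" for y using that by (auto simp: commutator_term_def)
    with partial_diff[OF a smooth_near_cone_D[OF H], of w b] partial_cone_D[OF H, of w b]
    show ?thesis unfolding germ_eq_def by (auto elim: eventually_elim2)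
  qed
  show thesis
  proof (rule that[OF H])
    fix w assume w: "w \<in> insert v R"
    then have "w = V \<or> (\<exists>n. w = W (\<not> b) n)" using v(2) R(1) by auto
    note p = p[OF this]
    show "zero_germ q (partial w (\<lambda>y. a y - cone_D b ?H y))"
    proof (cases "w = v")
      case True
      have "germ_eq q (cone_D b (partial v ?H)) (cone_D b \<zeta>)"
        by (rule vf_cong[OF partial_antideriv_same[OF \<zeta>]])
      with p va show ?thesis unfolding True germ_eq_def by eventually_elim simp
    next
      case False
      then have wR: "w \<in> R" using w by simp
      have "zero_germ q (partial w \<zeta>)"
        unfolding \<zeta>_def[abs_def] by (simp add: germ_eq_def partial_freeze[OF wR])
      from vf_zero[OF partial_antideriv_other[OF \<zeta> this False], of "cone_field b"] p R(2)[OF wR]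
      show ?thesis unfolding germ_eq_def by eventually_elim simp
    qed
  qed
qed

text \<open>The variables are removed from the highest order downwards, beginning with the infinitely
  many on which \<open>a\<close> does not depend: these must be frozen too, or they would enter through \<open>H\<close>. The
  variable \<open>u\<close> comes last because freezing it does not commute with \<open>cone_D b\<close>.\<close>

lemma reduce_to_strand:
  assumes a: "smooth_near q a" and ex: "exact q b (cone_D (\<not> b) a)"
  obtains F H where "smooth_near (strand b q) F" "smooth_near q H"
    "germ_eq q a (\<lambda>y. F (strand b y) + cone_D b H y)"
proof -
  have exD: "exact q b (partial v (\<lambda>y. a y - cone_D b H y))"
    if "smooth_near q H" "v = V \<or> (\<exists>n. v = W (\<not> b) n)" for H v
  proof (rule exact_cong[OF _ partial_diff[OF a smooth_near_cone_D[OF that(1)]]])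
    have "exact q b (partial v a)" using that(2) partials_exact[OF a ex] by blast
    then show "exact q b (\<lambda>y. partial v a y - partial v (cone_D b H) y)"
      by (intro exact_diff partial_exact[OF exact_cone_D] that)
  qed
  let ?P = "\<lambda>R H. smooth_near q H \<and> (\<forall>w\<in>R. zero_germ q (partial w (\<lambda>y. a y - cone_D b H y)))"
  have step: "\<exists>H. ?P (insert v R) H"
    if R: "R \<subseteq> range (W (\<not> b))" "\<exists>H. ?P R H" and v: "v \<notin> R" "v = V \<or> (\<exists>n. v = W (\<not> b) n)" for R v
  proof -
    obtain H where H: "smooth_near q H" "\<And>w. w \<in> R \<Longrightarrow> zero_germ q (partial w (\<lambda>y. a y - cone_D b H y))"
      using R(2) by blast
    let ?a = "\<lambda>y. a y - cone_D b H y"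
    have a': "smooth_near q ?a" by (intro smooth_near_diff smooth_near_cone_D a H)
    obtain K where K: "smooth_near q K" "\<And>w. w \<in> insert v R \<Longrightarrow> zero_germ q (partial w (\<lambda>y. ?a y - cone_D b K y))"
      using remove_variable[OF a' R(1) H(2) v exD[OF H(1) v(2)]] by blast
    have "germ_eq q (\<lambda>y. a y - cone_D b (\<lambda>y. H y + K y) y) (\<lambda>y. ?a y - cone_D b K y)"
      using vf_add[OF H(1) K(1), of "cone_field b"] unfolding germ_eq_def by eventually_elim simp
    note * = this
    have "zero_germ q (partial w (\<lambda>y. a y - cone_D b (\<lambda>y. H y + K y) y))" if "w \<in> insert v R" for w
      using germ_eq_trans[OF germ_eq_partial[OF *] K(2)[OF that]] .
    then show ?thesis using smooth_near_add[OF H(1) K(1)] by blast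
  qed
  obtain N where N: "\<And>n. N < n \<Longrightarrow> zero_germ q (partial (W (\<not> b) n) a)"
    using finite_order[OF a, where b = "\<not> b"] by blast
  have "\<exists>H. ?P (W (\<not> b) ` {0..}) H"
  proof (rule decreasing_induct[of N "\<lambda>n. \<exists>H. ?P (W (\<not> b) ` {n..}) H" 0])
    fix n assume "N < n"
    then show "\<exists>H. ?P (W (\<not> b) ` {n..}) H"
      by (intro exI[of _ "\<lambda>y. 0"]) (auto intro: N smooth_near_const)
  next
    fix n assume "\<exists>H. ?P (W (\<not> b) ` {Suc n..}) H"
    then have "\<exists>H. ?P (insert (W (\<not> b) n) (W (\<not> b) ` {Suc n..})) H"
      by (rule step[rotated]) auto
    moreover have "{n..} = insert n {Suc n..}" by auto
    ultimately show "\<exists>H. ?P (W (\<not> b) ` {n..}) H" by simp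
  qed simp
  then have "\<exists>H. ?P (range (W (\<not> b))) H" by (simp add: atLeast_0)
  then have "\<exists>H. ?P (insert V (range (W (\<not> b)))) H" by (rule step[rotated]) auto
  then obtain H where H: "smooth_near q H"
    "\<And>w. w \<in> insert V (range (W (\<not> b))) \<Longrightarrow> zero_germ q (partial w (\<lambda>y. a y - cone_D b H y))" by blast
  have "smooth_near q (\<lambda>y. a y - cone_D b H y)" by (intro smooth_near_diff smooth_near_cone_D a H)
  then obtain F where F: "smooth_near (strand b q) F" "germ_eq q (\<lambda>y. a y - cone_D b H y) (\<lambda>y. F (strand b y))"
    using function_of_strand[of q _ b] H(2) by blast
  show thesis
  proof (rule that[OF F(1) H(1)])
    show "germ_eq q a (\<lambda>y. F (strand b y) + cone_D b H y)"
      using F(2) unfolding germ_eq_def by eventually_elim simp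
  qed
qed

text \<open>With the term \<open>cone_D b H\<close> of \<open>a\<close> moved to the other side, the conservation law says that
  \<open>\<beta> - cone_D (\<not> b) H\<close> is in the kernel of \<open>cone_D b\<close>.\<close>

lemma conserved_normal_form:
  assumes a: "smooth_near q a" and \<beta>: "smooth_near q \<beta>"
    and eq: "germ_eq q (cone_D (\<not> b) a) (cone_D b \<beta>)"
  obtains F G H where "smooth_near (strand b q) F" "smooth_near (strand (\<not> b) q) G" "smooth_near q H"
    "germ_eq q a (\<lambda>y. F (strand b y) + cone_D b H y)"
    "germ_eq q \<beta> (\<lambda>y. G (strand (\<not> b) y) + cone_D (\<not> b) H y)"
proof -
  have ex: "exact q b (cone_D (\<not> b) a)" by (rule exactI[OF \<beta> eq])
  obtain F H where F: "smooth_near (strand b q) F" and H: "smooth_near q H"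
    and aF: "germ_eq q a (\<lambda>y. F (strand b y) + cone_D b H y)"
    using reduce_to_strand[OF a ex] .
  let ?g = "\<lambda>y. \<beta> y - cone_D (\<not> b) H y"
  note F' = smooth_near_strand[OF F]
  have "germ_eq q (cone_D b ?g) (\<lambda>y. cone_D b \<beta> y - cone_D b (cone_D (\<not> b) H) y)"
    by (rule vf_diff[OF \<beta> smooth_near_cone_D[OF H]])
  moreover have "germ_eq q (cone_D (\<not> b) a) (cone_D (\<not> b) (\<lambda>y. F (strand b y) + cone_D b H y))"
    by (rule vf_cong[OF aF])
  moreover have "germ_eq q (cone_D (\<not> b) (\<lambda>y. F (strand b y) + cone_D b H y))
      (\<lambda>y. cone_D (\<not> b) (\<lambda>y. F (strand b y)) y + cone_D (\<not> b) (cone_D b H) y)"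
    by (rule vf_add[OF F' smooth_near_cone_D[OF H]])
  moreover have "zero_germ q (cone_D (\<not> b) (\<lambda>y. F (strand b y)))"
    using cone_D_strand[OF F, of "\<not> b"] by simp
  ultimately have "zero_germ q (cone_D b ?g)"
    using eq cone_D_commute[OF H, of b "\<not> b"] unfolding germ_eq_def by eventually_elim simp
  moreover have g: "smooth_near q ?g" by (intro smooth_near_diff smooth_near_cone_D \<beta> H)
  ultimately have "zero_germ q (partial V ?g)" "\<And>n. zero_germ q (partial (W (\<not> \<not> b) n) ?g)"
    using cone_D_kernel[OF g, of b] by auto
  then obtain G where G: "smooth_near (strand (\<not> b) q) G" "germ_eq q ?g (\<lambda>y. G (strand (\<not> b) y))"
    using function_of_strand[OF g, of "\<not> b"] by blast
  show thesis
  proof (rule that[OF F G(1) H aF])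
    show "germ_eq q \<beta> (\<lambda>y. G (strand (\<not> b) y) + cone_D (\<not> b) H y)"
      using G(2) unfolding germ_eq_def by eventually_elim simp
  qed
qed

section \<open>Conservation laws\<close>

lemma D_t_linear:
  assumes "smooth_near p f" "smooth_near p g"
  shows "germ_eq p (D_t (\<lambda>z. a * f z + g z)) (\<lambda>z. a * D_t f z + D_t g z)"
  using D_t_eq_vf[OF smooth_near_linear[OF assms, of a]] vf_linear[OF assms, of field_t a]
    D_t_eq_vf[OF assms(1)] D_t_eq_vf[OF assms(2)]
  unfolding germ_eq_def by eventually_elim simp

lemma D_x_linear:
  assumes "smooth_near p f" "smooth_near p g"
  shows "germ_eq p (D_x (\<lambda>z. a * f z + g z)) (\<lambda>z. a * D_x f z + D_x g z)"
  using D_x_eq_vf[OF smooth_near_linear[OF assms, of a]] vf_linear[OF assms, of field_x a]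
    D_x_eq_vf[OF assms(1)] D_x_eq_vf[OF assms(2)]
  unfolding germ_eq_def by eventually_elim simp

lemma D_check_linear:
  assumes "smooth_near p f" "smooth_near p g"
  shows "germ_eq p (D_check (\<lambda>z. a * f z + g z)) (\<lambda>z. a * D_check f z + D_check g z)"
  using D_check_eq_vf[OF smooth_near_linear[OF assms, of a]] vf_linear[OF assms, of field_check a]
    D_check_eq_vf[OF assms(1)] D_check_eq_vf[OF assms(2)]
  unfolding germ_eq_def by eventually_elim simp

lemma D_t_zero [simp]: "D_t (\<lambda>z. 0) = (\<lambda>z. 0)"
  by (simp add: fun_eq_iff D_t_def)

lemma D_x_zero [simp]: "D_x (\<lambda>z. 0) = (\<lambda>z. 0)"
  by (simp add: fun_eq_iff D_x_def)

lemma zero_fun_eq: "0 = (\<lambda>z. 0)" by (simp add: fun_eq_iff)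

lemma pair_linear: "c *\<^sub>R (\<rho>, \<sigma>) + (\<rho>', \<sigma>') = (\<lambda>z. c * \<rho> z + \<rho>' z, \<lambda>z. c * \<sigma> z + \<sigma>' z)"
  for \<rho> \<sigma> :: "'a \<Rightarrow> real"
  by (simp add: fun_eq_iff scaleR_fun_def)

lemma fun_linear: "c *\<^sub>R f + g = (\<lambda>z. c * f z + g z)" for f g :: "'a \<Rightarrow> real"
  by (simp add: fun_eq_iff scaleR_fun_def)

lemma subspace_conserved_currents: "subspace (conserved_currents p)"
proof (rule subspaceI_linear)
  show "0 \<in> conserved_currents p"
    by (simp add: conserved_currents_def zero_prod_def zero_fun_eq smooth_near_const vanishes_on_solutions_def)
next
  fix c x y assume "x \<in> conserved_currents p" "y \<in> conserved_currents p"
  then obtain \<rho> \<sigma> \<rho>' \<sigma>' where x: "x = (\<rho>, \<sigma>)" "y = (\<rho>', \<sigma>')"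
    and s: "smooth_near p \<rho>" "smooth_near p \<sigma>" "smooth_near p \<rho>'" "smooth_near p \<sigma>'"
    and v: "vanishes_on_solutions p (\<lambda>z. D_t \<rho> z + D_x \<sigma> z)" "vanishes_on_solutions p (\<lambda>z. D_t \<rho>' z + D_x \<sigma>' z)"
    by (auto simp: conserved_currents_def)
  have "vanishes_on_solutions p (\<lambda>z. D_t (\<lambda>z. c * \<rho> z + \<rho>' z) z + D_x (\<lambda>z. c * \<sigma> z + \<sigma>' z) z)"
    using v D_t_linear[OF s(1,3), of c] D_x_linear[OF s(2,4), of c]
    unfolding vanishes_on_solutions_def germ_eq_def
  proof eventually_elim
    case (elim z)
    show ?case
    proof
      assume "z \<in> solution_set"
      then have "D_t \<rho> z + D_x \<sigma> z = 0" "D_t \<rho>' z + D_x \<sigma>' z = 0" using elim by auto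
      moreover have "c * D_t \<rho> z + c * D_x \<sigma> z = c * (D_t \<rho> z + D_x \<sigma> z)" by (simp add: distrib_left)
      ultimately show "D_t (\<lambda>z. c * \<rho> z + \<rho>' z) z + D_x (\<lambda>z. c * \<sigma> z + \<sigma>' z) z = 0"
        using elim(3,4) by simp
    qed
  qed
  then show "c *\<^sub>R x + y \<in> conserved_currents p"
    unfolding x pair_linear conserved_currents_def using s by (auto intro: smooth_near_linear)
qed

lemma conserved_iff:
  assumes p: "p \<in> solution_set"
  shows "(\<rho>, \<sigma>) \<in> conserved_currents p \<longleftrightarrow> smooth_near p \<rho> \<and> smooth_near p \<sigma> \<and>
    zero_germ (to_cone p) (\<lambda>y. cone_t (\<lambda>y. \<rho> (of_cone y)) y + cone_x (\<lambda>y. \<sigma> (of_cone y)) y)"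
proof -
  have "vanishes_on_solutions p (\<lambda>z. D_t \<rho> z + D_x \<sigma> z) \<longleftrightarrow>
      zero_germ (to_cone p) (\<lambda>y. cone_t (\<lambda>y. \<rho> (of_cone y)) y + cone_x (\<lambda>y. \<sigma> (of_cone y)) y)"
    if s: "smooth_near p \<rho>" "smooth_near p \<sigma>"
  proof -
    have "germ_eq (to_cone p) (\<lambda>y. D_t \<rho> (of_cone y) + D_x \<sigma> (of_cone y))
        (\<lambda>y. cone_t (\<lambda>y. \<rho> (of_cone y)) y + cone_x (\<lambda>y. \<sigma> (of_cone y)) y)"
      by (intro germ_eq_add D_t_of_cone D_x_of_cone p s)
    then show ?thesis unfolding vanishes_iff[OF p] using germ_eq_trans germ_eq_sym by blast
  qed
  then show ?thesis by (auto simp: conserved_currents_def)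
qed

text \<open>A potential on the solution set extends to all jets by composition with \<open>to_cone\<close>, and the
  parts of the current vanishing on solutions are then defined as the remainders.\<close>

lemma trivial_iff:
  assumes p: "p \<in> solution_set"
  shows "(\<rho>, \<sigma>) \<in> trivial_currents p \<longleftrightarrow> smooth_near p \<rho> \<and> smooth_near p \<sigma> \<and>
    (\<exists>H. smooth_near (to_cone p) H \<and> germ_eq (to_cone p) (\<lambda>y. \<rho> (of_cone y)) (cone_x H) \<and>
       germ_eq (to_cone p) (\<lambda>y. \<sigma> (of_cone y)) (\<lambda>y. - cone_t H y))"
proof
  let ?q = "to_cone p"
  assume "(\<rho>, \<sigma>) \<in> trivial_currents p"
  then obtain \<rho>' \<sigma>' H where s: "smooth_near p \<rho>'" "smooth_near p \<sigma>'" and H: "smooth_near p H"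
    and v: "vanishes_on_solutions p \<rho>'" "vanishes_on_solutions p \<sigma>'"
    and e: "germ_eq p \<rho> (\<lambda>z. \<rho>' z + D_x H z)" "germ_eq p \<sigma> (\<lambda>z. \<sigma>' z - D_t H z)"
    by (auto simp: trivial_currents_def)
  have comp: "germ_eq ?q (\<lambda>y. f (of_cone y)) (\<lambda>y. g (of_cone y))" if "germ_eq p f g" for f g
    using germ_eq_comp[OF affine_coords_continuous[OF affine_of_cone], of ?q f g] that
    by (simp add: of_cone_to_cone[OF p])
  have "germ_eq ?q (\<lambda>y. \<rho> (of_cone y)) (cone_x (\<lambda>y. H (of_cone y)))"
    using comp[OF e(1)] v(1)[unfolded vanishes_iff[OF p]] D_x_of_cone[OF p H]
    unfolding germ_eq_def by eventually_elim simp
  moreover have "germ_eq ?q (\<lambda>y. \<sigma> (of_cone y)) (\<lambda>y. - cone_t (\<lambda>y. H (of_cone y)) y)"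
    using comp[OF e(2)] v(2)[unfolded vanishes_iff[OF p]] D_t_of_cone[OF p H]
    unfolding germ_eq_def by eventually_elim simp
  moreover have "smooth_near p \<rho>"
    by (rule smooth_near_cong[OF _ germ_eq_sym[OF e(1)]]) (intro smooth_near_add smooth_near_D_x s H)
  moreover have "smooth_near p \<sigma>"
    by (rule smooth_near_cong[OF _ germ_eq_sym[OF e(2)]]) (intro smooth_near_diff smooth_near_D_t s H)
  ultimately show "smooth_near p \<rho> \<and> smooth_near p \<sigma> \<and>
    (\<exists>H. smooth_near ?q H \<and> germ_eq ?q (\<lambda>y. \<rho> (of_cone y)) (cone_x H) \<and>
       germ_eq ?q (\<lambda>y. \<sigma> (of_cone y)) (\<lambda>y. - cone_t H y))"
    using smooth_near_of_cone[OF p H] by blast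
next
  let ?q = "to_cone p"
  assume "smooth_near p \<rho> \<and> smooth_near p \<sigma> \<and>
    (\<exists>H. smooth_near ?q H \<and> germ_eq ?q (\<lambda>y. \<rho> (of_cone y)) (cone_x H) \<and>
       germ_eq ?q (\<lambda>y. \<sigma> (of_cone y)) (\<lambda>y. - cone_t H y))"
  then obtain H where s: "smooth_near p \<rho>" "smooth_near p \<sigma>" and H: "smooth_near ?q H"
    and e: "germ_eq ?q (\<lambda>y. \<rho> (of_cone y)) (cone_x H)" "germ_eq ?q (\<lambda>y. \<sigma> (of_cone y)) (\<lambda>y. - cone_t H y)"
    by blast
  define K where "K z = H (to_cone z)" for z
  have K: "smooth_near p K" unfolding K_def[abs_def] by (rule smooth_near_affine[OF affine_to_cone H])
  have KH: "(\<lambda>y. K (of_cone y)) = H" by (simp add: K_def)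
  have "vanishes_on_solutions p (\<lambda>z. \<rho> z - D_x K z)" unfolding vanishes_iff[OF p]
    using e(1) D_x_of_cone[OF p K] unfolding KH germ_eq_def by eventually_elim simp
  moreover have "vanishes_on_solutions p (\<lambda>z. \<sigma> z + D_t K z)" unfolding vanishes_iff[OF p]
    using e(2) D_t_of_cone[OF p K] unfolding KH germ_eq_def by eventually_elim simp
  moreover have "smooth_near p (\<lambda>z. \<rho> z - D_x K z)" "smooth_near p (\<lambda>z. \<sigma> z + D_t K z)"
    by (intro smooth_near_add smooth_near_diff smooth_near_D_t smooth_near_D_x s K)+
  moreover have "germ_eq p \<rho> (\<lambda>z. (\<rho> z - D_x K z) + D_x K z)" "germ_eq p \<sigma> (\<lambda>z. (\<sigma> z + D_t K z) - D_t K z)"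
    by simp_all
  ultimately show "(\<rho>, \<sigma>) \<in> trivial_currents p"
    unfolding trivial_currents_def using K by blast
qed

lemma cone_t_linear:
  assumes "smooth_near q f" "smooth_near q g"
  shows "germ_eq q (cone_t (\<lambda>z. a * f z + g z)) (\<lambda>z. a * cone_t f z + cone_t g z)"
  using vf_linear[OF assms, of "cone_field True" a] vf_linear[OF assms, of "cone_field False" a]
  unfolding germ_eq_def cone_t_def by eventually_elim (simp add: algebra_simps)

lemma cone_x_linear:
  assumes "smooth_near q f" "smooth_near q g"
  shows "germ_eq q (cone_x (\<lambda>z. a * f z + g z)) (\<lambda>z. a * cone_x f z + cone_x g z)"
  using vf_linear[OF assms, of "cone_field True" a] vf_linear[OF assms, of "cone_field False" a]
  unfolding germ_eq_def cone_x_def by eventually_elim (simp add: algebra_simps)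

lemma subspace_trivial_currents:
  assumes p: "p \<in> solution_set" shows "subspace (trivial_currents p)"
proof (rule subspaceI_linear)
  have "cone_x (\<lambda>y. 0) = (\<lambda>y. 0)" "cone_t (\<lambda>y. 0) = (\<lambda>y. 0)"
    by (simp_all add: fun_eq_iff cone_x_def cone_t_def)
  then show "0 \<in> trivial_currents p"
    unfolding zero_prod_def zero_fun_eq trivial_iff[OF p]
    by (intro conjI smooth_near_const exI[of _ "\<lambda>y. 0"]) simp_all
next
  fix c x y assume "x \<in> trivial_currents p" "y \<in> trivial_currents p"
  moreover obtain \<rho> \<sigma> \<rho>' \<sigma>' where x: "x = (\<rho>, \<sigma>)" "y = (\<rho>', \<sigma>')" by (metis surj_pair)
  ultimately obtain H H' where s: "smooth_near p \<rho>" "smooth_near p \<sigma>" "smooth_near p \<rho>'" "smooth_near p \<sigma>'"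
    and H: "smooth_near (to_cone p) H" "smooth_near (to_cone p) H'"
    and e: "germ_eq (to_cone p) (\<lambda>y. \<rho> (of_cone y)) (cone_x H)" "germ_eq (to_cone p) (\<lambda>y. \<sigma> (of_cone y)) (\<lambda>y. - cone_t H y)"
      "germ_eq (to_cone p) (\<lambda>y. \<rho>' (of_cone y)) (cone_x H')" "germ_eq (to_cone p) (\<lambda>y. \<sigma>' (of_cone y)) (\<lambda>y. - cone_t H' y)"
    unfolding x trivial_iff[OF p] by blast
  have "germ_eq (to_cone p) (\<lambda>y. c * \<rho> (of_cone y) + \<rho>' (of_cone y)) (cone_x (\<lambda>y. c * H y + H' y))"
    using e(1,3) cone_x_linear[OF H, of c] unfolding germ_eq_def by eventually_elim simp
  moreover have "germ_eq (to_cone p) (\<lambda>y. c * \<sigma> (of_cone y) + \<sigma>' (of_cone y)) (\<lambda>y. - cone_t (\<lambda>y. c * H y + H' y) y)"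
    using e(2,4) cone_t_linear[OF H, of c] unfolding germ_eq_def by eventually_elim simp
  ultimately show "c *\<^sub>R x + y \<in> trivial_currents p"
    unfolding x pair_linear trivial_iff[OF p] using smooth_near_linear[OF H, of c]
      smooth_near_linear[OF s(1,3), of c] smooth_near_linear[OF s(2,4), of c] by blast
qed

lemma trivial_subset_conserved:
  assumes p: "p \<in> solution_set" shows "trivial_currents p \<subseteq> conserved_currents p"
proof
  fix x assume "x \<in> trivial_currents p"
  moreover obtain \<rho> \<sigma> where x: "x = (\<rho>, \<sigma>)" by (metis surj_pair)
  ultimately obtain H where s: "smooth_near p \<rho>" "smooth_near p \<sigma>" and H: "smooth_near (to_cone p) H"
    and e: "germ_eq (to_cone p) (\<lambda>y. \<rho> (of_cone y)) (cone_x H)" "germ_eq (to_cone p) (\<lambda>y. \<sigma> (of_cone y)) (\<lambda>y. - cone_t H y)"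
    unfolding x trivial_iff[OF p] by blast
  let ?q = "to_cone p"
  note HD = smooth_near_cone_D[OF H]
  have D: "germ_eq ?q (cone_D b (\<lambda>y. \<rho> (of_cone y))) (\<lambda>y. cone_D b (cone_D True H) y + cone_D b (cone_D False H) y)"
    "germ_eq ?q (cone_D b (\<lambda>y. \<sigma> (of_cone y))) (\<lambda>y. cone_D b (cone_D False H) y - cone_D b (cone_D True H) y)" for b
  proof -
    show "germ_eq ?q (cone_D b (\<lambda>y. \<rho> (of_cone y))) (\<lambda>y. cone_D b (cone_D True H) y + cone_D b (cone_D False H) y)"
      using germ_eq_trans[OF vf_cong[OF e(1)[unfolded cone_x_def[abs_def]]] vf_add[OF HD HD]] .
    have "germ_eq ?q (\<lambda>y. \<sigma> (of_cone y)) (\<lambda>y. cone_D False H y - cone_D True H y)"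
      using e(2) by (simp add: cone_t_def)
    from germ_eq_trans[OF vf_cong[OF this] vf_diff[OF HD HD]]
    show "germ_eq ?q (cone_D b (\<lambda>y. \<sigma> (of_cone y))) (\<lambda>y. cone_D b (cone_D False H) y - cone_D b (cone_D True H) y)" .
  qed
  have "zero_germ ?q (\<lambda>y. cone_t (\<lambda>y. \<rho> (of_cone y)) y + cone_x (\<lambda>y. \<sigma> (of_cone y)) y)"
    using D(1)[of True] D(1)[of False] D(2)[of True] D(2)[of False] cone_D_commute[OF H, of True False]
    unfolding germ_eq_def cone_t_def cone_x_def by eventually_elim simp
  then show "x \<in> conserved_currents p" unfolding x conserved_iff[OF p] using s by blast
qed

subsection \<open>The special currents\<close>

lemma smooth_near_cone_coord: "smooth_near (cone_coord b p) F \<Longrightarrow> smooth_near p (\<lambda>z. F (cone_coord b z))"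
  by (rule smooth_near_affine[OF affine_cone_coord])

lemma restrict_to_cone:
  assumes p: "p \<in> solution_set" and "germ_eq p \<rho> (\<lambda>z. f (cone_coord False z) (cone_coord True z))"
  shows "germ_eq (to_cone p) (\<lambda>y. \<rho> (of_cone y)) (\<lambda>y. f (strand False y) (strand True y))"
  using germ_eq_comp[OF affine_coords_continuous[OF affine_of_cone], of "to_cone p" \<rho>
      "\<lambda>z. f (cone_coord False z) (cone_coord True z)"] assms(2)
  by (simp add: of_cone_to_cone[OF p])

lemma lift_from_cone:
  assumes "germ_eq (to_cone p) f g"
  shows "germ_eq p (\<lambda>z. f (to_cone z)) (\<lambda>z. g (to_cone z))"
  by (rule germ_eq_comp[OF affine_coords_continuous[OF affine_to_cone] assms])

lemma V_check_iff: "(\<rho>, \<sigma>) \<in> V_check p \<longleftrightarrow>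
  (\<exists>F G. smooth_near (cone_coord False p) F \<and> smooth_near (cone_coord True p) G \<and>
    germ_eq p \<rho> (\<lambda>z. F (cone_coord False z) - G (cone_coord True z)) \<and>
    germ_eq p \<sigma> (\<lambda>z. F (cone_coord False z) + G (cone_coord True z)))"
  by (simp add: V_check_def eta_coords_eq xi_coords_eq)

lemma V0_check_iff: "(\<rho>, \<sigma>) \<in> V0_check p \<longleftrightarrow>
  (\<exists>F G C. smooth_near (cone_coord False p) F \<and> smooth_near (cone_coord True p) G \<and>
    germ_eq p \<rho> (\<lambda>z. D_check F (cone_coord False z) - D_check G (cone_coord True z) + C * z (U 0 1)) \<and>
    germ_eq p \<sigma> (\<lambda>z. D_check F (cone_coord False z) + D_check G (cone_coord True z) - C * z (U 1 0)))"
  by (simp add: V0_check_def eta_coords_eq xi_coords_eq)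

lemma subspace_V_check: "subspace (V_check p)"
proof (rule subspaceI_linear)
  show "0 \<in> V_check p"
    unfolding zero_prod_def zero_fun_eq V_check_iff
    by (intro exI[of _ "\<lambda>y. 0"]) (simp add: smooth_near_const)
next
  fix c x y assume "x \<in> V_check p" "y \<in> V_check p"
  moreover obtain \<rho> \<sigma> \<rho>' \<sigma>' where x: "x = (\<rho>, \<sigma>)" "y = (\<rho>', \<sigma>')" by (metis surj_pair)
  ultimately obtain F G F' G' where s: "smooth_near (cone_coord False p) F" "smooth_near (cone_coord True p) G"
      "smooth_near (cone_coord False p) F'" "smooth_near (cone_coord True p) G'"
    and e: "germ_eq p \<rho> (\<lambda>z. F (cone_coord False z) - G (cone_coord True z))"
      "germ_eq p \<sigma> (\<lambda>z. F (cone_coord False z) + G (cone_coord True z))"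
      "germ_eq p \<rho>' (\<lambda>z. F' (cone_coord False z) - G' (cone_coord True z))"
      "germ_eq p \<sigma>' (\<lambda>z. F' (cone_coord False z) + G' (cone_coord True z))"
    unfolding x V_check_iff by blast
  have "germ_eq p (\<lambda>z. c * \<rho> z + \<rho>' z) (\<lambda>z. (c * F (cone_coord False z) + F' (cone_coord False z)) -
      (c * G (cone_coord True z) + G' (cone_coord True z)))"
    using e(1,3) unfolding germ_eq_def
  proof eventually_elim
    case (elim z)
    show ?case unfolding elim by (simp add: algebra_simps)
  qed
  moreover have "germ_eq p (\<lambda>z. c * \<sigma> z + \<sigma>' z) (\<lambda>z. (c * F (cone_coord False z) + F' (cone_coord False z)) +
      (c * G (cone_coord True z) + G' (cone_coord True z)))"
    using e(2,4) unfolding germ_eq_def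
  proof eventually_elim
    case (elim z)
    show ?case unfolding elim by (simp add: algebra_simps)
  qed
  ultimately show "c *\<^sub>R x + y \<in> V_check p"
    unfolding x pair_linear V_check_iff
    by (intro exI[of _ "\<lambda>y. c * F y + F' y"] exI[of _ "\<lambda>y. c * G y + G' y"])
      (simp add: smooth_near_linear s)
qed

lemma smooth_V_check:
  assumes "(\<rho>, \<sigma>) \<in> V_check p" shows "smooth_near p \<rho>" "smooth_near p \<sigma>"
proof -
  obtain F G where s: "smooth_near (cone_coord False p) F" "smooth_near (cone_coord True p) G"
    and e: "germ_eq p \<rho> (\<lambda>z. F (cone_coord False z) - G (cone_coord True z))"
      "germ_eq p \<sigma> (\<lambda>z. F (cone_coord False z) + G (cone_coord True z))"
    using assms unfolding V_check_iff by blast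
  show "smooth_near p \<rho>"
    by (rule smooth_near_cong[OF _ germ_eq_sym[OF e(1)]]) (intro smooth_near_diff smooth_near_cone_coord s)
  show "smooth_near p \<sigma>"
    by (rule smooth_near_cong[OF _ germ_eq_sym[OF e(2)]]) (intro smooth_near_add smooth_near_cone_coord s)
qed

lemma V_check_subset_conserved:
  assumes p: "p \<in> solution_set" shows "V_check p \<subseteq> conserved_currents p"
proof
  fix x assume xV: "x \<in> V_check p"
  obtain \<rho> \<sigma> where x: "x = (\<rho>, \<sigma>)" by (metis surj_pair)
  let ?q = "to_cone p"
  obtain F G where s: "smooth_near (strand False ?q) F" "smooth_near (strand True ?q) G"
    and e: "germ_eq p \<rho> (\<lambda>z. F (cone_coord False z) - G (cone_coord True z))"
      "germ_eq p \<sigma> (\<lambda>z. F (cone_coord False z) + G (cone_coord True z))"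
    using xV unfolding x V_check_iff strand_to_cone by blast
  note e' = restrict_to_cone[OF p e(1)] restrict_to_cone[OF p e(2)]
  note s' = smooth_near_strand[OF s(1)] smooth_near_strand[OF s(2)]
  have D: "germ_eq ?q (cone_D b (\<lambda>y. \<rho> (of_cone y)))
      (\<lambda>y. cone_D b (\<lambda>y. F (strand False y)) y - cone_D b (\<lambda>y. G (strand True y)) y)"
    "germ_eq ?q (cone_D b (\<lambda>y. \<sigma> (of_cone y)))
      (\<lambda>y. cone_D b (\<lambda>y. F (strand False y)) y + cone_D b (\<lambda>y. G (strand True y)) y)" for b
    using germ_eq_trans[OF vf_cong[OF e'(1)] vf_diff[OF s']] germ_eq_trans[OF vf_cong[OF e'(2)] vf_add[OF s']] .
  have "zero_germ ?q (\<lambda>y. cone_t (\<lambda>y. \<rho> (of_cone y)) y + cone_x (\<lambda>y. \<sigma> (of_cone y)) y)"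
    using D(1)[of True] D(1)[of False] D(2)[of True] D(2)[of False]
      cone_D_strand[OF s(1), of True] cone_D_strand[OF s(2), of False]
    unfolding germ_eq_def cone_t_def cone_x_def by eventually_elim simp
  then show "x \<in> conserved_currents p"
    unfolding x conserved_iff[OF p] using smooth_V_check[OF xV[unfolded x]] by blast
qed

lemma cone_D_potential:
  assumes "smooth_near (strand False q) F" "smooth_near (strand True q) G"
  shows "germ_eq q (cone_D b (\<lambda>y. F (strand False y) - G (strand True y) + C * y V))
    (\<lambda>y. (if b then - D_check G (strand True y) else D_check F (strand False y)) + C * y (W b 1) / 2)"
proof -
  note s = smooth_near_strand[OF assms(1)] smooth_near_strand[OF assms(2)]
  have "germ_eq q (cone_D b (\<lambda>y. F (strand False y) - G (strand True y) + C * y V))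
      (\<lambda>y. cone_D b (\<lambda>y. F (strand False y) - G (strand True y)) y + cone_D b (\<lambda>y. C * y V) y)"
    by (rule vf_add) (intro smooth_near_intros s)+
  moreover have "germ_eq q (cone_D b (\<lambda>y. C * y V)) (\<lambda>y. C * cone_D b (\<lambda>y. y V) y)"
    by (rule vf_cmult[OF smooth_near_coordinate])
  moreover note vf_diff[OF s, of "cone_field b"] cone_D_strand[OF assms(1), of b] cone_D_strand[OF assms(2), of b]
  ultimately show ?thesis unfolding germ_eq_def
    by eventually_elim (simp add: cone_field_def)
qed

text \<open>The potential of a trivial special current is \<open>F - G + C u\<close>. The terms with \<open>C\<close> are
  themselves of the special form, because \<open>u\<^sub>0\<^sub>1\<close> and \<open>u\<^sub>1\<^sub>0\<close> are half the sum and half the difference of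
  \<open>w\<^sub>1\<^sub>0\<close> and \<open>w\<^sub>0\<^sub>1\<close>.\<close>

lemma V0_check_eq:
  assumes p: "p \<in> solution_set" shows "V0_check p = V_check p \<inter> trivial_currents p"
proof (intro equalityI subsetI)
  let ?q = "to_cone p"
  fix x assume xV: "x \<in> V0_check p"
  obtain \<rho> \<sigma> where x: "x = (\<rho>, \<sigma>)" by (metis surj_pair)
  obtain F G C where s: "smooth_near (cone_coord False p) F" "smooth_near (cone_coord True p) G"
    and e: "germ_eq p \<rho> (\<lambda>z. D_check F (cone_coord False z) - D_check G (cone_coord True z) + C * z (U 0 1))"
      "germ_eq p \<sigma> (\<lambda>z. D_check F (cone_coord False z) + D_check G (cone_coord True z) - C * z (U 1 0))"
    using xV unfolding x V0_check_iff by blast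
  have c1: "z (U 0 1) = (cone_coord False z 1 + cone_coord True z 1) / 2"
    "z (U 1 0) = (cone_coord True z 1 - cone_coord False z 1) / 2" for z :: jet
    by (simp_all add: cone_coord_def sg_def)
  let ?F = "\<lambda>y. D_check F y + C * y 1 / 2" and ?G = "\<lambda>y. D_check G y - C * y 1 / 2"
  have "germ_eq p \<rho> (\<lambda>z. ?F (cone_coord False z) - ?G (cone_coord True z))"
    using e(1) unfolding germ_eq_def by eventually_elim (simp only: c1, simp add: field_simps)
  moreover have "germ_eq p \<sigma> (\<lambda>z. ?F (cone_coord False z) + ?G (cone_coord True z))"
    using e(2) unfolding germ_eq_def by eventually_elim (simp only: c1, simp add: field_simps)
  moreover have "smooth_near (cone_coord False p) ?F" "smooth_near (cone_coord True p) ?G"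
    by (intro smooth_near_add smooth_near_diff smooth_near_divide smooth_near_mult smooth_near_const
        smooth_near_coordinate smooth_near_D_check s)+
  ultimately have xV: "x \<in> V_check p" unfolding x V_check_iff by blast
  let ?H = "\<lambda>y. F (strand False y) - G (strand True y) + C * y V"
  have s': "smooth_near (strand False ?q) F" "smooth_near (strand True ?q) G" using s by (simp_all add: strand_to_cone)
  have comp: "germ_eq ?q (\<lambda>y. f (of_cone y)) (\<lambda>y. g (of_cone y))" if "germ_eq p f g" for f g
    using germ_eq_comp[OF affine_coords_continuous[OF affine_of_cone], of ?q f g] that
    by (simp add: of_cone_to_cone[OF p])
  have "germ_eq ?q (\<lambda>y. \<rho> (of_cone y)) (cone_x ?H)"
    using comp[OF e(1)] cone_D_potential[OF s', of True C] cone_D_potential[OF s', of False C]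
    unfolding germ_eq_def cone_x_def by eventually_elim (simp add: of_cone_def field_simps)
  moreover have "germ_eq ?q (\<lambda>y. \<sigma> (of_cone y)) (\<lambda>y. - cone_t ?H y)"
    using comp[OF e(2)] cone_D_potential[OF s', of True C] cone_D_potential[OF s', of False C]
    unfolding germ_eq_def cone_t_def by eventually_elim (simp add: of_cone_def field_simps)
  moreover have "smooth_near ?q ?H"
    by (intro smooth_near_intros smooth_near_strand s')
  ultimately have "x \<in> trivial_currents p"
    unfolding x trivial_iff[OF p] using smooth_V_check[OF xV[unfolded x]] by blast
  with xV show "x \<in> V_check p \<inter> trivial_currents p" by simp
next
  let ?q = "to_cone p"
  fix x assume "x \<in> V_check p \<inter> trivial_currents p"
  then have xV: "x \<in> V_check p" and xT: "x \<in> trivial_currents p" by simp_all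
  obtain \<rho> \<sigma> where x: "x = (\<rho>, \<sigma>)" by (metis surj_pair)
  obtain F G where s: "smooth_near (cone_coord False p) F" "smooth_near (cone_coord True p) G"
    and e: "germ_eq p \<rho> (\<lambda>z. F (cone_coord False z) - G (cone_coord True z))"
      "germ_eq p \<sigma> (\<lambda>z. F (cone_coord False z) + G (cone_coord True z))"
    using xV unfolding x V_check_iff by blast
  obtain H where H: "smooth_near ?q H" "germ_eq ?q (\<lambda>y. \<rho> (of_cone y)) (cone_x H)"
    "germ_eq ?q (\<lambda>y. \<sigma> (of_cone y)) (\<lambda>y. - cone_t H y)"
    using xT unfolding x trivial_iff[OF p] by blast
  note e' = restrict_to_cone[OF p e(1)] restrict_to_cone[OF p e(2)]
  have D: "germ_eq ?q (cone_D b H) (\<lambda>y. (if b then (\<lambda>y. - G y) else F) (strand b y))" for b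
    using e' H(2,3) unfolding germ_eq_def cone_x_def cone_t_def
    by eventually_elim (cases b; simp)
  obtain h C where h: "\<And>b. smooth_near (strand b ?q) (h b)"
    and Hh: "germ_eq ?q H (\<lambda>y. h True (strand True y) + h False (strand False y) + C * y V)"
    using potential_splits[of ?q H "\<lambda>b. if b then (\<lambda>y. - G y) else F", OF H(1) D] by blast
  let ?F = "h False" and ?G = "\<lambda>y. - h True y"
  have s': "smooth_near (strand False ?q) ?F" "smooth_near (strand True ?q) ?G"
    using h smooth_near_minus by blast+
  have "germ_eq ?q H (\<lambda>y. ?F (strand False y) - ?G (strand True y) + C * y V)"
    using Hh unfolding germ_eq_def by eventually_elim simp
  from germ_eq_trans[OF vf_cong[OF this] cone_D_potential[OF s']]
  have DH: "germ_eq ?q (cone_D b H)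
    (\<lambda>y. (if b then - D_check ?G (strand True y) else D_check ?F (strand False y)) + C * y (W b 1) / 2)" for b .
  have "germ_eq ?q (\<lambda>y. F (strand False y) - G (strand True y))
      (\<lambda>y. D_check ?F (strand False y) - D_check ?G (strand True y) + C * (y (W True 1) + y (W False 1)) / 2)"
    using e'(1) H(2) DH[of True] DH[of False] unfolding germ_eq_def cone_x_def
    by eventually_elim (simp add: field_simps)
  from germ_eq_trans[OF e(1)] lift_from_cone[OF this]
  have "germ_eq p \<rho> (\<lambda>z. D_check ?F (cone_coord False z) - D_check ?G (cone_coord True z)
      + C * (cone_coord True z 1 + cone_coord False z 1) / 2)"
    by (simp add: strand_to_cone to_cone_def)
  moreover have "germ_eq ?q (\<lambda>y. F (strand False y) + G (strand True y))
      (\<lambda>y. D_check ?F (strand False y) + D_check ?G (strand True y) - C * (y (W True 1) - y (W False 1)) / 2)"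
    using e'(2) H(3) DH[of True] DH[of False] unfolding germ_eq_def cone_t_def
    by eventually_elim (simp add: field_simps)
  from germ_eq_trans[OF e(2)] lift_from_cone[OF this]
  have "germ_eq p \<sigma> (\<lambda>z. D_check ?F (cone_coord False z) + D_check ?G (cone_coord True z)
      - C * (cone_coord True z 1 - cone_coord False z 1) / 2)"
    by (simp add: strand_to_cone to_cone_def)
  moreover have "(cone_coord True z 1 + cone_coord False z 1) / 2 = z (U 0 1)"
    "(cone_coord True z 1 - cone_coord False z 1) / 2 = z (U 1 0)" for z :: jet
    by (simp_all add: cone_coord_def sg_def)
  ultimately have "germ_eq p \<rho> (\<lambda>z. D_check ?F (cone_coord False z) - D_check ?G (cone_coord True z) + C * z (U 0 1))"
    "germ_eq p \<sigma> (\<lambda>z. D_check ?F (cone_coord False z) + D_check ?G (cone_coord True z) - C * z (U 1 0))"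
    by (simp_all flip: times_divide_eq_right)
  with s' show "x \<in> V0_check p" unfolding x V0_check_iff strand_to_cone by blast
qed

text \<open>For the half-sum \<open>a\<close> and the half-difference \<open>\<beta>\<close> of density and flux, the conservation law is
  the equation \<open>cone_D True a = cone_D False \<beta>\<close>.\<close>

lemma conserved_split:
  assumes p: "p \<in> solution_set" and c: "(\<rho>, \<sigma>) \<in> conserved_currents p"
  obtains F G H where "smooth_near (cone_coord False p) F" "smooth_near (cone_coord True p) G"
    "smooth_near (to_cone p) H"
    "germ_eq (to_cone p) (\<lambda>y. \<rho> (of_cone y)) (\<lambda>y. F (strand False y) - G (strand True y) + cone_x H y)"
    "germ_eq (to_cone p) (\<lambda>y. \<sigma> (of_cone y)) (\<lambda>y. F (strand False y) + G (strand True y) - cone_t H y)"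
proof -
  let ?q = "to_cone p"
  let ?r = "\<lambda>y. \<rho> (of_cone y)" and ?s = "\<lambda>y. \<sigma> (of_cone y)"
  have s: "smooth_near p \<rho>" "smooth_near p \<sigma>"
    and z: "zero_germ ?q (\<lambda>y. cone_t ?r y + cone_x ?s y)"
    using c unfolding conserved_iff[OF p] by blast+
  note rs = smooth_near_of_cone[OF p s(1)] smooth_near_of_cone[OF p s(2)]
  let ?a = "\<lambda>y. 1/2 * (?r y + ?s y)" and ?\<beta> = "\<lambda>y. 1/2 * (?r y - ?s y)"
  have ab: "smooth_near ?q ?a" "smooth_near ?q ?\<beta>" by (intro smooth_near_intros rs)+
  have D: "germ_eq ?q (cone_D b ?a) (\<lambda>y. 1/2 * (cone_D b ?r y + cone_D b ?s y))"
    "germ_eq ?q (cone_D b ?\<beta>) (\<lambda>y. 1/2 * (cone_D b ?r y - cone_D b ?s y))" for b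
    using vf_cmult[OF smooth_near_add[OF rs], of "cone_field b" "1/2"] vf_add[OF rs, of "cone_field b"]
      vf_cmult[OF smooth_near_diff[OF rs], of "cone_field b" "1/2"] vf_diff[OF rs, of "cone_field b"]
    unfolding germ_eq_def by (eventually_elim, simp)+
  have "germ_eq ?q (cone_D (\<not> False) ?a) (cone_D False ?\<beta>)"
    using z D(1)[of True] D(2)[of False] unfolding germ_eq_def cone_t_def cone_x_def
    by eventually_elim simp
  from conserved_normal_form[OF ab this] obtain F G H where
    FG: "smooth_near (strand False ?q) F" "smooth_near (strand True ?q) G" and H: "smooth_near ?q H"
    and e: "germ_eq ?q ?a (\<lambda>y. F (strand False y) + cone_D False H y)"
      "germ_eq ?q ?\<beta> (\<lambda>y. G (strand True y) + cone_D True H y)" by auto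
  show thesis
  proof (rule that[of F "\<lambda>y. - G y" H])
    show "smooth_near (cone_coord False p) F" "smooth_near (cone_coord True p) (\<lambda>y. - G y)"
      using FG by (auto simp: strand_to_cone)
    show "germ_eq ?q ?r (\<lambda>y. F (strand False y) - (- G (strand True y)) + cone_x H y)"
      using e unfolding germ_eq_def cone_x_def by eventually_elim (simp add: field_simps)
    show "germ_eq ?q ?s (\<lambda>y. F (strand False y) + (- G (strand True y)) - cone_t H y)"
      using e unfolding germ_eq_def cone_t_def by eventually_elim (simp add: field_simps)
  qed (rule H)
qed

theorem conservation_laws:
  assumes p: "p \<in> solution_set"
  shows "naturally_isomorphic (V_check p) (V0_check p) (conserved_currents p) (trivial_currents p)"
proof (rule naturally_isomorphicI[OF subspace_V_check V0_check_eq[OF p] subspace_conserved_currents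
      subspace_trivial_currents[OF p] trivial_subset_conserved[OF p] V_check_subset_conserved[OF p]])
  let ?q = "to_cone p"
  fix x assume xc: "x \<in> conserved_currents p"
  obtain \<rho> \<sigma> where x: "x = (\<rho>, \<sigma>)" by (metis surj_pair)
  obtain F G H where s: "smooth_near (cone_coord False p) F" "smooth_near (cone_coord True p) G"
    and H: "smooth_near ?q H"
    and e: "germ_eq ?q (\<lambda>y. \<rho> (of_cone y)) (\<lambda>y. F (strand False y) - G (strand True y) + cone_x H y)"
    "germ_eq ?q (\<lambda>y. \<sigma> (of_cone y)) (\<lambda>y. F (strand False y) + G (strand True y) - cone_t H y)"
    using conserved_split[OF p xc[unfolded x]] .
  let ?v = "(\<lambda>z. F (cone_coord False z) - G (cone_coord True z), \<lambda>z. F (cone_coord False z) + G (cone_coord True z))"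
  have v: "?v \<in> V_check p" unfolding V_check_iff using s by (meson germ_eq_refl)
  have xv: "x - ?v = (\<lambda>z. \<rho> z - (F (cone_coord False z) - G (cone_coord True z)),
      \<lambda>z. \<sigma> z - (F (cone_coord False z) + G (cone_coord True z)))"
    unfolding x by (simp add: fun_eq_iff)
  have "smooth_near p \<rho>" "smooth_near p \<sigma>" using xc unfolding x conserved_iff[OF p] by blast+
  then have "smooth_near p (\<lambda>z. \<rho> z - (F (cone_coord False z) - G (cone_coord True z)))"
    "smooth_near p (\<lambda>z. \<sigma> z - (F (cone_coord False z) + G (cone_coord True z)))"
    using s by (auto intro!: smooth_near_diff smooth_near_add smooth_near_cone_coord)
  moreover have "germ_eq ?q (\<lambda>y. \<rho> (of_cone y) - (F (strand False y) - G (strand True y))) (cone_x H)"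
    using e(1) unfolding germ_eq_def by eventually_elim simp
  moreover have "germ_eq ?q (\<lambda>y. \<sigma> (of_cone y) - (F (strand False y) + G (strand True y))) (\<lambda>y. - cone_t H y)"
    using e(2) unfolding germ_eq_def by eventually_elim simp
  ultimately have "x - ?v \<in> trivial_currents p"
    unfolding xv trivial_iff[OF p] cone_coord_of_cone using H by blast
  with v show "\<exists>v\<in>V_check p. x - v \<in> trivial_currents p" by blast
qed

section \<open>Characteristics and variational symmetries\<close>

lemma smooth_near_wave_lhs: "smooth_near p wave_lhs"
  unfolding wave_lhs_def[abs_def] by (intro smooth_near_intros)

lemma D_t_mult:
  assumes "smooth_near p f" "smooth_near p g"
  shows "germ_eq p (D_t (\<lambda>z. f z * g z)) (\<lambda>z. D_t f z * g z + f z * D_t g z)"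
  using D_t_eq_vf[OF smooth_near_mult[OF assms]] vf_mult[OF assms, of field_t]
    D_t_eq_vf[OF assms(1)] D_t_eq_vf[OF assms(2)]
  unfolding germ_eq_def by eventually_elim simp

lemma D_x_mult:
  assumes "smooth_near p f" "smooth_near p g"
  shows "germ_eq p (D_x (\<lambda>z. f z * g z)) (\<lambda>z. D_x f z * g z + f z * D_x g z)"
  using D_x_eq_vf[OF smooth_near_mult[OF assms]] vf_mult[OF assms, of field_x]
    D_x_eq_vf[OF assms(1)] D_x_eq_vf[OF assms(2)]
  unfolding germ_eq_def by eventually_elim simp

lemma D_t_coordinate: "germ_eq p (D_t (\<lambda>z. z v)) (field_t v)"
  using D_t_eq_vf[OF smooth_near_coordinate[of p v]] unfolding germ_eq_def by eventually_elim simp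

lemma D_x_coordinate: "germ_eq p (D_x (\<lambda>z. z v)) (field_x v)"
  using D_x_eq_vf[OF smooth_near_coordinate[of p v]] unfolding germ_eq_def by eventually_elim simp

lemma prolongation_Lagrangian:
  "prolongation \<mu> Lagrangian z = D_x \<mu> z * z (U 0 1) - D_t \<mu> z * z (U 1 0)"
proof -
  have p: "partial (U i j) Lagrangian z = (if i = 1 \<and> j = 0 then - z (U 1 0) else if i = 0 \<and> j = 1 then z (U 0 1) else 0)" for i j
    by (rule partial_eqI) (auto simp: Lagrangian_def power2_eq_square intro!: derivative_eq_intros)
  have "prolongation \<mu> Lagrangian z =
      (\<Sum>(i, j)\<in>{(1, 0), (0, 1)}. (D_t ^^ i) ((D_x ^^ j) \<mu>) z * partial (U i j) Lagrangian z)"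
    unfolding prolongation_def by (rule Sum_any_eq_sum) (auto simp: p split: if_splits)
  then show ?thesis by (simp add: p)
qed

lemma prolongation_divergence:
  assumes "smooth_near p \<mu>"
  shows "germ_eq p (prolongation \<mu> Lagrangian)
    (\<lambda>z. \<mu> z * wave_lhs z - D_t (\<lambda>z. \<mu> z * z (U 1 0)) z + D_x (\<lambda>z. \<mu> z * z (U 0 1)) z)"
  using D_t_mult[OF assms smooth_near_coordinate[of p "U 1 0"]] D_t_coordinate[of p "U 1 0"]
    D_x_mult[OF assms smooth_near_coordinate[of p "U 0 1"]] D_x_coordinate[of p "U 0 1"]
  unfolding germ_eq_def
  by eventually_elim
    (simp add: prolongation_Lagrangian wave_lhs_def field_t_def field_x_def numeral_2_eq_2 algebra_simps)

lemma characteristicsI: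
  "smooth_near p \<mu> \<Longrightarrow> smooth_near p \<rho> \<Longrightarrow> smooth_near p \<sigma> \<Longrightarrow>
    germ_eq p (\<lambda>z. \<mu> z * wave_lhs z) (\<lambda>z. D_t \<rho> z + D_x \<sigma> z) \<Longrightarrow> \<mu> \<in> characteristics p"
  unfolding characteristics_def by blast

lemma characteristicsE:
  assumes "\<mu> \<in> characteristics p"
  obtains \<rho> \<sigma> where "smooth_near p \<mu>" "smooth_near p \<rho>" "smooth_near p \<sigma>"
    "germ_eq p (\<lambda>z. \<mu> z * wave_lhs z) (\<lambda>z. D_t \<rho> z + D_x \<sigma> z)"
  using assms unfolding characteristics_def by blast

text \<open>The prolongation of the Lagrangian differs from \<open>\<mu> (u\<^sub>t\<^sub>t - u\<^sub>x\<^sub>x)\<close> by a total divergence.\<close>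

lemma variational_symmetries_eq: "variational_symmetries p = characteristics p"
proof (intro equalityI subsetI)
  fix \<mu> assume "\<mu> \<in> variational_symmetries p"
  then obtain A B where \<mu>: "smooth_near p \<mu>" and AB: "smooth_near p A" "smooth_near p B"
    and e: "germ_eq p (prolongation \<mu> Lagrangian) (\<lambda>z. D_t A z + D_x B z)"
    by (auto simp: variational_symmetries_def)
  have m: "smooth_near p (\<lambda>z. \<mu> z * z v)" for v by (intro smooth_near_intros \<mu>)
  have "germ_eq p (\<lambda>z. \<mu> z * wave_lhs z)
      (\<lambda>z. D_t (\<lambda>z. 1 * A z + \<mu> z * z (U 1 0)) z + D_x (\<lambda>z. - 1 * (\<mu> z * z (U 0 1)) + B z) z)"
    using e prolongation_divergence[OF \<mu>] D_t_linear[OF AB(1) m[of "U 1 0"], of 1]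
      D_x_linear[OF m[of "U 0 1"] AB(2), of "-1"]
    unfolding germ_eq_def by eventually_elim simp
  then show "\<mu> \<in> characteristics p"
    by (rule characteristicsI[rotated -1]) (intro smooth_near_linear \<mu> AB m)+
next
  fix \<mu> assume "\<mu> \<in> characteristics p"
  then obtain \<rho> \<sigma> where \<mu>: "smooth_near p \<mu>" and AB: "smooth_near p \<rho>" "smooth_near p \<sigma>"
    and e: "germ_eq p (\<lambda>z. \<mu> z * wave_lhs z) (\<lambda>z. D_t \<rho> z + D_x \<sigma> z)"
    by (rule characteristicsE)
  have m: "smooth_near p (\<lambda>z. \<mu> z * z v)" for v by (intro smooth_near_intros \<mu>)
  have "germ_eq p (prolongation \<mu> Lagrangian)
      (\<lambda>z. D_t (\<lambda>z. - 1 * (\<mu> z * z (U 1 0)) + \<rho> z) z + D_x (\<lambda>z. 1 * (\<mu> z * z (U 0 1)) + \<sigma> z) z)"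
    using e prolongation_divergence[OF \<mu>] D_t_linear[OF m[of "U 1 0"] AB(1), of "-1"]
      D_x_linear[OF m[of "U 0 1"] AB(2), of 1]
    unfolding germ_eq_def by eventually_elim simp
  moreover have "smooth_near p (\<lambda>z. - 1 * (\<mu> z * z (U 1 0)) + \<rho> z)"
    "smooth_near p (\<lambda>z. 1 * (\<mu> z * z (U 0 1)) + \<sigma> z)"
    by (intro smooth_near_linear AB m)+
  ultimately show "\<mu> \<in> variational_symmetries p"
    unfolding variational_symmetries_def using \<mu> by blast
qed

lemma subspace_characteristics: "subspace (characteristics p)"
proof (rule subspaceI_linear)
  show "0 \<in> characteristics p" unfolding zero_fun_eq
    by (rule characteristicsI[of _ _ "\<lambda>z. 0" "\<lambda>z. 0"]) simp_all
next
  fix c \<mu> \<mu>' assume *: "\<mu> \<in> characteristics p" "\<mu>' \<in> characteristics p"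
  obtain \<rho> \<sigma> where \<mu>: "smooth_near p \<mu>" and s: "smooth_near p \<rho>" "smooth_near p \<sigma>"
    and e: "germ_eq p (\<lambda>z. \<mu> z * wave_lhs z) (\<lambda>z. D_t \<rho> z + D_x \<sigma> z)"
    using characteristicsE[OF *(1)] .
  obtain \<rho>' \<sigma>' where \<mu>': "smooth_near p \<mu>'" and s': "smooth_near p \<rho>'" "smooth_near p \<sigma>'"
    and e': "germ_eq p (\<lambda>z. \<mu>' z * wave_lhs z) (\<lambda>z. D_t \<rho>' z + D_x \<sigma>' z)"
    using characteristicsE[OF *(2)] .
  have "germ_eq p (\<lambda>z. (c * \<mu> z + \<mu>' z) * wave_lhs z)
      (\<lambda>z. D_t (\<lambda>z. c * \<rho> z + \<rho>' z) z + D_x (\<lambda>z. c * \<sigma> z + \<sigma>' z) z)"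
    using e e' D_t_linear[OF s(1) s'(1), of c] D_x_linear[OF s(2) s'(2), of c] unfolding germ_eq_def
  proof eventually_elim
    case (elim z)
    have "(c * \<mu> z + \<mu>' z) * wave_lhs z = c * (\<mu> z * wave_lhs z) + \<mu>' z * wave_lhs z" by (simp add: algebra_simps)
    then show ?case unfolding elim by (simp add: algebra_simps)
  qed
  then show "c *\<^sub>R \<mu> + \<mu>' \<in> characteristics p" unfolding fun_linear
    by (rule characteristicsI[rotated -1]) (intro smooth_near_linear s s' \<mu> \<mu>')+
qed

lemma subspace_trivial_symmetries: "subspace (trivial_symmetries p)"
proof (rule subspaceI_linear)
  show "0 \<in> trivial_symmetries p"
    using subspace_0[OF subspace_characteristics]
    by (simp add: trivial_symmetries_def variational_symmetries_eq vanishes_on_solutions_def)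
next
  fix c \<mu> \<mu>' assume *: "\<mu> \<in> trivial_symmetries p" "\<mu>' \<in> trivial_symmetries p"
  then have "c *\<^sub>R \<mu> + \<mu>' \<in> characteristics p"
    by (intro subspace_add[OF subspace_characteristics] subspace_scale[OF subspace_characteristics])
      (auto simp: trivial_symmetries_def variational_symmetries_eq)
  moreover have "vanishes_on_solutions p (\<lambda>z. c * \<mu> z + \<mu>' z)"
  proof -
    have "vanishes_on_solutions p \<mu>" "vanishes_on_solutions p \<mu>'" using * by (auto simp: trivial_symmetries_def)
    then show ?thesis unfolding vanishes_on_solutions_def by eventually_elim simp
  qed
  ultimately show "c *\<^sub>R \<mu> + \<mu>' \<in> trivial_symmetries p"
    by (simp add: trivial_symmetries_def variational_symmetries_eq fun_linear)
qed

subsection \<open>The Euler operators\<close>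

abbreviation neg_D :: "((nat \<Rightarrow> real) \<Rightarrow> real) \<Rightarrow> (nat \<Rightarrow> real) \<Rightarrow> real" where
  "neg_D \<equiv> \<lambda>g. - D_check g"

lemma smooth_near_neg_D: "smooth_near x g \<Longrightarrow> smooth_near x (neg_D g)"
  unfolding fun_Compl_def by (intro smooth_near_minus smooth_near_D_check)

lemma smooth_near_neg_D_iter: "smooth_near x g \<Longrightarrow> smooth_near x ((neg_D ^^ k) g)"
  by (induction k) (simp_all add: smooth_near_neg_D)

lemma D_check_zero_on:
  assumes "open N" "\<And>y. y \<in> N \<Longrightarrow> g y = 0" "y \<in> N"
  shows "D_check g y = 0"
proof -
  have "partial l g y = 0" for l
    using partial_cong_open[OF assms(1,3), of g "\<lambda>y. 0" l] assms(2) by simp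
  then have "partial 0 g y = 0" "(\<lambda>l. if l \<ge> 1 then y (l + 1) * partial l g y else 0) = (\<lambda>l. 0)" by auto
  then show ?thesis unfolding D_check_def by (simp only:) simp
qed

text \<open>For the sum defining \<open>euler_check\<close> to be finite near a point, all but finitely many of its terms
  must vanish on one common neighbourhood.\<close>

lemma neg_D_iter_zero_on:
  assumes "open N" "\<And>y. y \<in> N \<Longrightarrow> g y = 0" "y \<in> N"
  shows "(neg_D ^^ k) g y = 0"
  using assms(3)
proof (induction k arbitrary: y)
  case (Suc k)
  then show ?case using D_check_zero_on[OF assms(1) Suc.IH Suc.prems] by simp
qed (use assms(2) in simp)

lemma support_bound:
  fixes x :: "nat \<Rightarrow> real"
  assumes "smooth_near x F"
  obtains N where "\<forall>\<^sub>F y in nhds x. \<forall>l\<ge>N. partial l F y = 0"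
proof -
  obtain S where S: "finite S" "\<forall>\<^sub>F y in nhds x. \<forall>l. l \<notin> S \<longrightarrow> partial l F y = 0"
    using finite_support[OF assms] .
  obtain N where "\<forall>l\<in>S. l < N" using S(1) unfolding finite_nat_set_iff_bounded by blast
  then have "l \<notin> S" if "N \<le> l" for l using that by force
  with S(2) have "\<forall>\<^sub>F y in nhds x. \<forall>l\<ge>N. partial l F y = 0" by (auto elim: eventually_mono)
  then show thesis by (rule that)
qed

lemma euler_check_eq_sum:
  assumes "smooth_near x F"
  shows "\<exists>N. \<forall>M\<ge>N. germ_eq x (euler_check F) (\<lambda>y. \<Sum>k<M. (neg_D ^^ k) (partial (Suc k) F) y)"
proof -
  obtain N where N: "\<forall>\<^sub>F y in nhds x. \<forall>l\<ge>N. partial l F y = 0" using support_bound[OF assms] .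
  then obtain Z where Z: "open Z" "x \<in> Z" "\<And>y l. y \<in> Z \<Longrightarrow> N \<le> l \<Longrightarrow> partial l F y = 0"
    unfolding eventually_nhds by blast
  have "germ_eq x (euler_check F) (\<lambda>y. \<Sum>k<M. (neg_D ^^ k) (partial (Suc k) F) y)" if "N \<le> M" for M
    unfolding germ_eq_def
  proof (rule eventually_mono[OF eventually_nhds_in_open[OF Z(1,2)]])
    fix y assume y: "y \<in> Z"
    have "euler_check F y = (\<Sum>l\<in>{1..M}. if l \<ge> 1 then (neg_D ^^ (l - 1)) (partial l F) y else 0)"
      unfolding euler_check_def
    proof (rule Sum_any_eq_sum)
      fix l assume "l \<notin> {1..M}"
      then show "(if l \<ge> 1 then (neg_D ^^ (l - 1)) (partial l F) y else 0) = 0"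
        using neg_D_iter_zero_on[OF Z(1) Z(3) y] that by auto
    qed simp
    also have "\<dots> = (\<Sum>k<M. (neg_D ^^ k) (partial (Suc k) F) y)"
      by (simp add: sum.atLeast1_atMost_eq)
    finally show "euler_check F y = (\<Sum>k<M. (neg_D ^^ k) (partial (Suc k) F) y)" .
  qed
  then show ?thesis by blast
qed

lemma smooth_near_euler_check:
  assumes "smooth_near x F" shows "smooth_near x (euler_check F)"
proof -
  obtain M where "germ_eq x (euler_check F) (\<lambda>y. \<Sum>k<M. (neg_D ^^ k) (partial (Suc k) F) y)"
    using euler_check_eq_sum[OF assms] by blast
  show ?thesis
    by (rule smooth_near_cong[OF _ germ_eq_sym[OF \<open>germ_eq x _ _\<close>]])
      (intro smooth_near_sum smooth_near_neg_D_iter smooth_near_partial assms)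
qed

subsection \<open>Special characteristics\<close>

text \<open>The differential consequence \<open>D\<^sub>x\<^sup>k (u\<^sub>t\<^sub>t - u\<^sub>x\<^sub>x)\<close> of the equation.\<close>

definition wave_D :: "nat \<Rightarrow> jet \<Rightarrow> real" where
  "wave_D k z = z (U 2 k) - z (U 0 (k + 2))"

lemma smooth_near_wave_D: "smooth_near p (wave_D k)"
  unfolding wave_D_def[abs_def] by (intro smooth_near_intros)

lemma D_x_wave_D: "germ_eq p (D_x (wave_D k)) (wave_D (Suc k))"
proof -
  have "germ_eq p (D_x (wave_D k)) (vf field_x (wave_D k))" by (rule D_x_eq_vf[OF smooth_near_wave_D])
  moreover have "germ_eq p (vf field_x (wave_D k)) (\<lambda>z. vf field_x (\<lambda>z. z (U 2 k)) z - vf field_x (\<lambda>z. z (U 0 (k + 2))) z)"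
    unfolding wave_D_def[abs_def] by (rule vf_diff) (rule smooth_near_coordinate)+
  ultimately show ?thesis unfolding germ_eq_def
    by eventually_elim (simp add: field_x_def wave_D_def)
qed

lemma D_x_cone_coord:
  assumes "smooth_near (cone_coord b p) F"
  shows "germ_eq p (D_x (\<lambda>z. F (cone_coord b z))) (\<lambda>z. D_check F (cone_coord b z))"
proof -
  have "germ_eq p (D_x (\<lambda>z. F (cone_coord b z))) (vf field_x (\<lambda>z. F (cone_coord b z)))"
    by (rule D_x_eq_vf[OF smooth_near_cone_coord[OF assms]])
  also have "germ_eq p \<dots> (\<lambda>z. vf field_check F (cone_coord b z))"
    by (rule vf_affine_related[OF affine_cone_coord, where c = field_x and d = field_check, OF assms])
      (simp add: cone_coord_def field_x_def field_check_def)
  also have "germ_eq p \<dots> (\<lambda>z. D_check F (cone_coord b z))"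
    by (rule germ_eq_sym, rule germ_eq_comp[OF affine_coords_continuous[OF affine_cone_coord], OF D_check_eq_vf[OF assms]])
  finally show ?thesis .
qed

text \<open>Off the solution set, the derivative of \<open>F\<close> along the other family of characteristics
  does not vanish but is a combination of the differential consequences of the equation.\<close>

lemma characteristic_defect:
  assumes F: "smooth_near (cone_coord b p) F"
  shows "\<exists>N. \<forall>M\<ge>N. germ_eq p
    (\<lambda>z. sg b * D_t (\<lambda>z. F (cone_coord b z)) z - D_x (\<lambda>z. F (cone_coord b z)) z)
    (\<lambda>z. \<Sum>k<M. partial (Suc k) F (cone_coord b z) * wave_D k z)"
proof -
  obtain N where N: "\<forall>\<^sub>F y in nhds (cone_coord b p). \<forall>l\<ge>N. partial l F y = 0" using support_bound[OF F] .
  from eventually_comp[OF affine_coords_continuous[OF affine_cone_coord],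
      where P = "\<lambda>y. \<forall>l\<ge>N. partial l F y = 0", OF N]
  have N': "\<forall>\<^sub>F z in nhds p. \<forall>l\<ge>N. partial l F (cone_coord b z) = 0" .
  let ?e = "\<lambda>l z. if l = 0 then 0 else wave_D (l - 1) z"
  have coef: "cone_coord b (\<lambda>v. field_t v z) l - cone_coord b (\<lambda>v. 0) l = sg b * (field_check l (cone_coord b z) + ?e l z)" for l z
    by (cases b; cases l) (simp_all add: cone_coord_def field_t_def field_check_def sg_def wave_D_def numeral_2_eq_2)
  have t: "germ_eq p (D_t (\<lambda>z. F (cone_coord b z)))
      (\<lambda>z. Sum_any (\<lambda>l. (cone_coord b (\<lambda>v. field_t v z) l - cone_coord b (\<lambda>v. 0) l) * partial l F (cone_coord b z)))"
    by (rule germ_eq_trans[OF D_t_eq_vf[OF smooth_near_cone_coord[OF F]] vf_affine[OF affine_cone_coord, OF F]])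
  have x: "germ_eq p (D_x (\<lambda>z. F (cone_coord b z))) (\<lambda>z. vf field_check F (cone_coord b z))"
    by (rule germ_eq_trans[OF D_x_cone_coord[OF F]],
      rule germ_eq_comp[OF affine_coords_continuous[OF affine_cone_coord], OF D_check_eq_vf[OF F]])
  have "germ_eq p
    (\<lambda>z. sg b * D_t (\<lambda>z. F (cone_coord b z)) z - D_x (\<lambda>z. F (cone_coord b z)) z)
    (\<lambda>z. \<Sum>k<M. partial (Suc k) F (cone_coord b z) * wave_D k z)" if "N \<le> M" for M
    using N' t x unfolding germ_eq_def
  proof eventually_elim
    case (elim z)
    let ?P = "\<lambda>l. partial l F (cone_coord b z)"
    have "D_t (\<lambda>z. F (cone_coord b z)) z = (\<Sum>l\<in>{..M}. sg b * (field_check l (cone_coord b z) + ?e l z) * ?P l)"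
      unfolding elim(2) coef by (rule Sum_any_eq_sum) (use elim(1) that in auto)
    then have "D_t (\<lambda>z. F (cone_coord b z)) z = sg b * (\<Sum>l\<in>{..M}. (field_check l (cone_coord b z) + ?e l z) * ?P l)"
      by (simp add: sum_distrib_left mult.assoc)
    moreover have "sg b * (sg b * r) = r" for r by (simp add: sg_def)
    ultimately have "sg b * D_t (\<lambda>z. F (cone_coord b z)) z = (\<Sum>l\<in>{..M}. (field_check l (cone_coord b z) + ?e l z) * ?P l)"
      by simp
    moreover have "D_x (\<lambda>z. F (cone_coord b z)) z = (\<Sum>l\<in>{..M}. field_check l (cone_coord b z) * ?P l)"
      unfolding elim(3) by (rule vf_eq_sum) (use elim(1) that in auto)
    ultimately have "sg b * D_t (\<lambda>z. F (cone_coord b z)) z - D_x (\<lambda>z. F (cone_coord b z)) z = (\<Sum>l\<in>{..M}. ?e l z * ?P l)"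
      by (simp add: distrib_right sum.distrib)
    also have "\<dots> = (\<Sum>k<M. wave_D k z * ?P (Suc k))"
      unfolding lessThan_Suc_atMost[symmetric] by (subst sum.lessThan_Suc_shift) simp
    finally show ?case by (simp add: mult.commute)
  qed
  then show ?thesis by blast
qed

lemma integrate_by_parts:
  assumes "smooth_near (cone_coord b p) g"
  shows "\<exists>Q. smooth_near p Q \<and> germ_eq p (\<lambda>z. g (cone_coord b z) * wave_D k z)
    (\<lambda>z. (neg_D ^^ k) g (cone_coord b z) * wave_lhs z + D_x Q z)"
  using assms
proof (induction k arbitrary: g)
  case 0
  have "germ_eq p (\<lambda>z. g (cone_coord b z) * wave_D 0 z)
    (\<lambda>z. (neg_D ^^ 0) g (cone_coord b z) * wave_lhs z + D_x (\<lambda>z. 0) z)"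
    by (simp add: wave_D_def wave_lhs_def numeral_2_eq_2)
  then show ?case using smooth_near_const by blast
next
  case (Suc k)
  let ?g = "\<lambda>z. g (cone_coord b z)"
  obtain Q where Q: "smooth_near p Q" "germ_eq p (\<lambda>z. neg_D g (cone_coord b z) * wave_D k z)
    (\<lambda>z. (neg_D ^^ k) (neg_D g) (cone_coord b z) * wave_lhs z + D_x Q z)"
    using Suc.IH[OF smooth_near_neg_D[OF Suc.prems]] by blast
  note g = smooth_near_cone_coord[OF Suc.prems]
  have s: "smooth_near p (\<lambda>z. ?g z * wave_D k z)" by (intro smooth_near_mult g smooth_near_wave_D)
  have it: "(neg_D ^^ Suc k) g = (neg_D ^^ k) (neg_D g)" by (simp only: funpow_Suc_right o_def)
  have "germ_eq p (\<lambda>z. ?g z * wave_D (Suc k) z)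
    (\<lambda>z. (neg_D ^^ Suc k) g (cone_coord b z) * wave_lhs z + D_x (\<lambda>z. 1 * (?g z * wave_D k z) + Q z) z)"
    using Q(2) D_x_linear[OF s Q(1), of 1] D_x_mult[OF g smooth_near_wave_D, of k] D_x_wave_D[of p k]
      D_x_cone_coord[OF Suc.prems]
    unfolding germ_eq_def it by eventually_elim simp
  then show ?case using smooth_near_linear[OF s Q(1), of 1] by blast
qed

text \<open>By \<open>characteristic_defect\<close> the divergence of the current belonging to \<open>F\<close> is a combination of
  differential consequences of the equation with coefficients \<open>\<partial>F\<close>; integrations by parts move the
  derivatives onto the coefficients.\<close>

lemma special_divergence:
  assumes F: "smooth_near (cone_coord b p) F"
  shows "\<exists>A B. smooth_near p A \<and> smooth_near p B \<and>
    germ_eq p (\<lambda>z. - euler_check F (cone_coord b z) * wave_lhs z) (\<lambda>z. D_t A z + D_x B z)"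
proof -
  let ?F = "\<lambda>z. F (cone_coord b z)"
  have parts: "\<exists>Q. smooth_near p Q \<and> germ_eq p (\<lambda>z. \<Sum>k<M. partial (Suc k) F (cone_coord b z) * wave_D k z)
      (\<lambda>z. (\<Sum>k<M. (neg_D ^^ k) (partial (Suc k) F) (cone_coord b z)) * wave_lhs z + D_x Q z)" for M
  proof (induction M)
    case 0
    show ?case by (rule exI[of _ "\<lambda>z. 0"]) (simp add: smooth_near_const)
  next
    case (Suc M)
    then obtain Q where Q: "smooth_near p Q" "germ_eq p (\<lambda>z. \<Sum>k<M. partial (Suc k) F (cone_coord b z) * wave_D k z)
      (\<lambda>z. (\<Sum>k<M. (neg_D ^^ k) (partial (Suc k) F) (cone_coord b z)) * wave_lhs z + D_x Q z)" by blast
    obtain Q' where Q': "smooth_near p Q'" "germ_eq p (\<lambda>z. partial (Suc M) F (cone_coord b z) * wave_D M z)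
      (\<lambda>z. (neg_D ^^ M) (partial (Suc M) F) (cone_coord b z) * wave_lhs z + D_x Q' z)"
      using integrate_by_parts[OF smooth_near_partial[OF F]] by blast
    have "germ_eq p (\<lambda>z. \<Sum>k<Suc M. partial (Suc k) F (cone_coord b z) * wave_D k z)
      (\<lambda>z. (\<Sum>k<Suc M. (neg_D ^^ k) (partial (Suc k) F) (cone_coord b z)) * wave_lhs z + D_x (\<lambda>z. 1 * Q z + Q' z) z)"
      using Q(2) Q'(2) D_x_linear[OF Q(1) Q'(1), of 1] unfolding germ_eq_def
      by eventually_elim (simp add: distrib_right)
    then show ?case using smooth_near_linear[OF Q(1) Q'(1), of 1] by blast
  qed
  obtain N where N: "\<forall>M\<ge>N. germ_eq (cone_coord b p) (euler_check F) (\<lambda>y. \<Sum>k<M. (neg_D ^^ k) (partial (Suc k) F) y)"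
    using euler_check_eq_sum[OF F] by blast
  obtain N' where N': "\<forall>M\<ge>N'. germ_eq p (\<lambda>z. sg b * D_t ?F z - D_x ?F z)
      (\<lambda>z. \<Sum>k<M. partial (Suc k) F (cone_coord b z) * wave_D k z)"
    using characteristic_defect[OF F] by blast
  define M where "M = max N N'"
  have E: "germ_eq (cone_coord b p) (euler_check F) (\<lambda>y. \<Sum>k<M. (neg_D ^^ k) (partial (Suc k) F) y)"
    using N by (simp add: M_def)
  have E': "germ_eq p (\<lambda>z. euler_check F (cone_coord b z)) (\<lambda>z. \<Sum>k<M. (neg_D ^^ k) (partial (Suc k) F) (cone_coord b z))"
    by (rule germ_eq_comp[OF affine_coords_continuous[OF affine_cone_coord], OF E])
  have D: "germ_eq p (\<lambda>z. sg b * D_t ?F z - D_x ?F z)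
      (\<lambda>z. \<Sum>k<M. partial (Suc k) F (cone_coord b z) * wave_D k z)"
    using N' by (simp add: M_def)
  obtain Q where Q: "smooth_near p Q" "germ_eq p (\<lambda>z. \<Sum>k<M. partial (Suc k) F (cone_coord b z) * wave_D k z)
      (\<lambda>z. (\<Sum>k<M. (neg_D ^^ k) (partial (Suc k) F) (cone_coord b z)) * wave_lhs z + D_x Q z)"
    using parts by blast
  note sF = smooth_near_cone_coord[OF F]
  have "germ_eq p (\<lambda>z. - euler_check F (cone_coord b z) * wave_lhs z)
      (\<lambda>z. D_t (\<lambda>z. - sg b * ?F z + 0) z + D_x (\<lambda>z. 1 * ?F z + Q z) z)"
    using E' D Q(2) D_t_linear[OF sF smooth_near_const, of "- sg b" 0] D_x_linear[OF sF Q(1), of 1]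
    unfolding germ_eq_def by eventually_elim simp
  then show ?thesis
    using smooth_near_linear[OF sF smooth_near_const, of "- sg b" 0] smooth_near_linear[OF sF Q(1), of 1] by blast
qed

lemma special_iff: "\<mu> \<in> special_symmetries p \<longleftrightarrow>
  (\<exists>F G. smooth_near (cone_coord False p) F \<and> smooth_near (cone_coord True p) G \<and>
    germ_eq p \<mu> (\<lambda>z. - euler_check F (cone_coord False z) - euler_check G (cone_coord True z)))"
  by (simp add: special_symmetries_def eta_coords_eq xi_coords_eq)

lemma special_subset_characteristics: "special_symmetries p \<subseteq> characteristics p"
proof
  fix \<mu> assume "\<mu> \<in> special_symmetries p"
  then obtain F G where s: "smooth_near (cone_coord False p) F" "smooth_near (cone_coord True p) G"
    and e: "germ_eq p \<mu> (\<lambda>z. - euler_check F (cone_coord False z) - euler_check G (cone_coord True z))"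
    unfolding special_iff by blast
  obtain A B where AB: "smooth_near p A" "smooth_near p B"
    "germ_eq p (\<lambda>z. - euler_check F (cone_coord False z) * wave_lhs z) (\<lambda>z. D_t A z + D_x B z)"
    using special_divergence[OF s(1)] by blast
  obtain A' B' where AB': "smooth_near p A'" "smooth_near p B'"
    "germ_eq p (\<lambda>z. - euler_check G (cone_coord True z) * wave_lhs z) (\<lambda>z. D_t A' z + D_x B' z)"
    using special_divergence[OF s(2)] by blast
  have "smooth_near p \<mu>"
    by (rule smooth_near_cong[OF _ germ_eq_sym[OF e]])
      (intro smooth_near_diff smooth_near_minus smooth_near_cone_coord smooth_near_euler_check s)
  moreover have "germ_eq p (\<lambda>z. \<mu> z * wave_lhs z) (\<lambda>z. D_t (\<lambda>z. 1 * A z + A' z) z + D_x (\<lambda>z. 1 * B z + B' z) z)"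
    using e AB(3) AB'(3) D_t_linear[OF AB(1) AB'(1), of 1] D_x_linear[OF AB(2) AB'(2), of 1] unfolding germ_eq_def
  proof eventually_elim
    case (elim z)
    have "\<mu> z * wave_lhs z = - euler_check F (cone_coord False z) * wave_lhs z + - euler_check G (cone_coord True z) * wave_lhs z"
      unfolding elim(1) by (simp add: algebra_simps)
    then show ?case unfolding elim by simp
  qed
  ultimately show "\<mu> \<in> characteristics p"
    by (intro characteristicsI[OF _ smooth_near_linear[OF AB(1) AB'(1), of 1]
          smooth_near_linear[OF AB(2) AB'(2), of 1]])
qed

subsection \<open>The restriction of a characteristic to the solution set\<close>

definition neg_x :: "(cone \<Rightarrow> real) \<Rightarrow> cone \<Rightarrow> real" where
  "neg_x f y = - cone_x f y"

lemma cone_x_cong: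
  assumes "germ_eq q f g" shows "germ_eq q (cone_x f) (cone_x g)"
  using vf_cong[OF assms, of "cone_field True"] vf_cong[OF assms, of "cone_field False"]
  unfolding germ_eq_def cone_x_def by eventually_elim simp

lemma neg_x_cong:
  assumes "germ_eq q f g" shows "germ_eq q (neg_x f) (neg_x g)"
  using cone_x_cong[OF assms] unfolding germ_eq_def neg_x_def by eventually_elim simp

lemma smooth_near_neg_x: "smooth_near q f \<Longrightarrow> smooth_near q (neg_x f)"
  unfolding neg_x_def[abs_def] by (intro smooth_near_minus smooth_near_cone_x)

lemma smooth_near_neg_x_iter: "smooth_near q f \<Longrightarrow> smooth_near q ((neg_x ^^ k) f)"
  by (induction k) (simp_all add: smooth_near_neg_x)

lemma neg_x_iter_cong: "germ_eq q f g \<Longrightarrow> germ_eq q ((neg_x ^^ k) f) ((neg_x ^^ k) g)"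
  by (induction k) (simp_all add: neg_x_cong)

lemma neg_x_iter_linear:
  assumes "smooth_near q f" "smooth_near q g"
  shows "germ_eq q ((neg_x ^^ k) (\<lambda>y. a * f y + g y)) (\<lambda>y. a * (neg_x ^^ k) f y + (neg_x ^^ k) g y)"
proof (induction k)
  case (Suc k)
  let ?f = "(neg_x ^^ k) f" and ?g = "(neg_x ^^ k) g"
  from neg_x_cong[OF Suc] cone_x_linear[OF smooth_near_neg_x_iter[OF assms(1)] smooth_near_neg_x_iter[OF assms(2)], of a k k]
  show ?case unfolding germ_eq_def by eventually_elim (simp add: neg_x_def)
qed simp

lemma neg_x_iter_zero:
  assumes "zero_germ q f" shows "zero_germ q ((neg_x ^^ k) f)"
proof -
  have "neg_x (\<lambda>y. 0) = (\<lambda>y. 0)" by (rule ext) (simp add: neg_x_def cone_x_def)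
  then have "(neg_x ^^ k) (\<lambda>y. 0) = (\<lambda>y. 0)" by (induction k) simp_all
  then show ?thesis using neg_x_iter_cong[OF assms, of k] by simp
qed

lemma neg_x_iter_cmult:
  assumes "smooth_near q f" shows "germ_eq q ((neg_x ^^ k) (\<lambda>y. a * f y)) (\<lambda>y. a * (neg_x ^^ k) f y)"
  using neg_x_iter_linear[OF assms smooth_near_const, of k a 0] neg_x_iter_zero[of q "\<lambda>y. 0" k]
  unfolding germ_eq_def by simp (erule eventually_elim2, assumption, simp)

lemma neg_x_iter_add:
  assumes "smooth_near q f" "smooth_near q g"
  shows "germ_eq q ((neg_x ^^ k) (\<lambda>y. f y + g y)) (\<lambda>y. (neg_x ^^ k) f y + (neg_x ^^ k) g y)"
  using neg_x_iter_linear[OF assms, of k 1] by simp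

lemma neg_x_iter_sum:
  assumes "\<And>i. i \<in> I \<Longrightarrow> smooth_near q (f i)"
  shows "germ_eq q ((neg_x ^^ k) (\<lambda>y. \<Sum>i\<in>I. f i y)) (\<lambda>y. \<Sum>i\<in>I. (neg_x ^^ k) (f i) y)"
  using assms
proof (induction I rule: infinite_finite_induct)
  case (insert i I)
  have s: "smooth_near q (f i)" "smooth_near q (\<lambda>y. \<Sum>i\<in>I. f i y)" using insert.prems by (auto intro: smooth_near_sum)
  have IH: "germ_eq q ((neg_x ^^ k) (\<lambda>y. \<Sum>i\<in>I. f i y)) (\<lambda>y. \<Sum>i\<in>I. (neg_x ^^ k) (f i) y)"
    by (rule insert.IH) (use insert.prems in auto)
  from neg_x_iter_add[OF s, of k] IH show ?case unfolding germ_eq_def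
    by eventually_elim (simp add: insert.hyps)
qed (simp_all add: neg_x_iter_zero)

lemma neg_x_cone_t:
  assumes f: "smooth_near q f" shows "germ_eq q (neg_x (cone_t f)) (cone_t (neg_x f))"
proof -
  note s = smooth_near_cone_D[OF f]
  have 1: "germ_eq q (cone_D b (cone_t f)) (\<lambda>y. cone_D b (cone_D True f) y - cone_D b (cone_D False f) y)" for b
    unfolding cone_t_def[abs_def] by (rule vf_diff[OF s s])
  have 2: "germ_eq q (cone_D b (cone_x f)) (\<lambda>y. cone_D b (cone_D True f) y + cone_D b (cone_D False f) y)" for b
    unfolding cone_x_def[abs_def] by (rule vf_add[OF s s])
  have 3: "germ_eq q (cone_D b (neg_x f)) (\<lambda>y. - cone_D b (cone_x f) y)" for b
    unfolding neg_x_def[abs_def] by (rule vf_minus[OF smooth_near_cone_x[OF f]])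
  show ?thesis
    using 1[of True] 1[of False] 2[of True] 2[of False] 3[of True] 3[of False] cone_D_commute[OF f, of True False]
    unfolding germ_eq_def by eventually_elim (simp add: neg_x_def cone_x_def cone_t_def)
qed

lemma neg_x_iter_cone_t:
  assumes f: "smooth_near q f" shows "germ_eq q ((neg_x ^^ k) (cone_t f)) (cone_t ((neg_x ^^ k) f))"
proof (induction k)
  case (Suc k)
  from germ_eq_trans[OF neg_x_cong[OF Suc] neg_x_cone_t[OF smooth_near_neg_x_iter[OF f]]] show ?case by simp
qed simp

text \<open>The formal adjoint of total \<open>x\<close>-differentiation, applied termwise to a family \<open>g\<close>.\<close>

definition adj :: "nat \<Rightarrow> (nat \<Rightarrow> cone \<Rightarrow> real) \<Rightarrow> cone \<Rightarrow> real" where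
  "adj N g y = (\<Sum>j<N. (neg_x ^^ j) (g j) y)"

lemma smooth_near_adj: "(\<And>j. smooth_near q (g j)) \<Longrightarrow> smooth_near q (adj N g)"
  unfolding adj_def[abs_def] by (intro smooth_near_sum smooth_near_neg_x_iter)

lemma adj_termwise:
  assumes "\<And>j. j < N \<Longrightarrow> germ_eq q (\<lambda>y. (neg_x ^^ j) (g j) y) (h j)"
  shows "germ_eq q (adj N g) (\<lambda>y. \<Sum>j<N. h j y)"
proof -
  have "\<forall>\<^sub>F y in nhds q. \<forall>j\<in>{..<N}. (neg_x ^^ j) (g j) y = h j y"
    by (rule eventually_ball_finite) (use assms in \<open>auto simp: germ_eq_def\<close>)
  then show ?thesis unfolding germ_eq_def adj_def by eventually_elim simp
qed

lemma adj_cong: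
  assumes "\<And>j. germ_eq q (g j) (h j)" shows "germ_eq q (adj N g) (adj N h)"
  unfolding adj_def[of N h, abs_def] by (rule adj_termwise) (rule neg_x_iter_cong[OF assms])

lemma adj_zero:
  assumes "\<And>j. zero_germ q (g j)" shows "zero_germ q (adj N g)"
proof -
  have "germ_eq q (adj N g) (\<lambda>y. \<Sum>j<N. 0)"
    by (rule adj_termwise) (rule neg_x_iter_zero[OF assms])
  then show ?thesis by simp
qed

lemma adj_add:
  assumes "\<And>j. smooth_near q (g j)" "\<And>j. smooth_near q (h j)"
  shows "germ_eq q (adj N (\<lambda>j y. g j y + h j y)) (\<lambda>y. adj N g y + adj N h y)"
proof -
  have "germ_eq q (adj N (\<lambda>j y. g j y + h j y)) (\<lambda>y. \<Sum>j<N. (neg_x ^^ j) (g j) y + (neg_x ^^ j) (h j) y)"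
    by (rule adj_termwise) (rule neg_x_iter_add[OF assms])
  then show ?thesis by (simp add: adj_def sum.distrib)
qed

lemma adj_cone_t:
  assumes "\<And>j. smooth_near q (g j)"
  shows "germ_eq q (adj N (\<lambda>j. cone_t (g j))) (cone_t (adj N g))"
proof -
  note s = smooth_near_neg_x_iter[OF assms]
  have "germ_eq q (cone_D b (adj N g)) (\<lambda>y. \<Sum>j<N. cone_D b ((neg_x ^^ j) (g j)) y)" for b
    unfolding adj_def[abs_def] by (rule vf_sum) (rule s)
  from this[of True] this[of False]
  have "germ_eq q (\<lambda>y. \<Sum>j<N. cone_t ((neg_x ^^ j) (g j)) y) (cone_t (adj N g))"
    unfolding germ_eq_def cone_t_def by eventually_elim (simp add: sum_subtractf)
  with adj_termwise[of N q "\<lambda>j. cone_t (g j)" "\<lambda>j. cone_t ((neg_x ^^ j) (g j))", OF neg_x_iter_cone_t[OF assms]]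
  show ?thesis by (rule germ_eq_trans)
qed

text \<open>Applied to \<open>g\<^sub>j = s\<^sub>j\<^sub>-\<^sub>1\<close> for the derivatives \<open>s\<^sub>j\<close> of a flux, this says that total
  \<open>x\<close>-derivatives have no variational derivative.\<close>

lemma adj_telescopes:
  assumes g: "\<And>j. smooth_near q (g j)"
  shows "germ_eq q (adj N (\<lambda>j y. cone_x (g (Suc j)) y + g j y)) (\<lambda>y. g 0 y - (neg_x ^^ N) (g N) y)"
proof -
  have "germ_eq q (adj N (\<lambda>j y. cone_x (g (Suc j)) y + g j y))
      (\<lambda>y. \<Sum>j<N. (neg_x ^^ j) (g j) y - (neg_x ^^ Suc j) (g (Suc j)) y)"
  proof (rule adj_termwise)
    fix j
    have "(neg_x ^^ Suc j) (g (Suc j)) = (neg_x ^^ j) (neg_x (g (Suc j)))" by (simp only: funpow_Suc_right o_def)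
    moreover have "(\<lambda>y. - 1 * neg_x (g (Suc j)) y + g j y) = (\<lambda>y. cone_x (g (Suc j)) y + g j y)"
      by (simp add: neg_x_def)
    ultimately show "germ_eq q ((neg_x ^^ j) (\<lambda>y. cone_x (g (Suc j)) y + g j y))
       (\<lambda>y. (neg_x ^^ j) (g j) y - (neg_x ^^ Suc j) (g (Suc j)) y)"
      using neg_x_iter_linear[OF smooth_near_neg_x[OF g[of "Suc j"]] g[of j], of j "-1"]
      unfolding germ_eq_def by (auto elim: eventually_mono)
  qed
  moreover have "(\<Sum>j<N. (neg_x ^^ j) (g j) y - (neg_x ^^ Suc j) (g (Suc j)) y) = g 0 y - (neg_x ^^ N) (g N) y" for y
    using sum_lessThan_telescope'[of "\<lambda>j. (neg_x ^^ j) (g j) y" N] by simp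
  ultimately show ?thesis by (simp only:)
qed

lemma partial_field_t:
  assumes "smooth_near p f"
  shows "germ_eq p (partial (U i j) (vf field_t f))
    (\<lambda>z. vf field_t (partial (U i j) f) z + (if i = 0 then 0 else partial (U (i - 1) j) f z))"
proof -
  have pc: "partial (U i j) (field_t w) z = (case w of U i' j' \<Rightarrow> if i = i' + 1 \<and> j = j' then 1 else 0 | _ \<Rightarrow> 0)" for w z
    by (cases w) (simp_all add: field_t_def[abs_def] partial_coordinate)
  have "vf (\<lambda>w. partial (U i j) (field_t w)) f z = (\<Sum>w\<in>{U (i - 1) j}. partial (U i j) (field_t w) z * partial w f z)" for z
    unfolding vf_def by (rule Sum_any_eq_sum) (auto simp: pc split: jet_var.splits)
  then have "vf (\<lambda>w. partial (U i j) (field_t w)) f z = (if i = 0 then 0 else partial (U (i - 1) j) f z)" for z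
    by (simp add: pc)
  then show ?thesis using partial_vf[where c = field_t, OF assms smooth_near_field_t, of "U i j"] by simp
qed

lemma partial_field_x:
  assumes "smooth_near p f"
  shows "germ_eq p (partial (U i j) (vf field_x f))
    (\<lambda>z. vf field_x (partial (U i j) f) z + (if j = 0 then 0 else partial (U i (j - 1)) f z))"
proof -
  have pc: "partial (U i j) (field_x w) z = (case w of U i' j' \<Rightarrow> if i = i' \<and> j = j' + 1 then 1 else 0 | _ \<Rightarrow> 0)" for w z
    by (cases w) (simp_all add: field_x_def[abs_def] partial_coordinate)
  have "vf (\<lambda>w. partial (U i j) (field_x w)) f z = (\<Sum>w\<in>{U i (j - 1)}. partial (U i j) (field_x w) z * partial w f z)" for z
    unfolding vf_def by (rule Sum_any_eq_sum) (auto simp: pc split: jet_var.splits)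
  then have "vf (\<lambda>w. partial (U i j) (field_x w)) f z = (if j = 0 then 0 else partial (U i (j - 1)) f z)" for z
    by (simp add: pc)
  then show ?thesis using partial_vf[where c = field_x, OF assms smooth_near_field_x, of "U i j"] by simp
qed

text \<open>The linearization at a solution of \<open>\<mu> (u\<^sub>t\<^sub>t - u\<^sub>x\<^sub>x) = D\<^sub>t \<rho> + D\<^sub>x \<sigma>\<close>: the derivative with respect
  to \<open>u\<^sub>i\<^sub>j\<close>, restricted to the solution set.\<close>

lemma linearized_divergence:
  assumes p: "p \<in> solution_set" and \<mu>: "smooth_near p \<mu>" and s: "smooth_near p \<rho>" "smooth_near p \<sigma>"
    and e: "germ_eq p (\<lambda>z. \<mu> z * wave_lhs z) (\<lambda>z. D_t \<rho> z + D_x \<sigma> z)"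
  defines "r \<equiv> \<lambda>i j y. partial (U i j) \<rho> (of_cone y)" and "s \<equiv> \<lambda>i j y. partial (U i j) \<sigma> (of_cone y)"
  shows "germ_eq (to_cone p)
    (\<lambda>y. \<mu> (of_cone y) * ((if i = 2 \<and> j = 0 then 1 else 0) - (if i = 0 \<and> j = 2 then 1 else 0)))
    (\<lambda>y. (cone_t (r i j) y + (if i = 0 then 0 else r (i - 1) j y)) +
         (cone_x (s i j) y + (if j = 0 then 0 else s i (j - 1) y)))"
proof -
  let ?q = "to_cone p" and ?P = "partial (U i j)"
  let ?\<delta> = "(if i = 2 \<and> j = 0 then 1 else 0) - (if i = 0 \<and> j = 2 then 1 else 0) :: real"
  have wl: "?P wave_lhs z = ?\<delta>" for z
    by (rule partial_eqI) (auto simp: wave_lhs_def intro!: derivative_eq_intros)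
  have e': "germ_eq p (\<lambda>z. \<mu> z * wave_lhs z) (\<lambda>z. vf field_t \<rho> z + vf field_x \<sigma> z)"
    using e D_t_eq_vf[OF s(1)] D_x_eq_vf[OF s(2)] unfolding germ_eq_def by eventually_elim simp
  have "germ_eq p (\<lambda>z. ?P \<mu> z * wave_lhs z + \<mu> z * ?\<delta>)
     (\<lambda>z. (D_t (?P \<rho>) z + (if i = 0 then 0 else partial (U (i - 1) j) \<rho> z)) +
          (D_x (?P \<sigma>) z + (if j = 0 then 0 else partial (U i (j - 1)) \<sigma> z)))"
    using germ_eq_partial[OF e', of "U i j"] eventually_partial_mult[OF \<mu> smooth_near_wave_lhs]
      partial_add[OF smooth_near_vf[where c = field_t, OF smooth_near_field_t s(1)]
        smooth_near_vf[where c = field_x, OF smooth_near_field_x s(2)], of "U i j"]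
      partial_field_t[OF s(1), of i j] partial_field_x[OF s(2), of i j]
      D_t_eq_vf[OF smooth_near_partial[OF s(1)], of "U i j"] D_x_eq_vf[OF smooth_near_partial[OF s(2)], of "U i j"]
    unfolding germ_eq_def
  proof eventually_elim
    case (elim z)
    have "?P (\<lambda>z. \<mu> z * wave_lhs z) z = ?P \<mu> z * wave_lhs z + \<mu> z * ?\<delta>"
      using elim(2) wl by simp
    then show ?case using elim(1) unfolding elim(3-7) by simp
  qed
  from germ_eq_comp[OF affine_coords_continuous[OF affine_of_cone], of ?q, unfolded of_cone_to_cone[OF p], OF this]
  have *: "germ_eq ?q (\<lambda>y. ?P \<mu> (of_cone y) * wave_lhs (of_cone y) + \<mu> (of_cone y) * ?\<delta>)
     (\<lambda>y. (D_t (?P \<rho>) (of_cone y) + (if i = 0 then 0 else r (i - 1) j y)) +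
          (D_x (?P \<sigma>) (of_cone y) + (if j = 0 then 0 else s i (j - 1) y)))"
    unfolding r_def s_def .
  have w0: "wave_lhs (of_cone y) = 0" for y by (simp add: wave_lhs_def of_cone_def)
  from * D_t_of_cone[OF p smooth_near_partial[OF s(1)], of "U i j"] D_x_of_cone[OF p smooth_near_partial[OF s(2)], of "U i j"]
  show ?thesis unfolding germ_eq_def r_def s_def
  proof eventually_elim
    case (elim y)
    show ?case using elim(1) unfolding w0 elim(2,3) by simp
  qed
qed

lemma order_bound:
  assumes "smooth_near p f" "smooth_near p g"
  obtains N where "\<forall>\<^sub>F z in nhds p. \<forall>i j. N \<le> i + j \<longrightarrow> partial (U i j) f z = 0 \<and> partial (U i j) g z = 0"
proof -
  obtain S where S: "finite S" "\<forall>\<^sub>F z in nhds p. \<forall>v. v \<notin> S \<longrightarrow> partial v f z = 0 \<and> partial v g z = 0"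
    using common_finite_support[OF assms] .
  let ?ord = "\<lambda>v. case v of U i j \<Rightarrow> i + j | _ \<Rightarrow> 0"
  have "finite (?ord ` S)" using S(1) by simp
  then obtain N where N: "\<forall>n\<in>?ord ` S. n < N" unfolding finite_nat_set_iff_bounded by blast
  have "U i j \<notin> S" if "N \<le> i + j" for i j
  proof
    assume "U i j \<in> S"
    then have "?ord (U i j) < N" using N by blast
    then show False using that by simp
  qed
  with S(2) have "\<forall>\<^sub>F z in nhds p. \<forall>i j. N \<le> i + j \<longrightarrow> partial (U i j) f z = 0 \<and> partial (U i j) g z = 0"
    by (auto elim: eventually_mono)
  then show thesis by (rule that)
qed

text \<open>\<open>partial_u1 n\<close> is \<open>\<partial>/\<partial>u\<^bsub>1,n-1\<^esub>\<close> in the coordinates \<open>u\<^sub>0\<^sub>j, u\<^sub>1\<^sub>j\<close> of the solution set.\<close>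

definition partial_u1 :: "nat \<Rightarrow> (cone \<Rightarrow> real) \<Rightarrow> cone \<Rightarrow> real" where
  "partial_u1 n f y = partial (W True n) f y - partial (W False n) f y"

lemma smooth_near_partial_u1: "smooth_near q f \<Longrightarrow> smooth_near q (partial_u1 n f)"
  unfolding partial_u1_def[abs_def] by (intro smooth_near_diff smooth_near_partial)

text \<open>On solutions \<open>u\<^sub>i\<^sub>j\<close> equals \<open>u\<^bsub>1,i+j-1\<^esub>\<close> for odd \<open>i\<close> and \<open>u\<^bsub>0,i+j\<^esub>\<close> for even \<open>i\<close>.\<close>

lemma partial_u1_of_cone:
  assumes p: "p \<in> solution_set" and \<rho>: "smooth_near p \<rho>"
    and N: "\<forall>\<^sub>F z in nhds p. \<forall>i j. N \<le> i + j \<longrightarrow> partial (U i j) \<rho> z = 0"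
  shows "germ_eq (to_cone p) (partial_u1 (Suc k) (\<lambda>y. \<rho> (of_cone y)))
    (\<lambda>y. \<Sum>(i, j)\<in>{..<N} \<times> {..<N}. (if odd i \<and> i + j = Suc k then 1 else 0) * partial (U i j) \<rho> (of_cone y))"
proof -
  let ?q = "to_cone p" and ?n = "Suc k"
  have \<rho>': "smooth_near (of_cone ?q) \<rho>" using \<rho> by (simp add: of_cone_to_cone[OF p])
  obtain S where S: "finite S" "\<forall>\<^sub>F z in nhds (of_cone ?q). \<forall>w. w \<notin> S \<longrightarrow> partial w \<rho> z = 0"
    "\<forall>\<^sub>F y in nhds ?q. \<forall>v. partial v (\<lambda>y. \<rho> (of_cone y)) y = (\<Sum>w\<in>S. slope (\<lambda>y. of_cone y w) v * partial w \<rho> (of_cone y))"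
    using eventually_partial_affine[OF affine_of_cone, OF \<rho>'] .
  let ?c = "\<lambda>w. case w of U i j \<Rightarrow> if odd i \<and> i + j = ?n then 1 else 0 :: real | _ \<Rightarrow> 0"
  have slope: "slope (\<lambda>y. of_cone y w) (W True ?n) - slope (\<lambda>y. of_cone y w) (W False ?n) = ?c w" for w
    by (cases w) (auto simp: slope_def of_cone_def field_simps)
  let ?B = "(\<lambda>(i, j). U i j) ` ({..<N} \<times> {..<N})"
  note ev = eventually_comp[OF affine_coords_continuous[OF affine_of_cone]]
  from S(3) ev[where P = "\<lambda>z. \<forall>w. w \<notin> S \<longrightarrow> partial w \<rho> z = 0", OF S(2)]
    ev[where P = "\<lambda>z. \<forall>i j. N \<le> i + j \<longrightarrow> partial (U i j) \<rho> z = 0" and q = ?q, unfolded of_cone_to_cone[OF p], OF N]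
  show ?thesis unfolding germ_eq_def
  proof eventually_elim
    case (elim y)
    have "partial_u1 ?n (\<lambda>y. \<rho> (of_cone y)) y = (\<Sum>w\<in>S. ?c w * partial w \<rho> (of_cone y))"
      unfolding partial_u1_def elim(1)[rule_format] slope[symmetric] by (simp add: sum_subtractf left_diff_distrib)
    also have "\<dots> = (\<Sum>w\<in>S \<union> ?B. ?c w * partial w \<rho> (of_cone y))"
      by (rule sum.mono_neutral_left) (use S(1) elim(2) in auto)
    also have "\<dots> = (\<Sum>w\<in>?B. ?c w * partial w \<rho> (of_cone y))"
    proof (rule sum.mono_neutral_right)
      show "\<forall>w\<in>S \<union> ?B - ?B. ?c w * partial w \<rho> (of_cone y) = 0"
      proof
        fix w assume w: "w \<in> S \<union> ?B - ?B"
        show "?c w * partial w \<rho> (of_cone y) = 0"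
        proof (cases w)
          case (U i j)
          then have "N \<le> i + j" using w by (force simp: image_iff)
          then show ?thesis using elim(3) U by simp
        qed simp_all
      qed
    qed (use S(1) in auto)
    also have "\<dots> = (\<Sum>(i, j)\<in>{..<N} \<times> {..<N}. ?c (U i j) * partial (U i j) \<rho> (of_cone y))"
      by (subst sum.reindex) (auto simp: inj_on_def intro!: sum.cong)
    finally show ?case by simp
  qed
qed

text \<open>On solutions \<open>\<mu>\<close> is the variational derivative of the restricted density with respect to
  \<open>u\<^sub>t\<close>. Let \<open>R i\<close> be the sum over \<open>j\<close> of \<open>(- D\<^sub>x)\<^sup>j\<close> applied to \<open>\<partial>\<rho>/\<partial>u\<^sub>i\<^sub>j\<close>. The linearized identity
  gives \<open>D\<^sub>t (R i) + R (i - 1) = 0\<close> for \<open>i \<ge> 3\<close>, and \<open>R i = 0\<close> for large \<open>i\<close>, hence for all \<open>i \<ge> 2\<close>; for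
  \<open>i = 2\<close> it then says that \<open>\<mu> = R 1\<close>. The variational derivative of the restriction of \<open>\<rho>\<close> collects
  the derivatives with respect to all \<open>u\<^sub>i\<^sub>j\<close> with odd \<open>i\<close> and is the sum of \<open>D\<^sub>x\<^bsup>i-1\<^esup> (R i)\<close> over these \<open>i\<close>,
  of which only \<open>R 1\<close> remains.\<close>

lemma characteristic_on_solutions:
  assumes p: "p \<in> solution_set" and \<mu>: "smooth_near p \<mu>" and s: "smooth_near p \<rho>" "smooth_near p \<sigma>"
    and e: "germ_eq p (\<lambda>z. \<mu> z * wave_lhs z) (\<lambda>z. D_t \<rho> z + D_x \<sigma> z)"
  shows "\<exists>N. \<forall>M\<ge>N. germ_eq (to_cone p) (\<lambda>y. \<mu> (of_cone y))
    (adj M (\<lambda>k. partial_u1 (Suc k) (\<lambda>y. \<rho> (of_cone y))))"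
proof -
  let ?q = "to_cone p"
  define r where "r i j y = partial (U i j) \<rho> (of_cone y)" for i j y
  define t where "t i j y = partial (U i j) \<sigma> (of_cone y)" for i j y
  define m where "m y = \<mu> (of_cone y)" for y
  obtain N0 where N0: "\<forall>\<^sub>F z in nhds p. \<forall>i j. N0 \<le> i + j \<longrightarrow> partial (U i j) \<rho> z = 0 \<and> partial (U i j) \<sigma> z = 0"
    using order_bound[OF s] .
  \<comment> \<open>one more than the order bound, so that the boundary term of the telescoping sum vanishes\<close>
  define N where "N = Suc N0"
  note ev = eventually_comp[OF affine_coords_continuous[OF affine_of_cone]]
  have "\<forall>\<^sub>F y in nhds ?q. \<forall>i j. N0 \<le> i + j \<longrightarrow> r i j y = 0 \<and> t i j y = 0"
    using ev[where q = ?q and P = "\<lambda>z. \<forall>i j. N0 \<le> i + j \<longrightarrow> partial (U i j) \<rho> z = 0 \<and> partial (U i j) \<sigma> z = 0",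
        unfolded of_cone_to_cone[OF p], OF N0] by (simp add: r_def t_def)
  then have rt0: "zero_germ q' (r i j)" "zero_germ q' (t i j)" if "N0 \<le> i + j" "q' = ?q" for i j q'
    using that unfolding germ_eq_def by (auto elim: eventually_mono)
  have sr: "smooth_near ?q (r i j)" and st: "smooth_near ?q (t i j)" for i j
    unfolding r_def[abs_def] t_def[abs_def] by (rule smooth_near_of_cone[OF p smooth_near_partial]; rule s)+
  have sm: "smooth_near ?q m" unfolding m_def[abs_def] by (rule smooth_near_of_cone[OF p \<mu>])
  define R where "R i = adj N (r i)" for i
  have sR: "smooth_near ?q (R i)" for i unfolding R_def by (rule smooth_near_adj[OF sr])
  define t' where "t' i j = (\<lambda>y. if j = 0 then 0 else t i (j - 1) y)" for i j
  have st': "smooth_near ?q (t' i j)" for i j by (cases j) (simp_all add: t'_def smooth_near_const st)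
  have rec: "germ_eq ?q (\<lambda>y. if i = 2 then m y else 0) (\<lambda>y. cone_t (R i) y + R (i - 1) y)" if "1 \<le> i" for i
  proof -
    let ?L = "\<lambda>j y. if i = 2 \<and> j = 0 then m y else 0"
    have "germ_eq ?q (?L j) (\<lambda>y. (cone_t (r i j) y + r (i - 1) j y) + (cone_x (t' i (Suc j)) y + t' i j y))" for j
      using linearized_divergence[OF p \<mu> s e, of i j] that
      unfolding germ_eq_def r_def[abs_def] t'_def t_def[abs_def] m_def by (auto elim: eventually_mono)
    from adj_cong[of ?q ?L, OF this]
    have "germ_eq ?q (adj N ?L) (adj N (\<lambda>j y. (cone_t (r i j) y + r (i - 1) j y) + (cone_x (t' i (Suc j)) y + t' i j y)))" .
    moreover have "germ_eq ?q \<dots> (\<lambda>y. adj N (\<lambda>j y. cone_t (r i j) y + r (i - 1) j y) y + adj N (\<lambda>j y. cone_x (t' i (Suc j)) y + t' i j y) y)"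
      by (rule adj_add) (intro smooth_near_add smooth_near_cone_t smooth_near_cone_x sr st')+
    moreover have "germ_eq ?q (adj N (\<lambda>j y. cone_t (r i j) y + r (i - 1) j y)) (\<lambda>y. adj N (\<lambda>j. cone_t (r i j)) y + adj N (r (i - 1)) y)"
      by (rule adj_add) (intro smooth_near_cone_t sr)+
    moreover have "germ_eq ?q (adj N (\<lambda>j. cone_t (r i j))) (cone_t (adj N (r i)))" by (rule adj_cone_t[OF sr])
    moreover have "germ_eq ?q (adj N (\<lambda>j y. cone_x (t' i (Suc j)) y + t' i j y)) (\<lambda>y. t' i 0 y - (neg_x ^^ N) (t' i N) y)"
      by (rule adj_telescopes[OF st'])
    moreover have "zero_germ ?q ((neg_x ^^ N) (t' i N))"
      by (rule neg_x_iter_zero) (simp add: t'_def N_def rt0)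
    moreover have "germ_eq ?q (adj N ?L) (\<lambda>y. \<Sum>j<N. ?L j y)"
    proof (rule adj_termwise)
      show "germ_eq ?q ((neg_x ^^ j) (?L j)) (?L j)" for j
        using neg_x_iter_zero[of ?q "\<lambda>y. 0" j] by (cases "i = 2 \<and> j = 0") auto
    qed
    ultimately show ?thesis unfolding germ_eq_def
    proof eventually_elim
      case (elim y)
      have "(\<Sum>j<N. ?L j y) = (if i = 2 then m y else 0)"
        by (cases "i = 2") (simp_all add: N_def sum.lessThan_Suc_shift)
      then show ?case using elim by (simp add: R_def t'_def)
    qed
  qed
  have R0: "zero_germ ?q (R i)" if "2 \<le> i" for i
  proof (rule decreasing_induct[of N0 "\<lambda>i. zero_germ ?q (R i)" 2, OF _ _ that])
    show "zero_germ ?q (R i)" if "N0 < i" for i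
      unfolding R_def by (rule adj_zero) (rule rt0; use that in simp)
  next
    fix i assume i: "2 \<le> i" and *: "zero_germ ?q (R (Suc i))"
    have "zero_germ ?q (cone_t (R (Suc i)))"
      using vf_zero[OF *, of "cone_field True"] vf_zero[OF *, of "cone_field False"]
      unfolding germ_eq_def cone_t_def by eventually_elim simp
    moreover have "germ_eq ?q (\<lambda>y. if Suc i = 2 then m y else 0) (\<lambda>y. cone_t (R (Suc i)) y + R (Suc i - 1) y)"
      by (rule rec) simp
    ultimately show "zero_germ ?q (R i)" unfolding germ_eq_def
      by eventually_elim (use i in simp)
  qed
  have mR: "germ_eq ?q m (R 1)"
  proof -
    have "zero_germ ?q (cone_t (R 2))"
      using vf_zero[OF R0[of 2], of "cone_field True"] vf_zero[OF R0[of 2], of "cone_field False"]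
      unfolding germ_eq_def cone_t_def by (auto elim: eventually_elim2)
    moreover have "germ_eq ?q (\<lambda>y. if 2 = (2::nat) then m y else 0) (\<lambda>y. cone_t (R 2) y + R (2 - 1) y)"
      by (rule rec) simp
    ultimately show ?thesis unfolding germ_eq_def by eventually_elim simp
  qed
  let ?B = "{..<N} \<times> {..<N}"
  have u1: "germ_eq ?q (partial_u1 (Suc k) (\<lambda>y. \<rho> (of_cone y)))
      (\<lambda>y. \<Sum>x\<in>?B. (if odd (fst x) \<and> fst x + snd x = Suc k then 1 else 0) * r (fst x) (snd x) y)" for k
  proof -
    have "\<forall>\<^sub>F z in nhds p. \<forall>i j. N \<le> i + j \<longrightarrow> partial (U i j) \<rho> z = 0"
      using N0 by (auto elim!: eventually_mono simp: N_def)
    from partial_u1_of_cone[OF p s(1) this, of k] show ?thesis by (simp add: r_def case_prod_beta)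
  qed
  have "germ_eq ?q m (adj M (\<lambda>k. partial_u1 (Suc k) (\<lambda>y. \<rho> (of_cone y))))" if M: "2 * N \<le> M" for M
  proof -
    let ?c = "\<lambda>k x. if odd (fst x) \<and> fst x + snd x = Suc k then 1 else 0 :: real"
    let ?r = "\<lambda>x. r (fst x) (snd x)"
    have summand: "germ_eq ?q ((neg_x ^^ k) (partial_u1 (Suc k) (\<lambda>y. \<rho> (of_cone y))))
        (\<lambda>y. \<Sum>x\<in>?B. ?c k x * (neg_x ^^ k) (?r x) y)" for k
    proof -
      have "germ_eq ?q ((neg_x ^^ k) (\<lambda>y. \<Sum>x\<in>?B. ?c k x * ?r x y)) (\<lambda>y. \<Sum>x\<in>?B. (neg_x ^^ k) (\<lambda>y. ?c k x * ?r x y) y)"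
        by (rule neg_x_iter_sum) (intro smooth_near_mult smooth_near_const sr)
      moreover have "\<forall>\<^sub>F y in nhds ?q. \<forall>x\<in>?B. (neg_x ^^ k) (\<lambda>y. ?c k x * ?r x y) y = ?c k x * (neg_x ^^ k) (?r x) y"
      proof (rule eventually_ball_finite, simp, rule ballI)
        fix x
        show "\<forall>\<^sub>F y in nhds ?q. (neg_x ^^ k) (\<lambda>y. ?c k x * ?r x y) y = ?c k x * (neg_x ^^ k) (?r x) y"
          using neg_x_iter_cmult[OF sr[of "fst x" "snd x"], of k "?c k x"] unfolding germ_eq_def .
      qed
      ultimately have "germ_eq ?q ((neg_x ^^ k) (\<lambda>y. \<Sum>x\<in>?B. ?c k x * ?r x y)) (\<lambda>y. \<Sum>x\<in>?B. ?c k x * (neg_x ^^ k) (?r x) y)"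
        unfolding germ_eq_def by eventually_elim simp
      with neg_x_iter_cong[OF u1, of k k] show ?thesis by (rule germ_eq_trans)
    qed
    have adjM: "germ_eq ?q (adj M (\<lambda>k. partial_u1 (Suc k) (\<lambda>y. \<rho> (of_cone y)))) (\<lambda>y. \<Sum>k<M. \<Sum>x\<in>?B. ?c k x * (neg_x ^^ k) (?r x) y)"
      by (rule adj_termwise) (rule summand)
    \<comment> \<open>the terms are regrouped by the order \<open>i\<close> in \<open>t\<close>, using \<open>k = (i - 1) + j\<close>\<close>
    have swap: "(\<Sum>k<M. \<Sum>x\<in>?B. ?c k x * (neg_x ^^ k) (?r x) y) =
        (\<Sum>i<N. if odd i then \<Sum>j<N. (neg_x ^^ (i - 1)) ((neg_x ^^ j) (r i j)) y else 0)" for y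
    proof -
      have "(\<Sum>k<M. \<Sum>x\<in>?B. ?c k x * (neg_x ^^ k) (?r x) y) = (\<Sum>x\<in>?B. \<Sum>k<M. ?c k x * (neg_x ^^ k) (?r x) y)"
        by (rule sum.swap)
      also have "\<dots> = (\<Sum>x\<in>?B. if odd (fst x) then (neg_x ^^ (fst x - 1)) ((neg_x ^^ snd x) (?r x)) y else 0)"
      proof (rule sum.cong[OF refl])
        fix x assume x: "x \<in> ?B"
        show "(\<Sum>k<M. ?c k x * (neg_x ^^ k) (?r x) y) =
            (if odd (fst x) then (neg_x ^^ (fst x - 1)) ((neg_x ^^ snd x) (?r x)) y else 0)"
        proof (cases "odd (fst x)")
          case True
          define k0 where "k0 = fst x - 1 + snd x"
          have k0: "fst x + snd x = Suc k \<longleftrightarrow> k = k0" for k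
            using True by (cases "fst x") (auto simp: k0_def)
          have "k0 < M" using x M by (auto simp: k0_def)
          have "(\<Sum>k<M. ?c k x * (neg_x ^^ k) (?r x) y) = (\<Sum>k<M. if k = k0 then (neg_x ^^ k) (?r x) y else 0)"
            by (rule sum.cong[OF refl]) (simp add: True k0)
          also have "\<dots> = (neg_x ^^ k0) (?r x) y" using \<open>k0 < M\<close> by (simp add: sum.delta)
          finally show ?thesis using True by (simp add: k0_def funpow_add)
        qed simp
      qed
      also have "\<dots> = (\<Sum>i<N. \<Sum>j<N. if odd i then (neg_x ^^ (i - 1)) ((neg_x ^^ j) (r i j)) y else 0)"
        by (simp add: sum.cartesian_product case_prod_beta)
      also have "\<dots> = (\<Sum>i<N. if odd i then \<Sum>j<N. (neg_x ^^ (i - 1)) ((neg_x ^^ j) (r i j)) y else 0)"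
        by (rule sum.cong[OF refl]) simp
      finally show ?thesis .
    qed
    have "\<forall>\<^sub>F y in nhds ?q. \<forall>i\<in>{..<N}. (\<Sum>j<N. (neg_x ^^ (i - 1)) ((neg_x ^^ j) (r i j)) y) = (neg_x ^^ (i - 1)) (R i) y"
    proof (rule eventually_ball_finite, simp, rule ballI)
      fix i
      have "germ_eq ?q ((neg_x ^^ (i - 1)) (\<lambda>y. \<Sum>j<N. (neg_x ^^ j) (r i j) y)) (\<lambda>y. \<Sum>j<N. (neg_x ^^ (i - 1)) ((neg_x ^^ j) (r i j)) y)"
        by (rule neg_x_iter_sum) (rule smooth_near_neg_x_iter[OF sr])
      then show "\<forall>\<^sub>F y in nhds ?q. (\<Sum>j<N. (neg_x ^^ (i - 1)) ((neg_x ^^ j) (r i j)) y) = (neg_x ^^ (i - 1)) (R i) y"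
        unfolding germ_eq_def R_def adj_def[abs_def] by eventually_elim simp
    qed
    moreover have "\<forall>\<^sub>F y in nhds ?q. \<forall>i\<in>{2..<N}. (neg_x ^^ (i - 1)) (R i) y = 0"
      by (rule eventually_ball_finite) (use neg_x_iter_zero[OF R0] in \<open>auto simp: germ_eq_def\<close>)
    moreover have "zero_germ ?q (R 1)" if "N < 2"
      unfolding R_def by (rule adj_zero) (rule rt0; use that in \<open>simp add: N_def\<close>)
    then have "\<forall>\<^sub>F y in nhds ?q. N < 2 \<longrightarrow> R 1 y = 0" by (cases "N < 2") (auto simp: germ_eq_def)
    moreover note adjM mR
    ultimately show ?thesis unfolding germ_eq_def
    proof eventually_elim
      case (elim y)
      have "adj M (\<lambda>k. partial_u1 (Suc k) (\<lambda>y. \<rho> (of_cone y))) y = (\<Sum>i<N. if odd i then (neg_x ^^ (i - 1)) (R i) y else 0)"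
        unfolding elim(4) swap by (rule sum.cong[OF refl]) (use elim(1) in auto)
      also have "\<dots> = (\<Sum>i<N. if i = 1 then R 1 y else 0)"
      proof (rule sum.cong[OF refl])
        fix i assume "i \<in> {..<N}"
        then show "(if odd i then (neg_x ^^ (i - 1)) (R i) y else 0) = (if i = 1 then R 1 y else 0)"
          using elim(2) by (cases "2 \<le> i") (auto simp: not_le less_2_cases_iff)
      qed
      also have "\<dots> = R 1 y" using elim(3) by (auto simp: sum.delta)
      finally show ?case using elim(5) by simp
    qed
  qed
  then show ?thesis unfolding m_def[abs_def] by blast
qed

lemma partial_u1_strand: "partial_u1 (Suc k) (\<lambda>y. F (strand b y)) y = sg b * partial (Suc k) F (strand b y)"
proof -
  have "strand b (y(W b n := s)) = (strand b y)(n := s)" for n s by (auto simp: strand_def)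
  then have "partial (W b (Suc k)) (\<lambda>y. F (strand b y)) y = partial (Suc k) F (strand b y)"
    by (simp add: partial_def) (simp add: strand_def)
  moreover have "partial (W (\<not> b) (Suc k)) (\<lambda>y. F (strand b y)) y = 0" by (rule partial_strand)
  ultimately show ?thesis by (cases b) (simp_all add: partial_u1_def sg_def)
qed

lemma cone_x_strand:
  assumes "smooth_near (strand b q) F"
  shows "germ_eq q (cone_x (\<lambda>y. F (strand b y))) (\<lambda>y. D_check F (strand b y))"
  using cone_D_strand[OF assms, of True] cone_D_strand[OF assms, of False]
  unfolding germ_eq_def cone_x_def by eventually_elim simp

lemma neg_x_iter_strand:
  assumes "smooth_near (strand b q) F"
  shows "germ_eq q ((neg_x ^^ k) (\<lambda>y. F (strand b y))) (\<lambda>y. (neg_D ^^ k) F (strand b y))"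
proof (induction k)
  case (Suc k)
  have "germ_eq q (neg_x ((neg_x ^^ k) (\<lambda>y. F (strand b y)))) (neg_x (\<lambda>y. (neg_D ^^ k) F (strand b y)))"
    by (rule neg_x_cong[OF Suc])
  also have "germ_eq q \<dots> (\<lambda>y. neg_D ((neg_D ^^ k) F) (strand b y))"
    using cone_x_strand[OF smooth_near_neg_D_iter[OF assms], of k]
    unfolding germ_eq_def neg_x_def by eventually_elim simp
  finally show ?case by (simp only: funpow.simps o_def)
qed simp

text \<open>On functions of one strand the variational derivative with respect to \<open>u\<^sub>t\<close> is, up to sign,
  the Euler operator of the strand.\<close>

lemma adj_partial_u1_strand:
  assumes F: "smooth_near (strand b q) F"
  shows "\<exists>N. \<forall>M\<ge>N. germ_eq q (adj M (\<lambda>k. partial_u1 (Suc k) (\<lambda>y. F (strand b y)))) (\<lambda>y. sg b * euler_check F (strand b y))"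
proof -
  obtain N where N: "\<forall>M\<ge>N. germ_eq (strand b q) (euler_check F) (\<lambda>y. \<Sum>k<M. (neg_D ^^ k) (partial (Suc k) F) y)"
    using euler_check_eq_sum[OF F] by blast
  have "germ_eq q (adj M (\<lambda>k. partial_u1 (Suc k) (\<lambda>y. F (strand b y)))) (\<lambda>y. sg b * euler_check F (strand b y))" if "N \<le> M" for M
  proof -
    have "germ_eq q (adj M (\<lambda>k. partial_u1 (Suc k) (\<lambda>y. F (strand b y)))) (\<lambda>y. \<Sum>k<M. sg b * (neg_D ^^ k) (partial (Suc k) F) (strand b y))"
    proof (rule adj_termwise)
      fix k
      have "partial_u1 (Suc k) (\<lambda>y. F (strand b y)) = (\<lambda>y. sg b * partial (Suc k) F (strand b y))"
        by (rule ext) (rule partial_u1_strand)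
      with neg_x_iter_cmult[OF smooth_near_strand[OF smooth_near_partial[OF F]], of k "sg b" "Suc k"]
        neg_x_iter_strand[OF smooth_near_partial[OF F], of k "Suc k"]
      show "germ_eq q ((neg_x ^^ k) (partial_u1 (Suc k) (\<lambda>y. F (strand b y)))) (\<lambda>y. sg b * (neg_D ^^ k) (partial (Suc k) F) (strand b y))"
        unfolding germ_eq_def by (auto elim: eventually_elim2)
    qed
    moreover have "germ_eq q (\<lambda>y. euler_check F (strand b y)) (\<lambda>y. \<Sum>k<M. (neg_D ^^ k) (partial (Suc k) F) (strand b y))"
      by (rule germ_eq_comp[OF affine_coords_continuous[OF affine_strand], OF N[rule_format, OF that]])
    ultimately show ?thesis unfolding germ_eq_def by eventually_elim (simp add: sum_distrib_left)
  qed
  then show ?thesis by blast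
qed

lemma adj_partial_u1_cone_x:
  assumes H: "smooth_near q H"
  shows "\<exists>N. \<forall>M\<ge>N. zero_germ q (adj M (\<lambda>k. partial_u1 (Suc k) (cone_x H)))"
proof -
  define g where "g k = (\<lambda>y. if k = 0 then 0 else partial_u1 k H y)" for k
  have g: "smooth_near q (g k)" for k
    by (cases k) (simp_all add: g_def smooth_near_const smooth_near_partial_u1[OF H])
  have step: "germ_eq q (partial_u1 (Suc k) (cone_x H)) (\<lambda>y. cone_x (g (Suc k)) y + g k y)" for k
  proof -
    let ?p = "\<lambda>b. partial (W b (Suc k))"
    have 1: "germ_eq q (?p b (cone_x H)) (\<lambda>y. ?p b (cone_D True H) y + ?p b (cone_D False H) y)" for b
      unfolding cone_x_def[abs_def] by (rule partial_add) (rule smooth_near_cone_D[OF H])+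
    have 2: "germ_eq q (?p b (cone_D b' H)) (\<lambda>y. cone_D b' (?p b H) y + commutator_term b' (W b (Suc k)) H y)" for b b'
      by (rule partial_cone_D[OF H])
    have 3: "germ_eq q (cone_D b (partial_u1 (Suc k) H)) (\<lambda>y. cone_D b (?p True H) y - cone_D b (?p False H) y)" for b
      unfolding partial_u1_def[abs_def] by (rule vf_diff) (rule smooth_near_partial[OF H])+
    show ?thesis
      using 1[of True] 1[of False] 2[of True True] 2[of True False] 2[of False True] 2[of False False] 3[of True] 3[of False]
      unfolding germ_eq_def
    proof eventually_elim
      case (elim y)
      have "g (Suc k) = partial_u1 (Suc k) H" by (simp add: g_def)
      moreover have "partial_u1 (Suc k) (cone_x H) y = ?p True (cone_x H) y - ?p False (cone_x H) y"
        by (simp add: partial_u1_def)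
      moreover have "g k y = commutator_term True (W True (Suc k)) H y - commutator_term False (W False (Suc k)) H y"
        by (simp add: g_def commutator_term_def partial_u1_def)
      moreover have "commutator_term False (W True (Suc k)) H y = 0" "commutator_term True (W False (Suc k)) H y = 0"
        by (simp_all add: commutator_term_def)
      ultimately show ?case using elim by (simp add: cone_x_def[of "partial_u1 (Suc k) H"])
    qed
  qed
  obtain N1 where N1: "\<And>n. N1 < n \<Longrightarrow> zero_germ q (partial (W True n) H)" using finite_order[OF H, where b = True] by blast
  obtain N2 where N2: "\<And>n. N2 < n \<Longrightarrow> zero_germ q (partial (W False n) H)" using finite_order[OF H, where b = False] by blast
  have "zero_germ q (adj M (\<lambda>k. partial_u1 (Suc k) (cone_x H)))" if M: "N1 + N2 + 1 \<le> M" for M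
  proof -
    have "zero_germ q (partial_u1 M H)"
      using N1[of M] N2[of M] M unfolding germ_eq_def partial_u1_def by (auto elim: eventually_elim2)
    then have "zero_germ q ((neg_x ^^ M) (g M))" using M by (intro neg_x_iter_zero) (simp add: g_def)
    with germ_eq_trans[OF adj_cong[of q "\<lambda>k. partial_u1 (Suc k) (cone_x H)" "\<lambda>k y. cone_x (g (Suc k)) y + g k y" M, OF step]
        adj_telescopes[of q g M, OF g]] show ?thesis
      unfolding germ_eq_def by (auto simp: g_def elim: eventually_elim2)
  qed
  then show ?thesis by blast
qed

lemma partial_u1_add:
  assumes "smooth_near q f" "smooth_near q g"
  shows "germ_eq q (partial_u1 n (\<lambda>y. f y + g y)) (\<lambda>y. partial_u1 n f y + partial_u1 n g y)"
  using partial_add[OF assms, of "W True n"] partial_add[OF assms, of "W False n"]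
  unfolding germ_eq_def partial_u1_def by eventually_elim simp

lemma adj_partial_u1_add:
  assumes "smooth_near q f" "smooth_near q g"
  shows "germ_eq q (adj N (\<lambda>k. partial_u1 (Suc k) (\<lambda>y. f y + g y))) (\<lambda>y. adj N (\<lambda>k. partial_u1 (Suc k) f) y + adj N (\<lambda>k. partial_u1 (Suc k) g) y)"
  using germ_eq_trans[OF adj_cong[OF partial_u1_add[OF assms]] adj_add[OF smooth_near_partial_u1[OF assms(1)] smooth_near_partial_u1[OF assms(2)]]] .

text \<open>The restricted density is \<open>F - G + D\<^sub>x H\<close>. Its variational derivative with respect to \<open>u\<^sub>t\<close> is
  \<open>\<mu>\<close> on the one hand, and on the other hand the special characteristic of \<open>F\<close> and \<open>G\<close>.\<close>

lemma special_representative: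
  assumes p: "p \<in> solution_set" and \<mu>: "\<mu> \<in> characteristics p"
  shows "\<exists>\<nu>\<in>special_symmetries p. vanishes_on_solutions p (\<lambda>z. \<mu> z - \<nu> z)"
proof -
  let ?q = "to_cone p"
  obtain \<rho> \<sigma> where sm: "smooth_near p \<mu>" and s: "smooth_near p \<rho>" "smooth_near p \<sigma>"
    and e: "germ_eq p (\<lambda>z. \<mu> z * wave_lhs z) (\<lambda>z. D_t \<rho> z + D_x \<sigma> z)"
    using characteristicsE[OF \<mu>] .
  have "vanishes_on_solutions p (\<lambda>z. D_t \<rho> z + D_x \<sigma> z)"
  proof -
    have w0: "wave_lhs z = 0" if "z \<in> solution_set" for z
    proof -
      have "z (U (0 + 2) 0) = z (U 0 (0 + 2))" using that unfolding solution_set_def by blast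
      then show ?thesis by (simp only: wave_lhs_def add_0 diff_self)
    qed
    show ?thesis using e unfolding germ_eq_def vanishes_on_solutions_def
    proof eventually_elim
      case (elim z)
      show ?case
      proof
        assume "z \<in> solution_set"
        then show "D_t \<rho> z + D_x \<sigma> z = 0" using w0[of z] elim[symmetric] by simp
      qed
    qed
  qed
  with s have cc: "(\<rho>, \<sigma>) \<in> conserved_currents p" by (simp add: conserved_currents_def)
  obtain F G H where FG: "smooth_near (cone_coord False p) F" "smooth_near (cone_coord True p) G"
    and H: "smooth_near ?q H"
    and \<rho>: "germ_eq ?q (\<lambda>y. \<rho> (of_cone y)) (\<lambda>y. F (strand False y) - G (strand True y) + cone_x H y)"
    and "germ_eq ?q (\<lambda>y. \<sigma> (of_cone y)) (\<lambda>y. F (strand False y) + G (strand True y) - cone_t H y)"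
    using conserved_split[OF p cc] .
  have FG': "smooth_near (strand False ?q) F" "smooth_near (strand True ?q) G" using FG by (simp_all add: strand_to_cone)
  let ?F = "\<lambda>y. F (strand False y)" and ?G = "\<lambda>y. G (strand True y)"
  note sF = smooth_near_strand[OF FG'(1)] and sG = smooth_near_strand[OF FG'(2)] and sH = smooth_near_cone_x[OF H]
  have \<rho>': "germ_eq ?q (\<lambda>y. \<rho> (of_cone y) + ?G y) (\<lambda>y. ?F y + cone_x H y)"
    using \<rho> unfolding germ_eq_def by eventually_elim simp
  obtain N1 where N1: "\<forall>M\<ge>N1. germ_eq ?q (\<lambda>y. \<mu> (of_cone y)) (adj M (\<lambda>k. partial_u1 (Suc k) (\<lambda>y. \<rho> (of_cone y))))"
    using characteristic_on_solutions[OF p sm s e] by blast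
  obtain N2 where N2: "\<forall>M\<ge>N2. germ_eq ?q (adj M (\<lambda>k. partial_u1 (Suc k) ?F)) (\<lambda>y. sg False * euler_check F (strand False y))"
    using adj_partial_u1_strand[OF FG'(1)] by blast
  obtain N3 where N3: "\<forall>M\<ge>N3. germ_eq ?q (adj M (\<lambda>k. partial_u1 (Suc k) ?G)) (\<lambda>y. sg True * euler_check G (strand True y))"
    using adj_partial_u1_strand[OF FG'(2)] by blast
  obtain N4 where N4: "\<forall>M\<ge>N4. zero_germ ?q (adj M (\<lambda>k. partial_u1 (Suc k) (cone_x H)))"
    using adj_partial_u1_cone_x[OF H] by blast
  define M where "M = N1 + N2 + N3 + N4"
  have jc: "germ_eq ?q (partial_u1 n f) (partial_u1 n g)" if "germ_eq ?q f g" for n f g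
    using germ_eq_partial[OF that, of "W True n"] germ_eq_partial[OF that, of "W False n"]
    unfolding germ_eq_def partial_u1_def by eventually_elim simp
  have "germ_eq ?q (adj M (\<lambda>k. partial_u1 (Suc k) (\<lambda>y. \<rho> (of_cone y) + ?G y))) (adj M (\<lambda>k. partial_u1 (Suc k) (\<lambda>y. ?F y + cone_x H y)))"
    by (rule adj_cong) (rule jc[OF \<rho>'])
  moreover note adj_partial_u1_add[OF smooth_near_of_cone[OF p s(1)] sG, of M] adj_partial_u1_add[OF sF sH, of M]
  moreover have "germ_eq ?q (\<lambda>y. \<mu> (of_cone y)) (adj M (\<lambda>k. partial_u1 (Suc k) (\<lambda>y. \<rho> (of_cone y))))"
    "germ_eq ?q (adj M (\<lambda>k. partial_u1 (Suc k) ?F)) (\<lambda>y. sg False * euler_check F (strand False y))"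
    "germ_eq ?q (adj M (\<lambda>k. partial_u1 (Suc k) ?G)) (\<lambda>y. sg True * euler_check G (strand True y))"
    "zero_germ ?q (adj M (\<lambda>k. partial_u1 (Suc k) (cone_x H)))"
    using N1 N2 N3 N4 by (simp_all add: M_def)
  ultimately have \<mu>e: "germ_eq ?q (\<lambda>y. \<mu> (of_cone y)) (\<lambda>y. - euler_check F (strand False y) - euler_check G (strand True y))"
    unfolding germ_eq_def by eventually_elim (simp add: sg_def)
  let ?\<nu> = "\<lambda>z. - euler_check F (cone_coord False z) - euler_check G (cone_coord True z)"
  have "?\<nu> \<in> special_symmetries p" unfolding special_iff using FG germ_eq_refl by blast
  moreover have "vanishes_on_solutions p (\<lambda>z. \<mu> z - ?\<nu> z)"
    unfolding vanishes_iff[OF p] cone_coord_of_cone using \<mu>e unfolding germ_eq_def by eventually_elim simp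
  ultimately show ?thesis by (intro bexI[of _ ?\<nu>])
qed

lemma euler_check_linear:
  assumes "smooth_near x F" "smooth_near x G"
  shows "germ_eq x (euler_check (\<lambda>y. c * F y + G y)) (\<lambda>y. c * euler_check F y + euler_check G y)"
proof -
  have D: "germ_eq x (neg_D f) (neg_D g)" if "germ_eq x f g" for f g
    using eventually_partial_cong[OF that] unfolding germ_eq_def D_check_def
    by eventually_elim (simp cong: if_cong)
  have it: "germ_eq x ((neg_D ^^ k) f) (\<lambda>y. c * (neg_D ^^ k) g y + (neg_D ^^ k) h y)"
    if "smooth_near x g" "smooth_near x h" "germ_eq x f (\<lambda>y. c * g y + h y)" for k f g h
  proof (induction k)
    case (Suc k)
    have "germ_eq x (neg_D ((neg_D ^^ k) f)) (neg_D (\<lambda>y. c * (neg_D ^^ k) g y + (neg_D ^^ k) h y))"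
      by (rule D[OF Suc])
    also have "germ_eq x \<dots> (\<lambda>y. c * neg_D ((neg_D ^^ k) g) y + neg_D ((neg_D ^^ k) h) y)"
      using D_check_linear[OF smooth_near_neg_D_iter[OF that(1)] smooth_near_neg_D_iter[OF that(2)], of c k k]
      unfolding germ_eq_def by eventually_elim simp
    finally show ?case by (simp only: funpow.simps o_def)
  qed (use that(3) in simp)
  obtain N1 where N1: "\<forall>M\<ge>N1. germ_eq x (euler_check F) (\<lambda>y. \<Sum>k<M. (neg_D ^^ k) (partial (Suc k) F) y)"
    using euler_check_eq_sum[OF assms(1)] by blast
  obtain N2 where N2: "\<forall>M\<ge>N2. germ_eq x (euler_check G) (\<lambda>y. \<Sum>k<M. (neg_D ^^ k) (partial (Suc k) G) y)"
    using euler_check_eq_sum[OF assms(2)] by blast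
  obtain N3 where N3: "\<forall>M\<ge>N3. germ_eq x (euler_check (\<lambda>y. c * F y + G y)) (\<lambda>y. \<Sum>k<M. (neg_D ^^ k) (partial (Suc k) (\<lambda>y. c * F y + G y)) y)"
    using euler_check_eq_sum[OF smooth_near_linear[OF assms]] by blast
  define M where "M = N1 + N2 + N3"
  have N: "germ_eq x (euler_check F) (\<lambda>y. \<Sum>k<M. (neg_D ^^ k) (partial (Suc k) F) y)"
    "germ_eq x (euler_check G) (\<lambda>y. \<Sum>k<M. (neg_D ^^ k) (partial (Suc k) G) y)"
    "germ_eq x (euler_check (\<lambda>y. c * F y + G y)) (\<lambda>y. \<Sum>k<M. (neg_D ^^ k) (partial (Suc k) (\<lambda>y. c * F y + G y)) y)"
    using N1 N2 N3 by (simp_all add: M_def)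
  have pl: "germ_eq x (partial l (\<lambda>y. c * F y + G y)) (\<lambda>y. c * partial l F y + partial l G y)" for l
    using partial_add[OF smooth_near_mult[OF smooth_near_const[of x c] assms(1)] assms(2), of l]
      eventually_partial_cmult[OF assms(1), of c] unfolding germ_eq_def by eventually_elim simp
  have "\<forall>\<^sub>F y in nhds x. \<forall>k\<in>{..<M}. (neg_D ^^ k) (partial (Suc k) (\<lambda>y. c * F y + G y)) y =
      c * (neg_D ^^ k) (partial (Suc k) F) y + (neg_D ^^ k) (partial (Suc k) G) y"
  proof (rule eventually_ball_finite, simp, rule ballI)
    fix k
    show "\<forall>\<^sub>F y in nhds x. (neg_D ^^ k) (partial (Suc k) (\<lambda>y. c * F y + G y)) y =
        c * (neg_D ^^ k) (partial (Suc k) F) y + (neg_D ^^ k) (partial (Suc k) G) y"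
      using it[OF smooth_near_partial[OF assms(1)] smooth_near_partial[OF assms(2)] pl] unfolding germ_eq_def .
  qed
  with N show ?thesis unfolding germ_eq_def
    by eventually_elim (simp add: sum.distrib sum_distrib_left)
qed

lemma euler_check_zero: "euler_check (\<lambda>y. 0) y = 0"
proof -
  have 1: "(neg_D ^^ k) (\<lambda>y. 0) = (\<lambda>y. 0)" for k
    by (rule ext) (rule neg_D_iter_zero_on[of UNIV], auto)
  have 2: "partial l (\<lambda>y :: nat \<Rightarrow> real. 0) = (\<lambda>y. 0)" for l by (rule ext) simp
  have "(\<lambda>l. if l \<ge> 1 then (neg_D ^^ (l - 1)) (partial l (\<lambda>y. 0)) y else 0) = (\<lambda>l. 0)"
    unfolding 2 1 by simp
  then show ?thesis unfolding euler_check_def by (simp only:) simp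
qed

lemma subspace_special_symmetries: "subspace (special_symmetries p)"
proof (rule subspaceI_linear)
  have "germ_eq p (\<lambda>z. 0) (\<lambda>z. - euler_check (\<lambda>y. 0) (cone_coord False z) - euler_check (\<lambda>y. 0) (cone_coord True z))"
    by (simp add: euler_check_zero)
  then show "0 \<in> special_symmetries p" unfolding special_iff zero_fun_eq using smooth_near_const by blast
next
  fix c \<mu> \<mu>' assume *: "\<mu> \<in> special_symmetries p" "\<mu>' \<in> special_symmetries p"
  obtain F G where s: "smooth_near (cone_coord False p) F" "smooth_near (cone_coord True p) G"
    and e: "germ_eq p \<mu> (\<lambda>z. - euler_check F (cone_coord False z) - euler_check G (cone_coord True z))"
    using *(1) unfolding special_iff by blast
  obtain F' G' where s': "smooth_near (cone_coord False p) F'" "smooth_near (cone_coord True p) G'"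
    and e': "germ_eq p \<mu>' (\<lambda>z. - euler_check F' (cone_coord False z) - euler_check G' (cone_coord True z))"
    using *(2) unfolding special_iff by blast
  note lin = germ_eq_comp[OF affine_coords_continuous[OF affine_cone_coord], OF euler_check_linear]
  have "germ_eq p (\<lambda>z. c * \<mu> z + \<mu>' z) (\<lambda>z. - euler_check (\<lambda>y. c * F y + F' y) (cone_coord False z)
      - euler_check (\<lambda>y. c * G y + G' y) (cone_coord True z))"
    using e e' lin[OF s(1) s'(1), of c] lin[OF s(2) s'(2), of c] unfolding germ_eq_def
  proof eventually_elim
    case (elim z)
    show ?case unfolding elim by (simp add: algebra_simps)
  qed
  then show "c *\<^sub>R \<mu> + \<mu>' \<in> special_symmetries p"
    unfolding special_iff fun_linear using smooth_near_linear[OF s(1) s'(1), of c] smooth_near_linear[OF s(2) s'(2), of c]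
    by blast
qed

text \<open>The special symmetries are functions of coordinates of the solution set, so that they are
  determined by their restriction to it.\<close>

lemma null_germs_eq:
  assumes p: "p \<in> solution_set"
  shows "null_germs p = special_symmetries p \<inter> trivial_symmetries p"
proof (intro equalityI subsetI)
  fix \<mu> assume "\<mu> \<in> null_germs p"
  then have z: "zero_germ p \<mu>" by (simp add: null_germs_def)
  have "germ_eq p \<mu> (\<lambda>z. - euler_check (\<lambda>y. 0) (cone_coord False z) - euler_check (\<lambda>y. 0) (cone_coord True z))"
    using z by (simp add: euler_check_zero)
  then have "\<mu> \<in> special_symmetries p" unfolding special_iff using smooth_near_const by blast
  moreover from this have "\<mu> \<in> variational_symmetries p"
    using special_subset_characteristics variational_symmetries_eq by blast
  moreover have "vanishes_on_solutions p \<mu>"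
    using z unfolding vanishes_on_solutions_def germ_eq_def by eventually_elim simp
  ultimately show "\<mu> \<in> special_symmetries p \<inter> trivial_symmetries p" by (simp add: trivial_symmetries_def)
next
  fix \<mu> assume "\<mu> \<in> special_symmetries p \<inter> trivial_symmetries p"
  then obtain F G where e: "germ_eq p \<mu> (\<lambda>z. - euler_check F (cone_coord False z) - euler_check G (cone_coord True z))"
    and v: "vanishes_on_solutions p \<mu>"
    unfolding special_iff Int_iff trivial_symmetries_def mem_Collect_eq by blast
  let ?f = "\<lambda>y. - euler_check F (strand False y) - euler_check G (strand True y)"
  have "germ_eq (to_cone p) (\<lambda>y. \<mu> (of_cone y)) ?f"
    using restrict_to_cone[OF p, of \<mu> "\<lambda>a b. - euler_check F a - euler_check G b"] e by simp
  from germ_eq_trans[OF germ_eq_sym[OF this] v[unfolded vanishes_iff[OF p]]] have "zero_germ (to_cone p) ?f" .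
  from lift_from_cone[OF this] e show "\<mu> \<in> null_germs p"
    unfolding null_germs_def mem_Collect_eq strand_to_cone by (meson germ_eq_trans)
qed

theorem variational_symmetries_quotient:
  assumes p: "p \<in> solution_set"
  shows "naturally_isomorphic (special_symmetries p) (null_germs p)
    (variational_symmetries p) (trivial_symmetries p)"
proof (rule naturally_isomorphicI[OF subspace_special_symmetries null_germs_eq[OF p] _ subspace_trivial_symmetries])
  show "subspace (variational_symmetries p)" unfolding variational_symmetries_eq by (rule subspace_characteristics)
  show "trivial_symmetries p \<subseteq> variational_symmetries p" by (auto simp: trivial_symmetries_def)
  show sub: "special_symmetries p \<subseteq> variational_symmetries p"
    unfolding variational_symmetries_eq by (rule special_subset_characteristics)
  fix \<mu> assume \<mu>: "\<mu> \<in> variational_symmetries p"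
  obtain \<nu> where \<nu>: "\<nu> \<in> special_symmetries p" "vanishes_on_solutions p (\<lambda>z. \<mu> z - \<nu> z)"
    using special_representative[OF p] \<mu> unfolding variational_symmetries_eq by blast
  have "\<mu> - \<nu> \<in> variational_symmetries p"
    using subspace_diff[OF subspace_characteristics, of \<mu> p \<nu>] \<mu> \<nu>(1) sub unfolding variational_symmetries_eq by blast
  moreover have "vanishes_on_solutions p (\<mu> - \<nu>)" using \<nu>(2) by (simp add: vanishes_on_solutions_def)
  ultimately show "\<exists>\<nu>\<in>special_symmetries p. \<mu> - \<nu> \<in> trivial_symmetries p"
    using \<nu>(1) unfolding trivial_symmetries_def by blast
qed

theorem theorem5:
  fixes p :: jet
  assumes "p \<in> solution_set"
  shows
    "V0_check p = V_check p \<inter> trivial_currents p \<and>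
     naturally_isomorphic (V_check p) (V0_check p) (conserved_currents p) (trivial_currents p) \<and>
     variational_symmetries p = characteristics p \<and>
     naturally_isomorphic (special_symmetries p) (null_germs p)
       (variational_symmetries p) (trivial_symmetries p)"
  using V0_check_eq[OF assms] conservation_laws[OF assms] variational_symmetries_eq
    variational_symmetries_quotient[OF assms] by blast

end
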